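(* Let $(\Omega,\sigma)$ be a minimal continuous flow on a compact metric space, let $a,b:\Omega\to\mathbb{R}$ be continuous, and let $g:\Omega\times\mathbb{R}\to\mathbb{R}$ satisfy: - the partial derivative $g_x$ exists, and $g,g_x$ are continuous on $\Omega\times\mathbb{R}$; - there exist real numbers $r_1\le r_2$ such that $g(\omega,x)=0$ if $r_1\le x\le r_2$, $g(\omega,x)>0$ if $x<r_1$, $g(\omega,x)<0$ if $x>r_2$, and, in case $r_1=r_2$, $g_x(\omega,r_1)=0$ for all $\omega\in\Omega$; - $\lim_{x\to\pm\infty}g(\omega,x)/x=-\infty$ uniformly on $\Omega$; - $g_x(\omega,x)<0$ whenever $x\notin[r_1,r_2]$. Let $(\Omega\times\mathbb{R},\tau)$ be the flow induced by the family $x'=a(\omega\cdot t)\,x+b(\omega\cdot t)+g(\omega\cdot t,x)$, $\omega\in\Omega$, let $\mathcal{A}=\bigcup_{\omega\in\Omega}\big(\{\omega\}\times[\alpha_{\mathcal{A}}(\omega),\beta_{\mathcal{A}}(\omega)]\big)$ be its global attractor, let $\Omega_c$ be the set of common continuity points of $\alpha_{\mathcal{A}}$ and $\beta_{\mathcal{A}}$, and let $\mathcal{M}^\alpha,\mathcal{M}^\beta$ be the $\tau$-minimal sets associated with $\alpha_{\mathcal{A}},\beta_{\mathcal{A}}$ (defined in the context). Assume also that $\sup\Sigma_a=0$, and that there exists $\omega_0\in\Omega_c$ such that $\alpha_{\mathcal{A}}(\omega_0)<\beta_{\mathcal{A}}(\omega_0)$. Then $\mathcal{M}^\alpha<\mathcal{M}^\beta$.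 In addition: (i) $r_1<r_2$. (ii) The map $a$ has a continuous primitive. (iii) $\Omega=\Omega_c$, $\mathcal{M}^\alpha=\{\alpha_{\mathcal{A}}\}$ and $\mathcal{M}^\beta=\{\beta_{\mathcal{A}}\}$. (iv) Any $\tau$-minimal set is the graph $\mathcal{M}^c$ of the continuous map $c\,\alpha_{\mathcal{A}}+(1-c)\,\beta_{\mathcal{A}}$ for a $c\in[0,1]$, and has zero upper Lyapunov exponent. (v) $\mathcal{A}=\bigcup_{c\in[0,1]}\mathcal{M}^c\subseteq\Omega\times[r_1,r_2]$, and hence the restriction of $\tau$ to $\mathcal{A}$ is linear and uniformly stable at $\pm\infty$.
   Context: Write $\omega\cdot t:=\sigma(t,\omega)$. The induced (local) flow is $\tau(t,\omega,x_0)=(\omega\cdot t,x(t,\omega,x_0))$, where $x(t,\omega,x_0)$ is the maximal solution of the equation corresponding to $\omega$ with $x(0,\omega,x_0)=x_0$. A set is $\tau$-invariant if it is composed of globally defined orbits and is mapped onto itself by $\tau_t$ for all $t\in\mathbb{R}$. A $\tau$-minimal set is a nonempty compact $\tau$-invariant set with no proper nonempty compact $\tau$-invariant subset ($(\Omega,\sigma)$ minimal: $\Omega$ itself is minimal for $\sigma$). The upper Lyapunov exponent of a $\tau$-minimal set $\mathcal{M}$ is $\sup\int_{\mathcal{M}}(a(\omega)+g_x(\omega,x))\,d\nu$ over all $\tau$-invariant Borel probability measures $\nu$ on $\mathcal{M}$. Sacker–Sell spectrum: the family $x'=c(\omega\cdot t)\,x$, $\omega\in\Omega$ ($c$ continuous)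 has exponential dichotomy over $\Omega$ if there are $\kappa\ge1$, $\gamma>0$ such that either $\exp\int_0^t c(\omega\cdot l)\,dl\le\kappa e^{-\gamma t}$ for all $\omega\in\Omega$, $t\ge0$, or $\exp\int_0^t c(\omega\cdot l)\,dl\le\kappa e^{\gamma t}$ for all $\omega\in\Omega$, $t\le0$. $\Sigma_a$ is the set of $\lambda\in\mathbb{R}$ such that $x'=(a(\omega\cdot t)-\lambda)\,x$, $\omega\in\Omega$, does not have exponential dichotomy over $\Omega$. (It is known that $\Sigma_a$ is the compact interval with endpoints the infimum and supremum of $\int_\Omega a\,dm$ over the $\sigma$-invariant Borel probability measures $m$, both attained at ergodic measures.) Continuous primitive of $a$: a continuous $h_a:\Omega\to\mathbb{R}$ with $h_a(\omega\cdot t)-h_a(\omega)=\int_0^t a(\omega\cdot s)\,ds$ for all $\omega\in\Omega$, $t\in\mathbb{R}$. Background: under the stated conditions all forward semiorbits are globally defined and bounded, and $\tau$ has a global attractor $\mathcal{A}$, i.e. a compact $\tau$-invariant set with $\lim_{t\to\infty}\mathrm{dist}(\tau_t(\mathcal{C}),\mathcal{A})=0$ (Hausdorff semidistance) for every bounded $\mathcal{C}$; it has the displayed form, with $\alpha_{\mathcal{A}}$ lower and $\beta_{\mathcal{A}}$ upper semicontinuous, both $\tau$-equilibria ($\alpha(\omega\cdot t)=x(t,\omega,\alpha(\omega))$ for all $t,\omega$); $\Omega_c$ is residual and $\sigma$-invariant. For any $\omega_0\in\Omega_c$, $\mathcal{M}^\alpha$ and $\mathcal{M}^\beta$ are the closures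 in $\Omega\times\mathbb{R}$ of $\{(\omega_0\cdot t,\alpha_{\mathcal{A}}(\omega_0\cdot t)) : t\in\mathbb{R}\}$ and $\{(\omega_0\cdot t,\beta_{\mathcal{A}}(\omega_0\cdot t)) : t\in\mathbb{R}\}$; they are $\tau$-minimal and independent of the choice of $\omega_0$. $\mathcal{M}<\mathcal{N}$ means $x<y$ whenever $(\omega,x)\in\mathcal{M}$, $(\omega,y)\in\mathcal{N}$. $\{\eta\}$ denotes the graph of a continuous $\tau$-equilibrium $\eta$. "The restriction of $\tau$ to $\mathcal{A}$ is linear" means that for $(\omega,x_0)\in\mathcal{A}$ the solution $t\mapsto x(t,\omega,x_0)$ solves the (nonhomogeneous) linear equation $x'=a(\omega\cdot t)x+b(\omega\cdot t)$ on $\mathbb{R}$. "Uniformly stable at $\pm\infty$" for the flow $(\mathcal{A},\tau)$ means: for every $\kappa>0$ there is $\delta>0$ such that, if $(\omega,x_1),(\omega,x_2)\in\mathcal{A}$ and $|x_1-x_2|<\delta$, then $|x(t,\omega,x_1)-x(t,\omega,x_2)|\le\kappa$ for all $t\ge0$ (at $+\infty$) and for all $t\le0$ (at $-\infty$). *)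

theory Defs
  imports "HOL-Probability.Probability"
begin

section \<open>Flows\<close>

definition continuous_flow :: "(real \<Rightarrow> 'w::topological_space \<Rightarrow> 'w) \<Rightarrow> bool" where
  "continuous_flow \<sigma> \<longleftrightarrow>
     continuous_on UNIV (\<lambda>(t, \<omega>). \<sigma> t \<omega>) \<and> (\<forall>\<omega>. \<sigma> 0 \<omega> = \<omega>) \<and>
     (\<forall>s t \<omega>. \<sigma> (s + t) \<omega> = \<sigma> s (\<sigma> t \<omega>))"

text \<open>
  A local flow is represented by a total map \<open>\<phi>\<close> together with the set \<open>D p\<close> of times at which
  the orbit of \<open>p\<close> is defined; \<open>\<phi> t p\<close> is meaningful only for \<open>t \<in> D p\<close>.
\<close>

definition flow_invariant :: "('p \<Rightarrow> real set) \<Rightarrow> (real \<Rightarrow> 'p \<Rightarrow> 'p) \<Rightarrow> 'p set \<Rightarrow> bool" where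
  "flow_invariant D \<phi> S \<longleftrightarrow> (\<forall>p\<in>S. D p = UNIV) \<and> (\<forall>t. \<phi> t ` S = S)"

definition flow_minimal ::
    "('p::topological_space \<Rightarrow> real set) \<Rightarrow> (real \<Rightarrow> 'p \<Rightarrow> 'p) \<Rightarrow> 'p set \<Rightarrow> bool" where
  "flow_minimal D \<phi> S \<longleftrightarrow>
     S \<noteq> {} \<and> compact S \<and> flow_invariant D \<phi> S \<and>
     (\<forall>K. K \<noteq> {} \<and> compact K \<and> flow_invariant D \<phi> K \<and> K \<subseteq> S \<longrightarrow> K = S)"

text \<open>The Hausdorff semidistance is extended-valued, so that it is \<open>\<infinity>\<close> whenever it is not finite.\<close>

definition hausdorff_semidist :: "'p::metric_space set \<Rightarrow> 'p set \<Rightarrow> ennreal" where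
  "hausdorff_semidist B A = (SUP p\<in>B. INF q\<in>A. ennreal (dist p q))"

definition global_attractor ::
    "('p::metric_space \<Rightarrow> real set) \<Rightarrow> (real \<Rightarrow> 'p \<Rightarrow> 'p) \<Rightarrow> 'p set \<Rightarrow> bool" where
  "global_attractor D \<phi> A \<longleftrightarrow>
     compact A \<and> flow_invariant D \<phi> A \<and>
     (\<forall>C. bounded C \<longrightarrow>
        (\<forall>p\<in>C. {0..} \<subseteq> D p) \<and>
        ((\<lambda>t. hausdorff_semidist (\<phi> t ` C) A) \<longlongrightarrow> 0) at_top)"

section \<open>The skew-product flow of a family of scalar equations\<close>

text \<open>Throughout, \<open>f\<close> stands for the family \<open>x' = f (\<sigma> t \<omega>) x\<close>, indexed by \<open>\<omega>\<close>.\<close>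

definition is_solution ::
    "(real \<Rightarrow> 'w \<Rightarrow> 'w) \<Rightarrow> ('w \<Rightarrow> real \<Rightarrow> real) \<Rightarrow> 'w \<Rightarrow> real \<Rightarrow> real set \<Rightarrow> (real \<Rightarrow> real) \<Rightarrow> bool"
  where
  "is_solution \<sigma> f \<omega> x0 I u \<longleftrightarrow>
     open I \<and> is_interval I \<and> 0 \<in> I \<and> u 0 = x0 \<and>
     (\<forall>t\<in>I. (u has_real_derivative f (\<sigma> t \<omega>) (u t)) (at t))"

text \<open>
  Domain and values of the maximal solution. The value is well defined when solutions of initial
  value problems are unique, in particular when \<open>f\<close> and its derivative in \<open>x\<close> are continuous.
\<close>

definition sol_dom :: "(real \<Rightarrow> 'w \<Rightarrow> 'w) \<Rightarrow> ('w \<Rightarrow> real \<Rightarrow> real) \<Rightarrow> 'w \<Rightarrow> real \<Rightarrow> real set" where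
  "sol_dom \<sigma> f \<omega> x0 = \<Union>{I. \<exists>u. is_solution \<sigma> f \<omega> x0 I u}"

definition sol :: "(real \<Rightarrow> 'w \<Rightarrow> 'w) \<Rightarrow> ('w \<Rightarrow> real \<Rightarrow> real) \<Rightarrow> real \<Rightarrow> 'w \<Rightarrow> real \<Rightarrow> real" where
  "sol \<sigma> f t \<omega> x0 = (THE y. \<exists>I u. is_solution \<sigma> f \<omega> x0 I u \<and> t \<in> I \<and> u t = y)"

definition skew_dom :: "(real \<Rightarrow> 'w \<Rightarrow> 'w) \<Rightarrow> ('w \<Rightarrow> real \<Rightarrow> real) \<Rightarrow> 'w \<times> real \<Rightarrow> real set" where
  "skew_dom \<sigma> f = (\<lambda>(\<omega>, x0). sol_dom \<sigma> f \<omega> x0)"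

definition skew_flow ::
    "(real \<Rightarrow> 'w \<Rightarrow> 'w) \<Rightarrow> ('w \<Rightarrow> real \<Rightarrow> real) \<Rightarrow> real \<Rightarrow> 'w \<times> real \<Rightarrow> 'w \<times> real" where
  "skew_flow \<sigma> f t = (\<lambda>(\<omega>, x0). (\<sigma> t \<omega>, sol \<sigma> f t \<omega> x0))"

definition equilibrium ::
    "(real \<Rightarrow> 'w \<Rightarrow> 'w) \<Rightarrow> ('w \<Rightarrow> real \<Rightarrow> real) \<Rightarrow> ('w \<Rightarrow> real) \<Rightarrow> bool" where
  "equilibrium \<sigma> f \<eta> \<longleftrightarrow>
     (\<forall>\<omega>. sol_dom \<sigma> f \<omega> (\<eta> \<omega>) = UNIV \<and> (\<forall>t. \<eta> (\<sigma> t \<omega>) = sol \<sigma> f t \<omega> (\<eta> \<omega>)))"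

definition graph :: "('w \<Rightarrow> real) \<Rightarrow> ('w \<times> real) set" where
  "graph \<eta> = range (\<lambda>\<omega>. (\<omega>, \<eta> \<omega>))"

definition orbit_closure ::
    "(real \<Rightarrow> 'w::topological_space \<Rightarrow> 'w) \<Rightarrow> ('w \<Rightarrow> real) \<Rightarrow> 'w \<Rightarrow> ('w \<times> real) set" where
  "orbit_closure \<sigma> \<eta> \<omega> = closure (range (\<lambda>t. (\<sigma> t \<omega>, \<eta> (\<sigma> t \<omega>))))"

definition fiber_less :: "('w \<times> real) set \<Rightarrow> ('w \<times> real) set \<Rightarrow> bool" where
  "fiber_less M N \<longleftrightarrow> (\<forall>\<omega> x y. (\<omega>, x) \<in> M \<longrightarrow> (\<omega>, y) \<in> N \<longrightarrow> x < y)"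

definition common_continuity_points ::
    "('w::metric_space \<Rightarrow> real) \<Rightarrow> ('w \<Rightarrow> real) \<Rightarrow> 'w set" where
  "common_continuity_points \<alpha> \<beta> = {\<omega>. isCont \<alpha> \<omega> \<and> isCont \<beta> \<omega>}"

text \<open>Uniform stability at \<open>+\<infinity>\<close> is the case \<open>T = {0..}\<close>, at \<open>-\<infinity>\<close> the case \<open>T = {..0}\<close>.\<close>

definition uniformly_stable ::
    "(real \<Rightarrow> 'w \<Rightarrow> 'w) \<Rightarrow> ('w \<Rightarrow> real \<Rightarrow> real) \<Rightarrow> ('w \<times> real) set \<Rightarrow> real set \<Rightarrow> bool" where
  "uniformly_stable \<sigma> f A T \<longleftrightarrow>
     (\<forall>\<kappa>>0. \<exists>\<delta>>0. \<forall>\<omega> x1 x2. (\<omega>, x1) \<in> A \<and> (\<omega>, x2) \<in> A \<and> \<bar>x1 - x2\<bar> < \<delta> \<longrightarrow>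
        (\<forall>t\<in>T. \<bar>sol \<sigma> f t \<omega> x1 - sol \<sigma> f t \<omega> x2\<bar> \<le> \<kappa>))"

definition linear_on ::
    "(real \<Rightarrow> 'w \<Rightarrow> 'w) \<Rightarrow> ('w \<Rightarrow> real \<Rightarrow> real) \<Rightarrow> ('w \<Rightarrow> real) \<Rightarrow> ('w \<Rightarrow> real) \<Rightarrow>
     ('w \<times> real) set \<Rightarrow> bool" where
  "linear_on \<sigma> f a b A \<longleftrightarrow>
     (\<forall>(\<omega>, x0)\<in>A. sol_dom \<sigma> f \<omega> x0 = UNIV \<and>
        (\<forall>t. ((\<lambda>s. sol \<sigma> f s \<omega> x0) has_real_derivative
               a (\<sigma> t \<omega>) * sol \<sigma> f t \<omega> x0 + b (\<sigma> t \<omega>)) (at t)))"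

section \<open>Lyapunov exponents, Sacker--Sell spectrum, primitives\<close>

definition invariant_measures ::
    "(real \<Rightarrow> 'p::topological_space \<Rightarrow> 'p) \<Rightarrow> 'p set \<Rightarrow> 'p measure set" where
  "invariant_measures \<phi> M =
     {\<nu>. sets \<nu> = sets (restrict_space borel M) \<and> prob_space \<nu> \<and>
         (\<forall>t. \<phi> t \<in> measurable \<nu> \<nu> \<and> distr \<nu> \<nu> (\<phi> t) = \<nu>)}"

definition upper_lyapunov_exponent ::
    "(real \<Rightarrow> 'p::topological_space \<Rightarrow> 'p) \<Rightarrow> ('p \<Rightarrow> real) \<Rightarrow> 'p set \<Rightarrow> ereal" where
  "upper_lyapunov_exponent \<phi> h M = (SUP \<nu>\<in>invariant_measures \<phi> M. ereal (\<integral>p. h p \<partial>\<nu>))"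

text \<open>The integrals below are oriented: for \<open>t < 0\<close> the integral from \<open>0\<close> to \<open>t\<close> changes sign.\<close>

definition exponential_dichotomy :: "(real \<Rightarrow> 'w \<Rightarrow> 'w) \<Rightarrow> ('w \<Rightarrow> real) \<Rightarrow> bool" where
  "exponential_dichotomy \<sigma> c \<longleftrightarrow>
     (\<exists>\<kappa>\<ge>1. \<exists>\<gamma>>0.
        (\<forall>\<omega>. \<forall>t\<ge>0. exp (LBINT l=ereal 0..ereal t. c (\<sigma> l \<omega>)) \<le> \<kappa> * exp (- \<gamma> * t)) \<or>
        (\<forall>\<omega>. \<forall>t\<le>0. exp (LBINT l=ereal 0..ereal t. c (\<sigma> l \<omega>)) \<le> \<kappa> * exp (\<gamma> * t)))"

definition sacker_sell_spectrum :: "(real \<Rightarrow> 'w \<Rightarrow> 'w) \<Rightarrow> ('w \<Rightarrow> real) \<Rightarrow> real set" where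
  "sacker_sell_spectrum \<sigma> a = {r. \<not> exponential_dichotomy \<sigma> (\<lambda>\<omega>. a \<omega> - r)}"

definition continuous_primitive ::
    "(real \<Rightarrow> 'w::topological_space \<Rightarrow> 'w) \<Rightarrow> ('w \<Rightarrow> real) \<Rightarrow> ('w \<Rightarrow> real) \<Rightarrow> bool" where
  "continuous_primitive \<sigma> a h \<longleftrightarrow>
     continuous_on UNIV h \<and>
     (\<forall>\<omega> t. h (\<sigma> t \<omega>) - h \<omega> = (LBINT s=ereal 0..ereal t. a (\<sigma> s \<omega>)))"

section \<open>The equation\<close>

definition admissible_nonlinearity ::
    "('w::topological_space \<Rightarrow> real \<Rightarrow> real) \<Rightarrow> real \<Rightarrow> real \<Rightarrow> bool" where
  "admissible_nonlinearity g r1 r2 \<longleftrightarrow>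
     (\<forall>\<omega> x. g \<omega> differentiable at x) \<and>
     continuous_on UNIV (\<lambda>(\<omega>, x). g \<omega> x) \<and>
     continuous_on UNIV (\<lambda>(\<omega>, x). deriv (g \<omega>) x) \<and>
     r1 \<le> r2 \<and>
     (\<forall>\<omega> x. (r1 \<le> x \<and> x \<le> r2 \<longrightarrow> g \<omega> x = 0) \<and>
            (x < r1 \<longrightarrow> g \<omega> x > 0) \<and> (x > r2 \<longrightarrow> g \<omega> x < 0)) \<and>
     (r1 = r2 \<longrightarrow> (\<forall>\<omega>. deriv (g \<omega>) r1 = 0)) \<and>
     (\<forall>K. \<exists>R>0. \<forall>\<omega> x. \<bar>x\<bar> \<ge> R \<longrightarrow> g \<omega> x / x \<le> K) \<and>
     (\<forall>\<omega> x. x \<notin> {r1..r2} \<longrightarrow> deriv (g \<omega>) x < 0)"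

definition rhs ::
    "('w \<Rightarrow> real) \<Rightarrow> ('w \<Rightarrow> real) \<Rightarrow> ('w \<Rightarrow> real \<Rightarrow> real) \<Rightarrow> 'w \<Rightarrow> real \<Rightarrow> real" where
  "rhs a b g \<omega> x = a \<omega> * x + b \<omega> + g \<omega> x"

end

theory Submission
  imports Defs
begin

text \<open>
  Let \<open>f \<omega> x = a \<omega> x + b \<omega> + g \<omega> x\<close>. The bounds \<open>\<alpha>\<close> and \<open>\<beta>\<close> of the attractor solve the equation
  along every orbit, because \<open>\<tau>\<^sub>t\<close> maps each fibre of \<open>A\<close> monotonically onto another fibre. Their
  difference \<open>y = \<beta> - \<alpha>\<close> is positive and continuous at \<open>\<omega>0\<close>; as every orbit returns to a
  neighbourhood of \<open>\<omega>0\<close> within a uniformly bounded time and \<open>f\<close> is Lipschitz on bounded sets, \<open>y\<close>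
  is bounded below by a positive constant on all of \<open>\<Omega>\<close> (\<open>uniform_gap\<close>).

  Since \<open>g\<close> is nonincreasing in \<open>x\<close>, \<open>y' \<le> a y\<close> along orbits, so \<open>J t = \<integral>\<^sub>0\<^sup>t a - ln y\<close> is
  nondecreasing. The hypothesis on the spectrum bounds the growth of \<open>\<integral>\<^sub>0\<^sup>t a\<close>, and hence that of
  \<open>J\<close>, by arbitrarily small rates, so \<open>J\<close> is almost constant on arbitrarily long windows
  (\<open>flat_windows\<close>). A limit of these windows, available because \<open>A\<close> is compact, is a pair of
  entire solutions \<open>u < v\<close> over one orbit with \<open>\<integral>\<^sub>0\<^sup>t a = ln (v - u)\<close> up to a constant. As \<open>v - u\<close>
  is bounded and bounded away from zero, that integral is bounded; differentiating gives \<open>g u = g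
  v\<close>, which is possible only if \<open>u\<close> and \<open>v\<close> stay in \<open>[r1, r2]\<close> (\<open>linear_pair\<close>).

  Over a minimal flow, boundedness of an integral along a single orbit already produces a
  continuous primitive (\<open>bounded_integral_imp_primitive\<close>). It is applied to \<open>a\<close>, giving \<open>h\<close>, and
  to \<open>e\<^sup>-\<^sup>h b\<close>, of which \<open>e\<^sup>-\<^sup>h u\<close> is a bounded antiderivative, giving \<open>k\<close>. The functions \<open>e\<^sup>h (k
  + c)\<close> then solve the linear equation along all orbits, and for two different values of \<open>c\<close> they
  lie in \<open>[r1, r2]\<close>, where \<open>g\<close> vanishes, so that they are continuous equilibria contained in \<open>A\<close>
  (\<open>affine_family\<close>).

  In the coordinate \<open>z = e\<^sup>-\<^sup>h \<beta> - k\<close> the equation reads \<open>z' = e\<^sup>-\<^sup>h g \<le> 0\<close>. Along any orbit \<open>z\<close>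
  increases, as \<open>t \<rightarrow> -\<infinity>\<close>, to a limit \<open>L\<close>, and recurrence forces \<open>g\<close> to vanish on the whole graph
  of \<open>e\<^sup>h (k + L)\<close> (\<open>monotone_orbit_limit\<close>). This graph is then contained in \<open>A\<close>, so \<open>L \<le> z\<close>
  everywhere, while \<open>z \<le> L\<close> at the starting point; as that point was arbitrary, \<open>z\<close> is constant.
  The same holds for \<open>\<alpha>\<close> (\<open>attractor_affine\<close>). Thus \<open>\<alpha>\<close> and \<open>\<beta>\<close> are continuous, the attractor is
  swept out by the convex combinations of \<open>\<alpha>\<close> and \<open>\<beta>\<close>, and on it the equation is linear;
  differences of solutions are multiples of \<open>e\<^sup>h\<close>, which is bounded and bounded away from zero,
  whence stability in both time directions.

  On a minimal set the Lyapunov integrand reduces to \<open>a\<close>, whose integral against any invariant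
  measure vanishes because \<open>a\<close> has a primitive (\<open>integral_eq_zero_of_primitive\<close>). The supremum
  defining the exponent is \<open>0\<close> rather than \<open>-\<infinity>\<close> only because an invariant measure exists; this is
  the Krylov--Bogolyubov theorem, proved here as \<open>ex_invariant_probability\<close> by extending a limit
  of occupation times of closed sets by Caratheodory's construction.
\<close>

section \<open>Flows on a compact base and integrals along orbits\<close>

locale compact_flow =
  fixes \<sigma> :: "real \<Rightarrow> 'w::metric_space \<Rightarrow> 'w"
  assumes compact_base: "compact (UNIV :: 'w set)"
    and flow: "continuous_flow \<sigma>"
begin

lemma flow_zero [simp]: "\<sigma> 0 \<omega> = \<omega>"
  and flow_add: "\<sigma> (s + t) \<omega> = \<sigma> s (\<sigma> t \<omega>)"
  using flow by (auto simp: continuous_flow_def)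

lemma flow_inverse [simp]: "\<sigma> (- t) (\<sigma> t \<omega>) = \<omega>" "\<sigma> t (\<sigma> (- t) \<omega>) = \<omega>"
  by (simp_all flip: flow_add)

lemma continuous_on_flow [continuous_intros]:
  assumes "continuous_on S f" and "continuous_on S k"
  shows "continuous_on S (\<lambda>x. \<sigma> (f x) (k x))"
proof -
  have "continuous_on UNIV (\<lambda>p. \<sigma> (fst p) (snd p))"
    using flow by (simp add: continuous_flow_def case_prod_unfold)
  from continuous_on_compose2[OF this continuous_on_Pair[OF assms]] show ?thesis by simp
qed

lemma continuous_on_along:
  assumes "continuous_on UNIV (c :: 'w \<Rightarrow> real)"
  shows "continuous_on S (\<lambda>t. c (\<sigma> t \<omega>))"
  by (rule continuous_on_compose2[OF assms]) (auto intro!: continuous_intros)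

definition integral_along :: "('w \<Rightarrow> real) \<Rightarrow> real \<Rightarrow> 'w \<Rightarrow> real" where
  "integral_along c t \<omega> = (LBINT s=ereal 0..ereal t. c (\<sigma> s \<omega>))"

lemma integral_along_eqI:
  assumes c: "continuous_on UNIV c"
    and F: "\<And>s. (F has_real_derivative c (\<sigma> s \<omega>)) (at s)"
  shows "integral_along c t \<omega> = F t - F 0"
  unfolding integral_along_def
  by (rule interval_integral_FTC_finite)
    (simp_all add: continuous_on_along[OF c] has_vector_derivative_at_within
      F[unfolded has_real_derivative_iff_has_vector_derivative])

lemma integral_along_deriv:
  assumes c: "continuous_on UNIV c"
  shows "((\<lambda>t. integral_along c t \<omega>) has_real_derivative c (\<sigma> t \<omega>)) (at t)"
proof -
  obtain F where F: "\<And>s. (F has_real_derivative c (\<sigma> s \<omega>)) (at s)"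
  proof -
    have "\<exists>F. \<forall>x::real. (F has_vector_derivative c (\<sigma> x \<omega>)) (at x)"
    proof -
      have "\<exists>F. \<forall>x::real. -\<infinity> < ereal x \<longrightarrow> ereal x < \<infinity> \<longrightarrow> (F has_vector_derivative c (\<sigma> x \<omega>)) (at x)"
        by (rule einterval_antiderivative)
          (simp_all add: continuous_on_along[OF c, of UNIV, unfolded continuous_on_eq_continuous_at[OF open_UNIV], rule_format])
      then show ?thesis by auto
    qed
    then show ?thesis using that by (auto simp: has_real_derivative_iff_has_vector_derivative)
  qed
  have "(\<lambda>t. integral_along c t \<omega>) = (\<lambda>t. F t - F 0)"
    by (simp add: integral_along_eqI[OF c F])
  then show ?thesis by (auto intro!: derivative_eq_intros F)
qed

lemma integral_along_zero [simp]: "integral_along c 0 \<omega> = 0"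
  by (simp add: integral_along_def)

lemma integral_along_add:
  assumes c: "continuous_on UNIV c"
  shows "integral_along c (s + t) \<omega> = integral_along c s (\<sigma> t \<omega>) + integral_along c t \<omega>"
proof -
  have "((\<lambda>s. integral_along c (s + t) \<omega>) has_real_derivative c (\<sigma> s (\<sigma> t \<omega>))) (at s)" for s
    using integral_along_deriv[OF c, of \<omega> "s + t"] by (simp add: DERIV_shift flow_add)
  from integral_along_eqI[OF c this, of s] show ?thesis by simp
qed

text \<open>Parametric integrals are handled for \<open>t \<ge> 0\<close>; the cocycle identity transports the result to
  negative times.\<close>

lemma continuous_on_integral_along:
  assumes c: "continuous_on UNIV c"
  shows "continuous_on UNIV (integral_along c t)"
proof -
  have pos: "continuous_on UNIV (integral_along c t)" if "t \<ge> 0" for t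
  proof -
    have "integral_along c t = (\<lambda>\<omega>. integral (cbox 0 t) (\<lambda>s. c (\<sigma> s \<omega>)))"
      unfolding integral_along_def using that
      by (intro ext, subst interval_integral_eq_integral)
        (auto intro!: borel_integrable_atLeastAtMost' continuous_on_along[OF c])
    moreover have "continuous_on UNIV (\<lambda>\<omega>. integral (cbox 0 t) (\<lambda>s. c (\<sigma> s \<omega>)))"
      by (rule integral_continuous_on_param)
        (auto simp: case_prod_unfold intro!: continuous_on_compose2[OF c] continuous_intros)
    ultimately show ?thesis by simp
  qed
  show ?thesis
  proof (cases "t \<ge> 0")
    case False
    have "integral_along c t \<omega> = - integral_along c (- t) (\<sigma> t \<omega>)" for \<omega>
      using integral_along_add[OF c, of "- t" t \<omega>] by simp
    then have "integral_along c t = (\<lambda>\<omega>. - integral_along c (- t) (\<sigma> t \<omega>))" ..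
    then show ?thesis
      using False by (auto intro!: continuous_intros continuous_on_compose2[OF pos])
  qed (rule pos)
qed

lemma primitive_deriv:
  assumes c: "continuous_on UNIV c" and h: "\<And>\<omega> t. h (\<sigma> t \<omega>) - h \<omega> = integral_along c t \<omega>"
  shows "((\<lambda>t. h (\<sigma> t \<omega>)) has_real_derivative c (\<sigma> t \<omega>)) (at t)"
proof -
  have "h (\<sigma> t \<omega>) = h \<omega> + integral_along c t \<omega>" for t using h[of t \<omega>] by linarith
  then show ?thesis using integral_along_deriv[OF c, of \<omega> t] by (auto intro!: derivative_eq_intros)
qed

lemma bounded_continuous_base:
  assumes "continuous_on UNIV (h :: 'w \<Rightarrow> real)"
  obtains B where "\<And>\<omega>. \<bar>h \<omega>\<bar> \<le> B"
proof -
  have "bounded (range h)"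
    using compact_continuous_image[OF assms compact_base] by (rule compact_imp_bounded)
  then show thesis using that by (auto simp: bounded_iff)
qed

lemma compact_graph:
  assumes "continuous_on UNIV (\<psi> :: 'w \<Rightarrow> real)"
  shows "compact (graph \<psi>)"
  unfolding graph_def using assms
  by (intro compact_continuous_image compact_base continuous_intros)

end

locale minimal_compact_flow = compact_flow +
  assumes minimal: "flow_minimal (\<lambda>_. UNIV) \<sigma> UNIV"
begin

lemma closed_invariant_eq_UNIV:
  assumes "closed K" and "\<omega> \<in> K" and inv: "\<And>\<omega> t. \<omega> \<in> K \<Longrightarrow> \<sigma> t \<omega> \<in> K"
  shows "K = UNIV"
proof -
  have "\<sigma> t ` K = K" for t
  proof
    show "K \<subseteq> \<sigma> t ` K"
      using inv by (metis flow_inverse(2) image_eqI subsetI)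
  qed (use inv in auto)
  moreover have "compact K"
    using compact_Int_closed[OF compact_base \<open>closed K\<close>] by simp
  ultimately show ?thesis
    using minimal \<open>\<omega> \<in> K\<close> unfolding flow_minimal_def flow_invariant_def by blast
qed

lemma closed_orbit_eq_UNIV:
  assumes "closed K" and "\<And>t. \<sigma> t \<omega> \<in> K"
  shows "K = UNIV"
proof -
  have "closed {\<omega>'. \<forall>t. \<sigma> t \<omega>' \<in> K}"
  proof -
    have "closed ((\<lambda>\<omega>'. \<sigma> t \<omega>') -` K)" for t
      by (rule closed_vimage[OF assms(1)]) (intro continuous_intros)
    then have "closed (\<Inter>t. (\<lambda>\<omega>'. \<sigma> t \<omega>') -` K)" by blast
    also have "(\<Inter>t. (\<lambda>\<omega>'. \<sigma> t \<omega>') -` K) = {\<omega>'. \<forall>t. \<sigma> t \<omega>' \<in> K}" by auto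
    finally show ?thesis .
  qed
  then have "{\<omega>'. \<forall>t. \<sigma> t \<omega>' \<in> K} = UNIV"
    by (rule closed_invariant_eq_UNIV[where \<omega> = \<omega>]) (auto simp: assms simp flip: flow_add)
  then have "\<sigma> 0 \<omega>' \<in> K" for \<omega>' by blast
  then show ?thesis by auto
qed

lemma uniform_return:
  assumes "open U" and "\<omega>0 \<in> U"
  obtains T where "T \<ge> 0" "\<And>\<omega>. \<exists>s. \<bar>s\<bar> \<le> T \<and> \<sigma> s \<omega> \<in> U"
proof -
  have hit: "\<exists>s. \<sigma> s \<omega> \<in> U" for \<omega>
    using closed_orbit_eq_UNIV[of "- U" \<omega>] assms by blast
  have op: "open ((\<lambda>\<omega>. \<sigma> s \<omega>) -` U)" for s
    by (rule open_vimage[OF assms(1)]) (intro continuous_intros)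
  have "UNIV \<subseteq> (\<Union>s\<in>UNIV. (\<lambda>\<omega>. \<sigma> s \<omega>) -` U)" using hit by auto
  from compactE_image[OF compact_base op this]
  obtain C where C: "finite C" "UNIV \<subseteq> (\<Union>s\<in>C. (\<lambda>\<omega>. \<sigma> s \<omega>) -` U)" .
  show thesis
  proof (rule that)
    show "(\<Sum>s\<in>C. \<bar>s\<bar>) \<ge> 0" by (simp add: sum_nonneg)
    fix \<omega>
    obtain s where s: "s \<in> C" "\<sigma> s \<omega> \<in> U" using C(2) by auto
    then have "\<bar>s\<bar> \<le> (\<Sum>s\<in>C. \<bar>s\<bar>)" using C(1) by (intro member_le_sum) auto
    then show "\<exists>s. \<bar>s\<bar> \<le> (\<Sum>s\<in>C. \<bar>s\<bar>) \<and> \<sigma> s \<omega> \<in> U" using s by blast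
  qed
qed

lemma orbit_closure_eq_graph:
  assumes "continuous_on UNIV \<eta>"
  shows "orbit_closure \<sigma> \<eta> \<omega> = graph \<eta>"
proof
  have cont: "continuous_on UNIV (\<lambda>\<theta>. (\<theta>, \<eta> \<theta>))" using assms by (intro continuous_intros)
  show "orbit_closure \<sigma> \<eta> \<omega> \<subseteq> graph \<eta>"
    unfolding orbit_closure_def using compact_graph[OF assms]
    by (intro closure_minimal compact_imp_closed) (auto simp: graph_def)
  have "closed ((\<lambda>\<theta>. (\<theta>, \<eta> \<theta>)) -` orbit_closure \<sigma> \<eta> \<omega>)"
    unfolding orbit_closure_def by (rule closed_vimage[OF closed_closure cont])
  moreover have "\<sigma> t \<omega> \<in> (\<lambda>\<theta>. (\<theta>, \<eta> \<theta>)) -` orbit_closure \<sigma> \<eta> \<omega>" for t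
    unfolding orbit_closure_def vimage_eq by (rule subsetD[OF closure_subset]) simp
  ultimately have "(\<lambda>\<theta>. (\<theta>, \<eta> \<theta>)) -` orbit_closure \<sigma> \<eta> \<omega> = UNIV"
    by (rule closed_orbit_eq_UNIV)
  then show "graph \<eta> \<subseteq> orbit_closure \<sigma> \<eta> \<omega>" by (auto simp: graph_def)
qed

text \<open>The suprema and the infima of the integrals along an orbit satisfy the same cocycle identity,
  so their difference is invariant under the flow; being lower semicontinuous, it is constant on a
  minimal base. The supremum, always lower semicontinuous, is then upper semicontinuous as well.\<close>

theorem bounded_integral_imp_primitive:
  assumes c: "continuous_on UNIV c" and bdd: "\<And>t. \<bar>integral_along c t \<omega>0\<bar> \<le> B"
  obtains h where "continuous_on UNIV h" and "\<And>\<omega> t. h (\<sigma> t \<omega>) - h \<omega> = integral_along c t \<omega>"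
proof -
  let ?I = "integral_along c"
  have cont: "continuous_on UNIV (?I t)" for t by (rule continuous_on_integral_along[OF c])
  have B: "\<bar>?I t \<omega>\<bar> \<le> 2 * B" for t \<omega>
  proof -
    have "{\<omega>. \<bar>?I t \<omega>\<bar> \<le> 2 * B} = UNIV"
    proof (rule closed_orbit_eq_UNIV)
      show "closed {\<omega>. \<bar>?I t \<omega>\<bar> \<le> 2 * B}"
        by (intro closed_Collect_le continuous_intros cont)
      show "\<sigma> s \<omega>0 \<in> {\<omega>. \<bar>?I t \<omega>\<bar> \<le> 2 * B}" for s
        using integral_along_add[OF c, of t s \<omega>0] bdd[of s] bdd[of "t + s"] by simp
    qed
    then show ?thesis by auto
  qed
  define hs where "hs \<omega> = (SUP t. ?I t \<omega>)" for \<omega>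
  define hi where "hi \<omega> = (INF t. ?I t \<omega>)" for \<omega>
  have bA: "bdd_above (range (\<lambda>t. ?I t \<omega>))" for \<omega>
    using B by (intro bdd_aboveI[of _ "2*B"]) (auto simp: abs_le_iff)
  have bB: "bdd_below (range (\<lambda>t. ?I t \<omega>))" for \<omega>
    using B by (intro bdd_belowI[of _ "-2*B"]) (auto simp: abs_le_iff minus_le_iff)
  have le_hs: "?I t \<omega> \<le> hs \<omega>" and hi_le: "hi \<omega> \<le> ?I t \<omega>" for t \<omega>
    unfolding hs_def hi_def by (auto intro!: cSUP_upper[OF _ bA] cINF_lower[OF bB])
  have shift: "?I t (\<sigma> s \<omega>) = ?I (t + s) \<omega> - ?I s \<omega>" for s t \<omega>
    using integral_along_add[OF c, of t s \<omega>] by simp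
  have hs_le: "hs (\<sigma> s \<omega>) \<le> hs \<omega> - ?I s \<omega>" for s \<omega>
    unfolding hs_def[of "\<sigma> s \<omega>"] by (rule cSUP_least) (use le_hs in \<open>auto simp: shift\<close>)
  have hi_ge: "hi (\<sigma> s \<omega>) \<ge> hi \<omega> - ?I s \<omega>" for s \<omega>
    unfolding hi_def[of "\<sigma> s \<omega>"] by (rule cINF_greatest) (use hi_le in \<open>auto simp: shift\<close>)
  have I_inv: "?I (-s) (\<sigma> s \<omega>) = - ?I s \<omega>" for s \<omega>
    using integral_along_add[OF c, of "-s" s \<omega>] by simp
  have hs: "hs (\<sigma> s \<omega>) = hs \<omega> - ?I s \<omega>" for s \<omega>
    using hs_le[of s \<omega>] hs_le[of "-s" "\<sigma> s \<omega>"] by (simp add: I_inv)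
  have hi: "hi (\<sigma> s \<omega>) = hi \<omega> - ?I s \<omega>" for s \<omega>
    using hi_ge[of \<omega> s] hi_ge[of "\<sigma> s \<omega>" "-s"] by (simp add: I_inv)
  have le_iff: "hs \<omega> - hi \<omega> \<le> k \<longleftrightarrow> (\<forall>s t. ?I t \<omega> - ?I s \<omega> \<le> k)" for \<omega> k
  proof -
    have "hs \<omega> - hi \<omega> \<le> k \<longleftrightarrow> (\<forall>t. ?I t \<omega> - k \<le> hi \<omega>)"
      unfolding hs_def using cSUP_le_iff[OF _ bA, of \<omega> "k + hi \<omega>"] by (auto simp: algebra_simps)
    also have "\<dots> \<longleftrightarrow> (\<forall>t s. ?I t \<omega> - k \<le> ?I s \<omega>)"
      unfolding hi_def by (subst le_cINF_iff[OF _ bB]) auto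
    finally show ?thesis by (auto simp: algebra_simps)
  qed
  define k where "k = hs \<omega>0 - hi \<omega>0"
  have "hs \<omega> - hi \<omega> \<le> hs \<omega>' - hi \<omega>'" for \<omega> \<omega>'
  proof -
    have "{\<omega>. hs \<omega> - hi \<omega> \<le> hs \<omega>' - hi \<omega>'} = UNIV"
    proof (rule closed_invariant_eq_UNIV)
      show "closed {\<omega>. hs \<omega> - hi \<omega> \<le> hs \<omega>' - hi \<omega>'}"
        unfolding le_iff by (intro closed_Collect_all closed_Collect_le continuous_intros cont)
      show "\<omega>' \<in> {\<omega>. hs \<omega> - hi \<omega> \<le> hs \<omega>' - hi \<omega>'}" by simp
    qed (simp add: hs hi)
    then show ?thesis by auto
  qed
  from this[of _ \<omega>0] this[of \<omega>0] have k: "hs \<omega> = hi \<omega> + k" for \<omega>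
    unfolding k_def by (smt (verit))
  have "isCont hs \<omega>" for \<omega>
    unfolding isCont_def
  proof (rule order_tendstoI)
    fix r assume "r < hs \<omega>"
    then obtain t where t: "r < ?I t \<omega>"
      unfolding hs_def using less_cSUP_iff[OF _ bA, of r \<omega>] by auto
    have "(?I t \<longlongrightarrow> ?I t \<omega>) (at \<omega>)"
      using cont[of t] by (simp add: continuous_on_eq_continuous_at isCont_def)
    from order_tendstoD(1)[OF this t] show "\<forall>\<^sub>F x in at \<omega>. r < hs x"
      by eventually_elim (use le_hs in \<open>auto intro: less_le_trans\<close>)
  next
    fix r assume "hs \<omega> < r"
    then have "hi \<omega> < r - k" using k by simp
    then obtain t where t: "?I t \<omega> < r - k"
      unfolding hi_def using cINF_less_iff[OF _ bB, of \<omega> "r - k"] by auto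
    have "(?I t \<longlongrightarrow> ?I t \<omega>) (at \<omega>)"
      using cont[of t] by (simp add: continuous_on_eq_continuous_at isCont_def)
    from order_tendstoD(2)[OF this t] show "\<forall>\<^sub>F x in at \<omega>. hs x < r"
    proof eventually_elim
      fix x assume "?I t x < r - k"
      then show "hs x < r" using k[of x] hi_le[of x t] by simp
    qed
  qed
  then have "continuous_on UNIV (\<lambda>\<omega>. - hs \<omega>)"
    by (intro continuous_intros continuous_at_imp_continuous_on) auto
  then show thesis by (rule that) (simp add: hs)
qed

lemma bounded_antiderivative_imp_primitive:
  assumes c: "continuous_on UNIV c" and bdd: "\<And>t. \<bar>z t\<bar> \<le> B"
    and z: "\<And>t. (z has_real_derivative c (\<sigma> t \<omega>)) (at t)"
  obtains k where "continuous_on UNIV k" "\<And>\<omega> t. k (\<sigma> t \<omega>) - k \<omega> = integral_along c t \<omega>"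
proof -
  have "integral_along c t \<omega> = z t - z 0" for t by (rule integral_along_eqI[OF c z])
  then have "\<bar>integral_along c t \<omega>\<bar> \<le> 2 * B" for t using bdd[of t] bdd[of 0] by simp
  from bounded_integral_imp_primitive[OF c this] show thesis using that by blast
qed

text \<open>The integrals over windows of fixed length tend to zero along the orbit, hence vanish on the
  orbits of its limit points, which are dense.\<close>

lemma nonneg_eq_zero_of_bounded_integral:
  assumes F: "continuous_on UNIV F" and nn: "\<And>\<omega>. F \<omega> \<ge> 0"
    and bdd: "\<And>t. t \<le> 0 \<Longrightarrow> - integral_along F t \<omega>0 \<le> B"
  shows "F \<omega> = 0"
proof -
  let ?I = "integral_along F"
  have mono: "?I s \<omega> \<le> ?I t \<omega>" if "s \<le> t" for s t \<omega>
    by (rule DERIV_nonneg_imp_nondecreasing[OF that]) (use integral_along_deriv[OF F] nn in blast)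
  have "decseq (\<lambda>n. ?I (- real n) \<omega>0)"
    by (auto simp: decseq_def intro!: mono)
  moreover have "- B \<le> ?I (- real n) \<omega>0" for n using bdd[of "- real n"] by simp
  ultimately obtain l where l: "(\<lambda>n. ?I (- real n) \<omega>0) \<longlonglongrightarrow> l"
    using decseq_convergent by blast
  obtain r \<omega>' where r: "strict_mono (r :: nat \<Rightarrow> nat)" "(\<lambda>n. \<sigma> (- real (r n)) \<omega>0) \<longlonglongrightarrow> \<omega>'"
    using compact_base[unfolded compact_def, rule_format, of "\<lambda>n. \<sigma> (- real n) \<omega>0"] by (auto simp: o_def)
  have zero: "?I (real m) \<omega>' - ?I (- real m) \<omega>' = 0" for m
  proof (rule LIMSEQ_unique)
    have [continuous_intros]: "isCont (?I t) x" for t x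
      using continuous_on_integral_along[OF F] by (simp add: continuous_on_eq_continuous_at)
    show "(\<lambda>n. ?I (real m) (\<sigma> (- real (r n)) \<omega>0) - ?I (- real m) (\<sigma> (- real (r n)) \<omega>0))
       \<longlonglongrightarrow> ?I (real m) \<omega>' - ?I (- real m) \<omega>'"
      by (intro tendsto_intros isCont_tendsto_compose[OF _ r(2)] continuous_intros)
    have "(\<lambda>n. ?I (- real (r n - m)) \<omega>0 - ?I (- real (r n + m)) \<omega>0) \<longlonglongrightarrow> l - l"
      by (intro tendsto_intros filterlim_compose[OF l]
          filterlim_compose[OF filterlim_minus_const_nat_at_top]
          filterlim_compose[OF filterlim_add_const_nat_at_top] filterlim_subseq r(1))
    moreover have "\<forall>\<^sub>F n in sequentially. ?I (- real (r n - m)) \<omega>0 - ?I (- real (r n + m)) \<omega>0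
       = ?I (real m) (\<sigma> (- real (r n)) \<omega>0) - ?I (- real m) (\<sigma> (- real (r n)) \<omega>0)"
      using filterlim_at_top[THEN iffD1, OF filterlim_subseq[OF r(1)], rule_format, of m]
    proof eventually_elim
      case (elim n)
      then show ?case
        using integral_along_add[OF F, of "real m" "- real (r n)" \<omega>0]
          integral_along_add[OF F, of "- real m" "- real (r n)" \<omega>0]
        by (simp add: of_nat_diff algebra_simps)
    qed
    ultimately show "(\<lambda>n. ?I (real m) (\<sigma> (- real (r n)) \<omega>0) - ?I (- real m) (\<sigma> (- real (r n)) \<omega>0))
       \<longlonglongrightarrow> 0"
      by (auto intro: Lim_transform_eventually)
  qed
  have const: "?I t \<omega>' = 0" for t
  proof -
    obtain m :: nat where "\<bar>t\<bar> \<le> real m" using real_arch_simple by blast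
    then have "t \<le> real m" "- real m \<le> t" by auto
    from mono[OF this(1), of \<omega>'] mono[OF this(2), of \<omega>'] show ?thesis
      using zero[of m] mono[of 0 "real m" \<omega>'] mono[of "- real m" 0 \<omega>'] by simp
  qed
  have "F (\<sigma> t \<omega>') = 0" for t
    using DERIV_unique[OF integral_along_deriv[OF F, of \<omega>' t]] const by simp
  then have "{\<omega>. F \<omega> = 0} = UNIV"
    by (intro closed_orbit_eq_UNIV[where \<omega> = \<omega>'] closed_Collect_eq F continuous_intros) auto
  then show ?thesis by auto
qed

end

section \<open>Scalar differential equations over a flow\<close>

text \<open>The estimate is two-sided in time, as the attractor has to be compared both forwards and
  backwards. The offset \<open>e\<close> absorbs a perturbation of the vector field.\<close>

lemma gronwall:
  fixes w w' :: "real \<Rightarrow> real"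
  assumes w: "\<And>x. x \<in> closed_segment s t \<Longrightarrow> (w has_real_derivative w' x) (at x)"
    and le: "\<And>x. x \<in> closed_segment s t \<Longrightarrow> \<bar>w' x\<bar> \<le> K * (w x + e)"
  shows "w t + e \<le> (w s + e) * exp (K * \<bar>t - s\<bar>)"
proof (cases "s \<le> t")
  case True
  have "(w t + e) * exp (- K * t) \<le> (w s + e) * exp (- K * s)"
  proof (rule DERIV_nonpos_imp_nonincreasing[OF True], intro exI conjI)
    fix x assume "s \<le> x" "x \<le> t"
    then have x: "x \<in> closed_segment s t" using True by (simp add: closed_segment_eq_real_ivl)
    show "((\<lambda>x. (w x + e) * exp (- K * x)) has_real_derivative
        (w' x - K * (w x + e)) * exp (- K * x)) (at x)"
      by (auto intro!: derivative_eq_intros w[OF x] simp: algebra_simps)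
    show "(w' x - K * (w x + e)) * exp (- K * x) \<le> 0"
      using le[OF x] by (simp add: mult_le_0_iff)
  qed
  then have "(w t + e) * exp (- K * t) * exp (K * t) \<le> (w s + e) * exp (- K * s) * exp (K * t)"
    by (intro mult_right_mono) auto
  then show ?thesis using True by (simp add: algebra_simps flip: exp_add)
next
  case False
  then have ts: "t \<le> s" by simp
  have "(w t + e) * exp (K * t) \<le> (w s + e) * exp (K * s)"
  proof (rule DERIV_nonneg_imp_nondecreasing[OF ts], intro exI conjI)
    fix x assume "t \<le> x" "x \<le> s"
    then have x: "x \<in> closed_segment s t" using ts by (simp add: closed_segment_eq_real_ivl)
    show "((\<lambda>x. (w x + e) * exp (K * x)) has_real_derivative
        (w' x + K * (w x + e)) * exp (K * x)) (at x)"
      by (auto intro!: derivative_eq_intros w[OF x] simp: algebra_simps)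
    show "(w' x + K * (w x + e)) * exp (K * x) \<ge> 0"
      using le[OF x] by simp
  qed
  then have "(w t + e) * exp (K * t) * exp (- K * t) \<le> (w s + e) * exp (K * s) * exp (- K * t)"
    by (intro mult_right_mono) auto
  then show ?thesis using ts by (simp add: algebra_simps flip: exp_add)
qed

locale smooth_family = compact_flow \<sigma> for \<sigma> :: "real \<Rightarrow> 'w::metric_space \<Rightarrow> 'w" +
  fixes f f' :: "'w \<Rightarrow> real \<Rightarrow> real"
  assumes f_deriv: "\<And>\<omega> x. (f \<omega> has_real_derivative f' \<omega> x) (at x)"
    and f_cont: "continuous_on UNIV (\<lambda>(\<omega>, x). f \<omega> x)"
    and f'_cont: "continuous_on UNIV (\<lambda>(\<omega>, x). f' \<omega> x)"
begin

lemma continuous_on_f [continuous_intros]: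
  assumes "continuous_on S p" and "continuous_on S q"
  shows "continuous_on S (\<lambda>x. f (p x) (q x))"
  using continuous_on_compose2[OF f_cont continuous_on_Pair[OF assms]] by simp

lemma lipschitz_on_bounded:
  obtains L where "L \<ge> 0"
    and "\<And>\<omega> x y. \<bar>x\<bar> \<le> R \<Longrightarrow> \<bar>y\<bar> \<le> R \<Longrightarrow> \<bar>f \<omega> x - f \<omega> y\<bar> \<le> L * \<bar>x - y\<bar>"
proof -
  have "compact ((\<lambda>(\<omega>, x). f' \<omega> x) ` (UNIV \<times> {-R..R}))"
    by (intro compact_continuous_image compact_Times compact_base compact_Icc
        continuous_on_subset[OF f'_cont]) auto
  then obtain L where L: "\<And>\<omega> x. \<bar>x\<bar> \<le> R \<Longrightarrow> \<bar>f' \<omega> x\<bar> \<le> L"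
    unfolding compact_eq_bounded_closed bounded_iff by (auto simp: abs_le_iff) force
  have L': "\<bar>f' \<omega> x\<bar> \<le> max L 0" if "\<bar>x\<bar> \<le> R" for \<omega> x using L[OF that, of \<omega>] by simp
  show thesis
  proof (rule that)
    show "max L 0 \<ge> 0" by simp
    fix \<omega> x y :: real assume "\<bar>x\<bar> \<le> R" "\<bar>y\<bar> \<le> R"
    then have "norm (f \<omega> x - f \<omega> y) \<le> max L 0 * norm (x - y)" for \<omega>
      by (intro field_differentiable_bound[where S = "{-R..R}" and f' = "f' \<omega>"])
        (auto intro!: has_field_derivative_at_within f_deriv L')
    then show "\<bar>f \<omega> x - f \<omega> y\<bar> \<le> max L 0 * \<bar>x - y\<bar>" for \<omega> by simp
  qed
qed

text \<open>Working with the square of the difference avoids differentiating an absolute value; the mixed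
  term is split by \<open>2 p q \<le> p\<^sup>2 + q\<^sup>2\<close>. For \<open>e = 0\<close> and \<open>\<omega> = \<omega>'\<close> this is at once uniqueness and the fact
  that two solutions cannot approach each other faster than exponentially.\<close>

lemma compare_solutions:
  assumes L: "L \<ge> 0" "\<And>\<omega> x y. \<bar>x\<bar> \<le> R \<Longrightarrow> \<bar>y\<bar> \<le> R \<Longrightarrow> \<bar>f \<omega> x - f \<omega> y\<bar> \<le> L * \<bar>x - y\<bar>"
    and u: "\<And>x. x \<in> closed_segment s t \<Longrightarrow> (u has_real_derivative f (\<sigma> x \<omega>) (u x)) (at x)"
    and v: "\<And>x. x \<in> closed_segment s t \<Longrightarrow> (v has_real_derivative f (\<sigma> x \<omega>') (v x)) (at x)"
    and R: "\<And>x. x \<in> closed_segment s t \<Longrightarrow> \<bar>u x\<bar> \<le> R" "\<And>x. x \<in> closed_segment s t \<Longrightarrow> \<bar>v x\<bar> \<le> R"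
    and e: "\<And>x. x \<in> closed_segment s t \<Longrightarrow> \<bar>f (\<sigma> x \<omega>) (v x) - f (\<sigma> x \<omega>') (v x)\<bar> \<le> e"
  shows "(u t - v t)\<^sup>2 + e\<^sup>2 \<le> ((u s - v s)\<^sup>2 + e\<^sup>2) * exp ((2 * L + 1) * \<bar>t - s\<bar>)"
proof (rule gronwall)
  fix x assume x: "x \<in> closed_segment s t"
  let ?d = "u x - v x" and ?d' = "f (\<sigma> x \<omega>) (u x) - f (\<sigma> x \<omega>') (v x)"
  show "((\<lambda>x. (u x - v x)\<^sup>2) has_real_derivative 2 * ?d * ?d') (at x)"
    by (auto intro!: derivative_eq_intros u v x)
  have "\<bar>?d'\<bar> \<le> L * \<bar>?d\<bar> + e"
    using L(2)[OF R(1)[OF x] R(2)[OF x], of "\<sigma> x \<omega>"] e[OF x] by linarith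
  then have "2 * \<bar>?d\<bar> * \<bar>?d'\<bar> \<le> 2 * \<bar>?d\<bar> * (L * \<bar>?d\<bar> + e)"
    by (intro mult_left_mono) auto
  also have "\<dots> = 2 * L * ?d\<^sup>2 + 2 * \<bar>?d\<bar> * e"
    by (simp add: algebra_simps power2_eq_square)
  also have "2 * \<bar>?d\<bar> * e \<le> ?d\<^sup>2 + e\<^sup>2"
    using sum_squares_bound[of "\<bar>?d\<bar>" e] by simp
  also have "2 * L * ?d\<^sup>2 + (?d\<^sup>2 + e\<^sup>2) \<le> (2 * L + 1) * (?d\<^sup>2 + e\<^sup>2)"
    using L(1) by (simp add: algebra_simps)
  finally show "\<bar>2 * ?d * ?d'\<bar> \<le> (2 * L + 1) * (?d\<^sup>2 + e\<^sup>2)"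
    unfolding abs_mult abs_numeral by simp
qed

lemma solutions_agree:
  assumes u: "\<And>x. x \<in> closed_segment s t \<Longrightarrow> (u has_real_derivative f (\<sigma> x \<omega>) (u x)) (at x)"
    and v: "\<And>x. x \<in> closed_segment s t \<Longrightarrow> (v has_real_derivative f (\<sigma> x \<omega>) (v x)) (at x)"
    and "u s = v s"
  shows "u t = v t"
proof -
  have bdd: "\<exists>R. \<forall>x\<in>closed_segment s t. \<bar>w x\<bar> \<le> R"
    if "\<And>x. x \<in> closed_segment s t \<Longrightarrow> (w has_real_derivative w' x) (at x)" for w w' :: "real \<Rightarrow> real"
  proof -
    have "continuous_on (closed_segment s t) w"
      using that by (intro continuous_at_imp_continuous_on ballI) (blast intro: DERIV_isCont)
    then have "bounded (w ` closed_segment s t)"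
      by (intro compact_imp_bounded compact_continuous_image compact_segment)
    then show ?thesis by (auto simp: bounded_iff)
  qed
  obtain R1 R2 where R: "\<forall>x\<in>closed_segment s t. \<bar>u x\<bar> \<le> R1" "\<forall>x\<in>closed_segment s t. \<bar>v x\<bar> \<le> R2"
    using bdd[OF u] bdd[OF v] by blast
  obtain L where L: "L \<ge> 0"
    "\<And>\<omega> x y. \<bar>x\<bar> \<le> max R1 R2 \<Longrightarrow> \<bar>y\<bar> \<le> max R1 R2 \<Longrightarrow> \<bar>f \<omega> x - f \<omega> y\<bar> \<le> L * \<bar>x - y\<bar>"
    using lipschitz_on_bounded by blast
  have "(u t - v t)\<^sup>2 + 0\<^sup>2 \<le> ((u s - v s)\<^sup>2 + 0\<^sup>2) * exp ((2 * L + 1) * \<bar>t - s\<bar>)"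
    by (rule compare_solutions[OF L u v]) (use R in \<open>fastforce simp: le_max_iff_disj\<close>)+
  then show ?thesis using \<open>u s = v s\<close> by simp
qed

definition entire_solution :: "'w \<Rightarrow> (real \<Rightarrow> real) \<Rightarrow> bool" where
  "entire_solution \<omega> u \<longleftrightarrow> (\<forall>t. (u has_real_derivative f (\<sigma> t \<omega>) (u t)) (at t))"

lemma entire_solution_deriv:
  "entire_solution \<omega> u \<Longrightarrow> (u has_real_derivative f (\<sigma> t \<omega>) (u t)) (at t)"
  by (simp add: entire_solution_def)

text \<open>Uniqueness makes the description in the definition of \<^const>\<open>sol\<close> a proper one.\<close>

lemma sol_eq:
  assumes I: "is_solution \<sigma> f \<omega> x0 I u" and "t \<in> I"
  shows "sol \<sigma> f t \<omega> x0 = u t"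
  unfolding sol_def
proof (rule the_equality)
  show "\<exists>I u'. is_solution \<sigma> f \<omega> x0 I u' \<and> t \<in> I \<and> u' t = u t" using assms by blast
  fix y assume "\<exists>J v. is_solution \<sigma> f \<omega> x0 J v \<and> t \<in> J \<and> v t = y"
  then obtain J v where J: "is_solution \<sigma> f \<omega> x0 J v" "t \<in> J" "v t = y" by blast
  have "closed_segment 0 t \<subseteq> I" "closed_segment 0 t \<subseteq> J"
    using assms J by (simp_all add: is_solution_def is_interval_convex_1 closed_segment_subset)
  then have "(u has_real_derivative f (\<sigma> x \<omega>) (u x)) (at x)" "(v has_real_derivative f (\<sigma> x \<omega>) (v x)) (at x)"
    if "x \<in> closed_segment 0 t" for x
    using I J(1) that unfolding is_solution_def by blast+
  then have "v t = u t"
    using I J(1) by (intro solutions_agree[of 0 t v \<omega> u]) (simp_all add: is_solution_def)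
  with J show "y = u t" by simp
qed

lemma entire_solution_imp_sol:
  assumes "entire_solution \<omega> u"
  shows "sol_dom \<sigma> f \<omega> (u 0) = UNIV" and "sol \<sigma> f t \<omega> (u 0) = u t"
proof -
  have *: "is_solution \<sigma> f \<omega> (u 0) UNIV u"
    using assms by (auto simp: is_solution_def entire_solution_def)
  then show "sol_dom \<sigma> f \<omega> (u 0) = UNIV" by (auto simp: sol_dom_def)
  show "sol \<sigma> f t \<omega> (u 0) = u t" by (rule sol_eq[OF *]) simp
qed

lemma entire_solution_sol:
  assumes "sol_dom \<sigma> f \<omega> x0 = UNIV"
  shows "entire_solution \<omega> (\<lambda>t. sol \<sigma> f t \<omega> x0)" and "sol \<sigma> f 0 \<omega> x0 = x0"
proof -
  have ex: "\<exists>I u. is_solution \<sigma> f \<omega> x0 I u \<and> t \<in> I" for t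
    using assms unfolding sol_dom_def by blast
  show "sol \<sigma> f 0 \<omega> x0 = x0"
    using ex[of 0] sol_eq[of \<omega> x0 _ _ 0] by (auto simp: is_solution_def)
  show "entire_solution \<omega> (\<lambda>t. sol \<sigma> f t \<omega> x0)"
    unfolding entire_solution_def
  proof
    fix t
    obtain I u where I: "is_solution \<sigma> f \<omega> x0 I u" "t \<in> I" using ex by blast
    then have "(u has_real_derivative f (\<sigma> t \<omega>) (u t)) (at t)" by (simp add: is_solution_def)
    then have "(u has_real_derivative f (\<sigma> t \<omega>) (sol \<sigma> f t \<omega> x0)) (at t)" by (simp add: sol_eq[OF I])
    then show "((\<lambda>t. sol \<sigma> f t \<omega> x0) has_real_derivative f (\<sigma> t \<omega>) (sol \<sigma> f t \<omega> x0)) (at t)"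
      by (rule has_field_derivative_transform_within_open[where S = I])
        (use I in \<open>auto simp: is_solution_def sol_eq[OF I(1)]\<close>)
  qed
qed

lemma entire_solution_eq:
  assumes "entire_solution \<omega> u" and "entire_solution \<omega> v" and "u s = v s"
  shows "u t = v t"
  using solutions_agree[of s t u \<omega> v] assms by (auto simp: entire_solution_def)

lemma entire_solution_continuous: "entire_solution \<omega> u \<Longrightarrow> continuous_on S u"
  by (intro continuous_at_imp_continuous_on ballI) (blast intro: DERIV_isCont entire_solution_deriv)

lemma entire_solution_less:
  assumes u: "entire_solution \<omega> u" and v: "entire_solution \<omega> v" and "u s < v s"
  shows "u t < v t"
proof (rule ccontr)
  assume "\<not> u t < v t"
  have "connected ((\<lambda>x. v x - u x) ` UNIV)"
    by (intro connected_continuous_image continuous_intros entire_solution_continuous[OF u]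
        entire_solution_continuous[OF v]) auto
  from connectedD_interval[OF this, of "v t - u t" "v s - u s" 0]
  have "0 \<in> range (\<lambda>x. v x - u x)" using \<open>u s < v s\<close> \<open>\<not> u t < v t\<close> by simp
  then obtain x where "0 = v x - u x" by blast
  then have "u x = v x" by simp
  then have "u s = v s" by (rule entire_solution_eq[OF u v])
  then show False using \<open>u s < v s\<close> by simp
qed

text \<open>The uniform bound \<open>R\<close> confines all solutions to a set on which one Lipschitz constant is valid; the
  vector fields over \<open>\<theta> n\<close> are uniformly close, on \<open>[0, t]\<close>, to the one over \<open>\<omega>\<close>.\<close>

lemma continuous_dependence:
  assumes u: "\<And>n. entire_solution (\<theta> n) (u n)" "\<And>n t. \<bar>u n t\<bar> \<le> R"
    and v: "entire_solution \<omega> v" "\<And>t. \<bar>v t\<bar> \<le> R"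
    and \<theta>: "\<theta> \<longlonglongrightarrow> \<omega>" and u0: "(\<lambda>n. u n 0) \<longlonglongrightarrow> v 0"
  shows "(\<lambda>n. u n t) \<longlonglongrightarrow> v t"
proof -
  obtain L where L: "L \<ge> 0" "\<And>\<omega> x y. \<bar>x\<bar> \<le> R \<Longrightarrow> \<bar>y\<bar> \<le> R \<Longrightarrow> \<bar>f \<omega> x - f \<omega> y\<bar> \<le> L * \<bar>x - y\<bar>"
    using lipschitz_on_bounded by blast
  define E where "E = exp ((2 * L + 1) * \<bar>t\<bar>)"
  have "E > 0" by (simp add: E_def)
  have "(\<lambda>n. (u n t - v t)\<^sup>2) \<longlonglongrightarrow> 0"
  proof (rule LIMSEQ_I)
    fix \<epsilon> :: real assume "\<epsilon> > 0"
    \<comment> \<open>The perturbation contributes \<open>e\<^sup>2 E = \<epsilon> / 2\<close> to the final estimate.\<close>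
    define e where "e = sqrt (\<epsilon> / (2 * E))"
    have "e > 0" using \<open>\<epsilon> > 0\<close> \<open>E > 0\<close> by (simp add: e_def)
    have e2: "e\<^sup>2 * E = \<epsilon> / 2" using \<open>\<epsilon> > 0\<close> \<open>E > 0\<close> by (simp add: e_def)
    have "continuous_on (UNIV \<times> closed_segment 0 t) (\<lambda>p. v (snd p))"
      by (rule continuous_on_compose2[OF entire_solution_continuous[OF v(1), of UNIV]])
        (auto intro: continuous_intros)
    then have "uniformly_continuous_on (UNIV \<times> closed_segment 0 t) (\<lambda>(\<omega>, x). f (\<sigma> x \<omega>) (v x))"
      by (intro compact_uniformly_continuous compact_Times compact_base compact_segment)
        (auto simp: case_prod_unfold intro!: continuous_intros)
    from this[unfolded uniformly_continuous_on_def, rule_format, OF \<open>e > 0\<close>]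
    obtain d where d: "d > 0" "\<And>p q. p \<in> UNIV \<times> closed_segment 0 t \<Longrightarrow> q \<in> UNIV \<times> closed_segment 0 t \<Longrightarrow>
        dist q p < d \<Longrightarrow> dist (case q of (\<omega>, x) \<Rightarrow> f (\<sigma> x \<omega>) (v x)) (case p of (\<omega>, x) \<Rightarrow> f (\<sigma> x \<omega>) (v x)) < e"
      by blast
    have "\<forall>\<^sub>F n in sequentially. dist (\<theta> n) \<omega> < d" using \<theta> d(1) by (rule tendstoD)
    moreover have "(\<lambda>n. (u n 0 - v 0)\<^sup>2 * E) \<longlonglongrightarrow> (v 0 - v 0)\<^sup>2 * E"
      by (intro tendsto_intros u0)
    then have "\<forall>\<^sub>F n in sequentially. (u n 0 - v 0)\<^sup>2 * E < \<epsilon> / 2"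
      using \<open>\<epsilon> > 0\<close> by (intro order_tendstoD) auto
    ultimately have "\<forall>\<^sub>F n in sequentially. (u n t - v t)\<^sup>2 < \<epsilon>"
    proof eventually_elim
      case (elim n)
      have "(u n t - v t)\<^sup>2 + e\<^sup>2 \<le> ((u n 0 - v 0)\<^sup>2 + e\<^sup>2) * exp ((2 * L + 1) * \<bar>t - 0\<bar>)"
      proof (rule compare_solutions[OF L])
        fix x assume x: "x \<in> closed_segment 0 t"
        show "\<bar>f (\<sigma> x (\<theta> n)) (v x) - f (\<sigma> x \<omega>) (v x)\<bar> \<le> e"
          using d(2)[of "(\<omega>, x)" "(\<theta> n, x)"] x elim(1) by (simp add: dist_Pair_Pair dist_real_def)
      qed (use u v in \<open>auto simp: entire_solution_def\<close>)
      also have "\<dots> = (u n 0 - v 0)\<^sup>2 * E + e\<^sup>2 * E" by (simp add: E_def algebra_simps)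
      also have "\<dots> < \<epsilon>" using elim(2) e2 by simp
      finally show ?case using zero_le_power2[of e] by linarith
    qed
    then show "\<exists>no. \<forall>n\<ge>no. norm ((u n t - v t)\<^sup>2 - 0) < \<epsilon>"
      by (simp add: eventually_sequentially)
  qed
  then have "(\<lambda>n. sqrt ((u n t - v t)\<^sup>2)) \<longlonglongrightarrow> sqrt 0" by (intro tendsto_intros)
  then have "(\<lambda>n. u n t - v t) \<longlonglongrightarrow> 0" by (simp add: tendsto_rabs_zero_iff)
  then show ?thesis by (simp add: LIM_zero_iff)
qed

end

section \<open>Invariant measures\<close>

lemma eventually_in_closed_cluster_point:
  assumes "inf (nhds x) F \<noteq> bot" and "closed C" and "\<forall>\<^sub>F y in F. y \<in> C"
  shows "x \<in> C"
proof (rule ccontr)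
  assume "x \<notin> C"
  then have "\<forall>\<^sub>F y in nhds x. y \<in> - C"
    using \<open>closed C\<close> by (intro eventually_nhds_in_open) auto
  then have "\<forall>\<^sub>F y in inf (nhds x) F. False"
    using assms(3) by (auto simp: eventually_inf)
  then show False using assms(1) by (simp add: eventually_False)
qed

lemma compact_unit_cube: "compact {h :: 'i \<Rightarrow> real. \<forall>i. h i \<in> {0..1}}"
proof -
  have "compactin (product_topology (\<lambda>i::'i. euclidean) UNIV) (PiE UNIV (\<lambda>_. {0..1::real}))"
    by (simp add: compactin_PiE)
  moreover have "PiE UNIV (\<lambda>_. {0..1::real}) = {h :: 'i \<Rightarrow> real. \<forall>i. h i \<in> {0..1}}"
    by (auto simp: PiE_def)
  ultimately show ?thesis
    by (simp add: euclidean_product_topology)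
qed

text \<open>A content known only on closed sets of a compact space extends to a Borel measure: open sets are
  approximated from inside by closed sets, arbitrary sets from outside by open ones, and compactness
  turns finite into countable subadditivity.\<close>

locale closed_content =
  fixes \<mu> :: "'w::metric_space set \<Rightarrow> ennreal"
  assumes compact_space: "compact (UNIV :: 'w set)"
    and mono: "closed K \<Longrightarrow> closed L \<Longrightarrow> K \<subseteq> L \<Longrightarrow> \<mu> K \<le> \<mu> L"
    and subadd: "closed K \<Longrightarrow> closed L \<Longrightarrow> \<mu> (K \<union> L) \<le> \<mu> K + \<mu> L"
    and superadd: "closed K \<Longrightarrow> closed L \<Longrightarrow> K \<inter> L = {} \<Longrightarrow> \<mu> K + \<mu> L \<le> \<mu> (K \<union> L)"
    and empty: "\<mu> {} = 0"
    and finite: "\<mu> UNIV < \<infinity>"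
begin

definition inner_mass :: "'w set \<Rightarrow> ennreal" where
  "inner_mass V = (SUP K\<in>{K. closed K \<and> K \<subseteq> V}. \<mu> K)"

definition outer_mass :: "'w set \<Rightarrow> ennreal" where
  "outer_mass E = (INF V\<in>{V. open V \<and> E \<subseteq> V}. inner_mass V)"

lemma inner_upper: "closed K \<Longrightarrow> K \<subseteq> V \<Longrightarrow> \<mu> K \<le> inner_mass V"
  unfolding inner_mass_def by (auto intro: SUP_upper)

lemma inner_mono: "V \<subseteq> W \<Longrightarrow> inner_mass V \<le> inner_mass W"
  unfolding inner_mass_def by (rule SUP_subset_mono) auto

lemma outer_mono: "E \<subseteq> F \<Longrightarrow> outer_mass E \<le> outer_mass F"
  unfolding outer_mass_def by (rule INF_superset_mono) auto

lemma outer_le_inner: "open V \<Longrightarrow> E \<subseteq> V \<Longrightarrow> outer_mass E \<le> inner_mass V"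
  unfolding outer_mass_def by (auto intro: INF_lower)

lemma outer_open: "open V \<Longrightarrow> outer_mass V = inner_mass V"
  unfolding outer_mass_def by (intro antisym INF_lower INF_greatest inner_mono) auto

lemma inner_UNIV: "inner_mass UNIV = \<mu> UNIV"
  by (intro antisym inner_upper) (auto simp: inner_mass_def intro!: SUP_least mono)

lemma outer_finite: "outer_mass E < \<infinity>"
  using outer_mono[of E UNIV] finite by (auto simp: outer_open inner_UNIV)

text \<open>Normality: this is what transfers subadditivity from closed sets to open sets.\<close>

lemma closed_split:
  fixes K V W :: "'w set"
  assumes "closed K" and "open V" and "open W" and "K \<subseteq> V \<union> W"
  obtains K1 K2 where "closed K1" "closed K2" "K1 \<subseteq> V" "K2 \<subseteq> W" "K = K1 \<union> K2"
proof -
  have "closed (K - V)" "closed (K - W)" "(K - V) \<inter> (K - W) = {}"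
    using assms by auto
  from t4_space[OF this] obtain A B
    where AB: "open A" "open B" "K - V \<subseteq> A" "K - W \<subseteq> B" "A \<inter> B = {}" by blast
  show thesis
    by (rule that[of "K - A" "K - B"]) (use AB assms in \<open>auto intro: closed_Diff\<close>)
qed

lemma content_le_sum_inner:
  assumes "\<And>i. open (V i)" and "closed K" and "K \<subseteq> (\<Union>i<n. V i)"
  shows "\<mu> K \<le> (\<Sum>i<(n::nat). inner_mass (V i))"
  using assms(2,3)
proof (induction n arbitrary: K)
  case 0
  then show ?case by (simp add: empty)
next
  case (Suc n)
  have "open (\<Union>i<n. V i)" "K \<subseteq> (\<Union>i<n. V i) \<union> V n"
    using Suc.prems(2) assms(1) by (auto simp: lessThan_Suc)
  from closed_split[OF Suc.prems(1) this(1) assms(1) this(2)]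
  obtain K1 K2 where K: "closed K1" "closed K2" "K1 \<subseteq> (\<Union>i<n. V i)" "K2 \<subseteq> V n" "K = K1 \<union> K2" .
  have "\<mu> K \<le> \<mu> K1 + \<mu> K2" using subadd K by simp
  also have "\<dots> \<le> (\<Sum>i<n. inner_mass (V i)) + inner_mass (V n)"
    by (intro add_mono Suc.IH inner_upper K)
  finally show ?case by simp
qed

lemma inner_countably_subadditive:
  assumes V: "\<And>i::nat. open (V i)"
  shows "inner_mass (\<Union>i. V i) \<le> (\<Sum>i. inner_mass (V i))"
  unfolding inner_mass_def[of "\<Union>i. V i"]
proof (rule SUP_least)
  fix K assume "K \<in> {K. closed K \<and> K \<subseteq> (\<Union>i. V i)}"
  then have K: "closed K" "K \<subseteq> (\<Union>i. V i)" by auto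
  then have "compact K" using compact_Int_closed[OF compact_space] by fastforce
  from compactE_image[OF this V K(2)]
  obtain C where C: "finite C" "K \<subseteq> (\<Union>i\<in>C. V i)" .
  then obtain n where "\<forall>i\<in>C. i < n" unfolding finite_nat_set_iff_bounded by blast
  then have "\<mu> K \<le> (\<Sum>i<n. inner_mass (V i))"
    using C by (intro content_le_sum_inner V K) fastforce
  also have "\<dots> \<le> (\<Sum>i. inner_mass (V i))" by (rule sum_le_suminf) auto
  finally show "\<mu> K \<le> (\<Sum>i. inner_mass (V i))" .
qed

lemma outer_measure_space_outer: "outer_measure_space UNIV outer_mass"
  unfolding outer_measure_space_def
proof (intro conjI)
  have "inner_mass {} = 0" unfolding inner_mass_def by (auto simp: empty intro!: SUP_eq_const)
  then show "positive UNIV outer_mass" by (simp add: positive_def outer_open)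
  show "increasing UNIV outer_mass" by (simp add: increasing_def outer_mono)
  show "countably_subadditive UNIV outer_mass"
    unfolding countably_subadditive_def
  proof (intro allI impI)
    fix A :: "nat \<Rightarrow> 'w set"
    show "outer_mass (\<Union>i. A i) \<le> (\<Sum>i. outer_mass (A i))"
    proof (rule ennreal_le_epsilon)
      fix e :: real assume "e > 0"
      have "\<exists>V. open V \<and> A n \<subseteq> V \<and> inner_mass V < outer_mass (A n) + e * (1/2) ^ Suc n" for n
      proof -
        have "outer_mass (A n) < outer_mass (A n) + ennreal (e * (1/2) ^ Suc n)"
          using outer_finite[of "A n"] \<open>e > 0\<close> by (auto simp: less_top)
        then show ?thesis
          unfolding outer_mass_def[of "A n"] by (subst (asm) INF_less_iff) auto
      qed
      then obtain V where V: "\<And>n. open (V n)" "\<And>n. A n \<subseteq> V n"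
        "\<And>n. inner_mass (V n) < outer_mass (A n) + e * (1/2) ^ Suc n" by metis
      have "outer_mass (\<Union>i. A i) \<le> inner_mass (\<Union>i. V i)"
        using V by (intro outer_le_inner) blast+
      also have "\<dots> \<le> (\<Sum>n. inner_mass (V n))" by (rule inner_countably_subadditive[OF V(1)])
      also have "\<dots> \<le> (\<Sum>n. outer_mass (A n) + e * (1/2) ^ Suc n)"
        using V(3) by (intro suminf_le allI) (auto intro: less_imp_le)
      also have "\<dots> = (\<Sum>n. outer_mass (A n)) + (\<Sum>n. ennreal e * ennreal ((1/2) ^ Suc n))"
        using \<open>0 < e\<close> by (subst suminf_add[symmetric])
          (auto simp del: ennreal_suminf_cmult simp add: ennreal_mult[symmetric])
      also have "\<dots> = (\<Sum>n. outer_mass (A n)) + e"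
        unfolding ennreal_suminf_cmult
        by (subst suminf_ennreal_eq[OF zero_le_power power_half_series]) auto
      finally show "outer_mass (\<Union>i. A i) \<le> (\<Sum>n. outer_mass (A n)) + e" .
    qed
  qed
qed

text \<open>A closed subset of \<open>U \<inter> V\<close> nearly exhausts it, and its complement in \<open>V\<close> is an open
  set covering \<open>V - U\<close>; disjoint closed sets add up. This is Caratheodory's criterion for
  open sets, tested on open sets.\<close>

lemma outer_split_open:
  assumes "open U" and "open V"
  shows "outer_mass (U \<inter> V) + outer_mass (V - U) \<le> inner_mass V"
proof -
  have "inner_mass (U \<inter> V) + outer_mass (V - U) \<le> inner_mass V"
    unfolding inner_mass_def[of "U \<inter> V"]
  proof (subst ennreal_SUP_add_left[symmetric])
    show "(SUP K\<in>{K. closed K \<and> K \<subseteq> U \<inter> V}. \<mu> K + outer_mass (V - U)) \<le> inner_mass V"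
    proof (rule SUP_least)
      fix K assume "K \<in> {K. closed K \<and> K \<subseteq> U \<inter> V}"
      then have K: "closed K" "K \<subseteq> U \<inter> V" by auto
      have "outer_mass (V - U) \<le> inner_mass (V - K)"
        using K assms by (intro outer_le_inner) auto
      then have "\<mu> K + outer_mass (V - U) \<le> \<mu> K + inner_mass (V - K)" by (intro add_left_mono)
      also have "\<dots> \<le> inner_mass V"
        unfolding inner_mass_def[of "V - K"]
      proof (subst ennreal_SUP_add_right)
        show "(SUP K'\<in>{K'. closed K' \<and> K' \<subseteq> V - K}. \<mu> K + \<mu> K') \<le> inner_mass V"
        proof (rule SUP_least)
          fix K' assume "K' \<in> {K'. closed K' \<and> K' \<subseteq> V - K}"
          then have "\<mu> K + \<mu> K' \<le> \<mu> (K \<union> K')" "closed (K \<union> K')" "K \<union> K' \<subseteq> V"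
            using K by (auto intro!: superadd)
          then show "\<mu> K + \<mu> K' \<le> inner_mass V"
            by (intro order_trans[OF _ inner_upper[of "K \<union> K'" V]])
        qed
      qed auto
      finally show "\<mu> K + outer_mass (V - U) \<le> inner_mass V" .
    qed
  qed auto
  then show ?thesis using assms by (simp add: outer_open open_Int)
qed

lemma measure_space_outer: "measure_space UNIV (sets borel) outer_mass"
proof -
  let ?L = "lambda_system UNIV UNIV outer_mass"
  have ms: "measure_space UNIV ?L outer_mass"
    using sigma_algebra.caratheodory_lemma[OF sigma_algebra_Pow, of UNIV outer_mass] outer_measure_space_outer by simp
  have sa: "subadditive UNIV outer_mass"
    using ring_of_sets.countably_subadditive_subadditive[of UNIV UNIV outer_mass]
      outer_measure_space_outer
    by (auto simp: outer_measure_space_def ring_of_sets_iff)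
  have "U \<in> ?L" if "open U" for U
  proof -
    have "outer_mass (U \<inter> E) + outer_mass (- U \<inter> E) = outer_mass E" for E
    proof (rule antisym)
      show "outer_mass (U \<inter> E) + outer_mass (- U \<inter> E) \<le> outer_mass E"
        unfolding outer_mass_def[of E]
      proof (rule INF_greatest)
        fix V assume "V \<in> {V. open V \<and> E \<subseteq> V}"
        then have V: "open V" "E \<subseteq> V" by auto
        have "outer_mass (U \<inter> E) + outer_mass (- U \<inter> E) \<le> outer_mass (U \<inter> V) + outer_mass (V - U)"
          using V by (intro add_mono outer_mono) auto
        also have "\<dots> \<le> inner_mass V" by (rule outer_split_open[OF that V(1)])
        finally show "outer_mass (U \<inter> E) + outer_mass (- U \<inter> E) \<le> inner_mass V" .
      qed
      have "outer_mass ((U \<inter> E) \<union> (- U \<inter> E)) \<le> outer_mass (U \<inter> E) + outer_mass (- U \<inter> E)"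
        by (rule subadditiveD[OF sa]) auto
      then show "outer_mass E \<le> outer_mass (U \<inter> E) + outer_mass (- U \<inter> E)"
        by (simp add: Int_Un_distrib2[symmetric])
    qed
    then show ?thesis by (simp add: lambda_system_def Compl_eq_Diff_UNIV)
  qed
  then have "sigma_sets UNIV {S. open S} \<subseteq> ?L"
    using ms by (intro sigma_algebra.sigma_sets_subset) (auto simp: measure_space_def)
  then have "sets borel \<subseteq> ?L" by (simp add: borel_def)
  moreover have "sigma_algebra UNIV (sets (borel :: 'w measure))"
    using sets.sigma_algebra_axioms[of borel] by simp
  ultimately show ?thesis by (intro measure_down[OF ms])
qed

definition borel_extension :: "'w measure" where
  "borel_extension = measure_of UNIV (sets borel) outer_mass"

lemma sets_borel_extension [simp]: "sets borel_extension = sets borel"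
  unfolding borel_extension_def
  using sets.sets_measure_of_eq[of borel outer_mass] by simp

lemma emeasure_borel_extension: "E \<in> sets borel \<Longrightarrow> emeasure borel_extension E = outer_mass E"
  unfolding borel_extension_def
  using measure_space_outer unfolding measure_space_def
  by (intro emeasure_measure_of_sigma) blast+

end

context compact_flow
begin

text \<open>The content of a closed set is a cluster point, in the product topology on all set functions, of
  the proportions of time that one orbit spends in the set during \<open>[0, n]\<close>. Shifting the orbit by \<open>t\<close>
  changes the time by at most \<open>\<bar>t\<bar>\<close>, which becomes negligible as \<open>n \<rightarrow> \<infinity>\<close>. Closedness keeps the
  sets of times measurable.\<close>

lemma ex_invariant_content:
  obtains \<mu> :: "'w set \<Rightarrow> real" where "\<And>K. 0 \<le> \<mu> K" "\<mu> {} = 0" "\<mu> UNIV = 1"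
    "\<And>K L. closed K \<Longrightarrow> closed L \<Longrightarrow> K \<subseteq> L \<Longrightarrow> \<mu> K \<le> \<mu> L"
    "\<And>K L. closed K \<Longrightarrow> closed L \<Longrightarrow> \<mu> (K \<union> L) \<le> \<mu> K + \<mu> L"
    "\<And>K L. closed K \<Longrightarrow> closed L \<Longrightarrow> K \<inter> L = {} \<Longrightarrow> \<mu> K + \<mu> L \<le> \<mu> (K \<union> L)"
    "\<And>K t. closed K \<Longrightarrow> \<mu> (\<sigma> t -` K) = \<mu> K"
proof -
  fix \<omega> :: 'w
  define S where "S K = {s. \<sigma> s \<omega> \<in> K}" for K
  define m where "m n K = measure lborel ({0..real (Suc n)} \<inter> S K) / real (Suc n)" for n K
  have closed_S: "closed (S K)" if "closed K" for K
    using continuous_closed_vimage[OF that, of "\<lambda>s. \<sigma> s \<omega>"] continuous_on_flow[of UNIV "\<lambda>s. s" "\<lambda>_. \<omega>"]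
    by (auto simp: S_def vimage_def continuous_on_eq_continuous_at)
  have fm: "{c..d} \<inter> S K \<in> fmeasurable lborel" if "closed K" for c d K
    using closed_S[OF that]
    by (intro fmeasurable_compact compact_Int_closed) auto
  have m01: "m n K \<in> {0..1}" for n K
  proof -
    have "measure lborel ({0..real (Suc n)} \<inter> S K) \<le> measure lborel {0..real (Suc n)}"
    proof (cases "{0..real (Suc n)} \<inter> S K \<in> sets lborel")
      case True
      then show ?thesis by (intro measure_mono_fmeasurable) (auto simp: fmeasurable_compact)
    qed (simp add: measure_notin_sets)
    then show ?thesis by (simp add: m_def)
  qed
  have "\<exists>\<mu>\<in>{h. \<forall>i. h i \<in> {0..1}}. inf (nhds \<mu>) (filtermap m sequentially) \<noteq> bot"
    using compact_unit_cube[where 'i = "'w set"] m01 unfolding compact_filter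
    by (auto simp: eventually_filtermap filtermap_bot_iff)
  then obtain \<mu> where \<mu>01: "\<forall>K. \<mu> K \<in> {0..1}"
    and cluster: "inf (nhds \<mu>) (filtermap m sequentially) \<noteq> bot" by blast
  have limit: "\<mu> \<in> C" if "closed C" "\<forall>\<^sub>F n in sequentially. m n \<in> C" for C
    using eventually_in_closed_cluster_point[OF cluster that(1)] that(2)
    by (simp add: eventually_filtermap)
  have [continuous_intros]: "continuous_on UNIV (\<lambda>h :: 'w set \<Rightarrow> real. h K)" for K
    by (rule continuous_on_product_coordinates)
  show thesis
  proof (rule that)
    show "0 \<le> \<mu> K" for K using \<mu>01 by auto
    have "\<mu> \<in> {h. h {} = 0}"
      by (rule limit) (auto intro!: closed_Collect_eq continuous_intros simp: m_def S_def)
    then show "\<mu> {} = 0" by simp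
    have "\<mu> \<in> {h. h UNIV = 1}"
      by (rule limit) (auto intro!: closed_Collect_eq continuous_intros simp: m_def S_def)
    then show "\<mu> UNIV = 1" by simp
  next
    fix K L :: "'w set" assume KL: "closed K" "closed L"
    have Un: "{0..c} \<inter> S (K \<union> L) = ({0..c} \<inter> S K) \<union> ({0..c} \<inter> S L)" for c
      by (auto simp: S_def)
    {
      assume "K \<subseteq> L"
      have "m n K \<le> m n L" for n
        unfolding m_def using \<open>K \<subseteq> L\<close> fm KL
        by (intro divide_right_mono measure_mono_fmeasurable) (auto simp: S_def fmeasurable_def)
      then have "\<mu> \<in> {h. h K \<le> h L}"
        by (intro limit closed_Collect_le continuous_intros) auto
      then show "\<mu> K \<le> \<mu> L" by simp
    next
      have "m n (K \<union> L) \<le> m n K + m n L" for n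
        unfolding m_def add_divide_distrib[symmetric] Un
        by (intro divide_right_mono measure_Un_le) (use fm KL in \<open>auto simp: fmeasurable_def\<close>)
      then have "\<mu> \<in> {h. h (K \<union> L) \<le> h K + h L}"
        by (intro limit closed_Collect_le continuous_intros) auto
      then show "\<mu> (K \<union> L) \<le> \<mu> K + \<mu> L" by simp
    next
      assume "K \<inter> L = {}"
      then have disj: "({0..c} \<inter> S K) \<inter> ({0..c} \<inter> S L) = {}" for c by (auto simp: S_def)
      have "m n K + m n L = m n (K \<union> L)" for n
        unfolding m_def add_divide_distrib[symmetric] Un
        by (subst measure_Un3[OF fm[OF KL(1)] fm[OF KL(2)]]) (simp only: disj measure_empty diff_zero)
      then have "\<mu> \<in> {h. h K + h L \<le> h (K \<union> L)}"
        by (intro limit closed_Collect_le continuous_intros) auto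
      then show "\<mu> K + \<mu> L \<le> \<mu> (K \<union> L)" by simp
    }
  next
    \<comment> \<open>Applied to \<open>-t\<close> as well, the inequality yields equality.\<close>
    have le: "\<mu> (\<sigma> t -` K) \<le> \<mu> K" if "closed K" for K t
    proof (rule field_le_epsilon)
      fix e :: real assume "e > 0"
      have meas: "measure lborel ({0..N} \<inter> S (\<sigma> t -` K)) \<le> measure lborel ({0..N} \<inter> S K) + \<bar>t\<bar>"
        if "N \<ge> 0" for N
      proof -
        have "{0..N} \<inter> S (\<sigma> t -` K) = (+) t -` ({t..N + t} \<inter> S K)"
          by (auto simp: S_def simp flip: flow_add)
        then have "measure lborel ({0..N} \<inter> S (\<sigma> t -` K))
            = measure (distr lborel borel ((+) t)) ({t..N + t} \<inter> S K)"
          using closed_S[OF \<open>closed K\<close>] by (subst measure_distr) (auto simp: closed_Int)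
        also have "\<dots> = measure lborel ({t..N + t} \<inter> S K)" by (simp add: lborel_distr_plus)
        also have "\<dots> \<le> measure lborel (({0..N} \<inter> S K) \<union> (if t \<ge> 0 then {N..N + t} else {t..0}))"
          using fm[OF \<open>closed K\<close>] fmeasurable_compact[OF compact_Icc]
          by (intro measure_mono_fmeasurable fmeasurable.Un) (auto simp: fmeasurable_def)
        also have "\<dots> \<le> measure lborel ({0..N} \<inter> S K) + measure lborel (if t \<ge> 0 then {N..N + t} else {t..0})"
          using fm[OF \<open>closed K\<close>] by (intro measure_Un_le) (auto simp: fmeasurable_def)
        also have "measure lborel (if t \<ge> 0 then {N..N + t} else {t..0}) = \<bar>t\<bar>" by simp
        finally show ?thesis .
      qed
      have "m n (\<sigma> t -` K) \<le> m n K + \<bar>t\<bar> / real (Suc n)" for n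
        unfolding m_def add_divide_distrib[symmetric] by (intro divide_right_mono meas) auto
      moreover have "(\<lambda>n. \<bar>t\<bar> / real (Suc n)) \<longlonglongrightarrow> 0"
        by (rule LIMSEQ_Suc[OF lim_const_over_n])
      then have "\<forall>\<^sub>F n in sequentially. \<bar>t\<bar> / real (Suc n) < e"
        using \<open>e > 0\<close> by (intro order_tendstoD)
      ultimately have "\<forall>\<^sub>F n in sequentially. m n (\<sigma> t -` K) \<le> m n K + e"
        by (elim eventually_mono) (smt (verit))
      then have "\<mu> \<in> {h. h (\<sigma> t -` K) \<le> h K + e}"
        by (intro limit closed_Collect_le continuous_intros) auto
      then show "\<mu> (\<sigma> t -` K) \<le> \<mu> K + e" by simp
    qed
    fix K :: "'w set" and t assume "closed K"
    then have "closed (\<sigma> t -` K)" by (rule closed_vimage) (intro continuous_intros)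
    from le[OF this, of "- t"] le[OF \<open>closed K\<close>, of t]
    show "\<mu> (\<sigma> t -` K) = \<mu> K" by (simp add: vimage_def)
  qed
qed

text \<open>Invariance passes from the content to its extension because each \<open>\<sigma>\<^sub>t\<close> is a homeomorphism and so
  permutes the closed and the open sets.\<close>

theorem ex_invariant_probability:
  obtains m where "sets m = sets borel" "prob_space m" "\<And>t. distr m borel (\<sigma> t) = m"
proof (rule ex_invariant_content)
  fix \<mu> :: "'w set \<Rightarrow> real"
  assume \<mu>: "\<And>K. 0 \<le> \<mu> K" "\<mu> {} = 0" "\<mu> UNIV = 1"
    "\<And>K L. closed K \<Longrightarrow> closed L \<Longrightarrow> K \<subseteq> L \<Longrightarrow> \<mu> K \<le> \<mu> L"
    "\<And>K L. closed K \<Longrightarrow> closed L \<Longrightarrow> \<mu> (K \<union> L) \<le> \<mu> K + \<mu> L"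
    "\<And>K L. closed K \<Longrightarrow> closed L \<Longrightarrow> K \<inter> L = {} \<Longrightarrow> \<mu> K + \<mu> L \<le> \<mu> (K \<union> L)"
    "\<And>K t. closed K \<Longrightarrow> \<mu> (\<sigma> t -` K) = \<mu> K"
  interpret closed_content "\<lambda>K. ennreal (\<mu> K)"
    by unfold_locales (use \<mu> compact_base in \<open>auto simp flip: ennreal_plus intro!: ennreal_leI\<close>)
  have cont: "continuous_on UNIV (\<sigma> t)" for t
    using continuous_on_flow[of UNIV "\<lambda>_. t" "\<lambda>x. x"] by (simp add: continuous_intros)
  have closed_v: "closed (\<sigma> t -` K)" if "closed K" for t K
    using closed_vimage[OF that cont] .
  have open_v: "open (\<sigma> t -` V)" if "open V" for t V
    using open_vimage[OF that cont] .
  have vimage_cancel: "\<sigma> (- t) -` (\<sigma> t -` E) = E" "\<sigma> t -` (\<sigma> (- t) -` E) = E" for t E by auto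
  have inner_le: "inner_mass V \<le> inner_mass (\<sigma> t -` V)" for V t
    unfolding inner_mass_def[of V]
  proof (rule SUP_least)
    fix K assume "K \<in> {K. closed K \<and> K \<subseteq> V}"
    then have "ennreal (\<mu> K) = ennreal (\<mu> (\<sigma> t -` K))" "closed (\<sigma> t -` K)" "\<sigma> t -` K \<subseteq> \<sigma> t -` V"
      using \<mu>(7) closed_v by auto
    then show "ennreal (\<mu> K) \<le> inner_mass (\<sigma> t -` V)" by (simp add: inner_upper)
  qed
  have inner_inv: "inner_mass (\<sigma> t -` V) = inner_mass V" for V t
    using inner_le[of V t] inner_le[of "\<sigma> t -` V" "- t"] vimage_cancel by (intro antisym) auto
  have outer_le: "outer_mass (\<sigma> t -` E) \<le> outer_mass E" for E t
    unfolding outer_mass_def[of E]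
  proof (rule INF_greatest)
    fix V assume "V \<in> {V. open V \<and> E \<subseteq> V}"
    then have "outer_mass (\<sigma> t -` E) \<le> inner_mass (\<sigma> t -` V)"
      by (intro outer_le_inner open_v) auto
    then show "outer_mass (\<sigma> t -` E) \<le> inner_mass V" by (simp add: inner_inv)
  qed
  have outer_inv: "outer_mass (\<sigma> t -` E) = outer_mass E" for E t
    using outer_le[of t E] outer_le[of "- t" "\<sigma> t -` E"] vimage_cancel by (intro antisym) auto
  have meas: "\<sigma> t \<in> borel_measurable borel" for t
    by (rule borel_measurable_continuous_onI[OF cont])
  show thesis
  proof (rule that)
    show "sets borel_extension = sets borel" by simp
    then have sp: "space borel_extension = UNIV" using sets_eq_imp_space_eq by fastforce
    have "outer_mass UNIV = 1" by (simp add: outer_open inner_UNIV \<mu>(3))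
    then show "prob_space borel_extension"
      by (intro prob_spaceI) (simp add: sp emeasure_borel_extension)
    fix t
    have mt: "\<sigma> t \<in> measurable borel_extension borel"
      using meas by (simp cong: measurable_cong_sets)
    show "distr borel_extension borel (\<sigma> t) = borel_extension"
    proof (rule measure_eqI)
      fix E assume "E \<in> sets (distr borel_extension borel (\<sigma> t))"
      then have E: "E \<in> sets borel" by simp
      then have "\<sigma> t -` E \<in> sets borel" using measurable_sets[OF meas, of E t] by simp
      then show "emeasure (distr borel_extension borel (\<sigma> t)) E = emeasure borel_extension E"
        using E mt by (simp add: emeasure_distr sp emeasure_borel_extension outer_inv)
    qed simp
  qed
qed

text \<open>The difference quotients of \<open>h\<close> along the flow have integral zero by invariance, and they converge
  boundedly to \<open>c\<close>. Stated for a flow that factors onto \<open>\<sigma>\<close>, it applies to measures on a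
  set in the product.\<close>

lemma integral_eq_zero_of_primitive:
  fixes \<Phi> :: "real \<Rightarrow> 'p::topological_space \<Rightarrow> 'p"
  assumes c: "continuous_on UNIV c" and h: "continuous_on UNIV h"
    and prim: "\<And>\<omega> t. h (\<sigma> t \<omega>) - h \<omega> = integral_along c t \<omega>"
    and \<nu>: "\<nu> \<in> invariant_measures \<Phi> M"
    and pr: "pr \<in> borel_measurable \<nu>" "\<And>t p. p \<in> M \<Longrightarrow> pr (\<Phi> t p) = \<sigma> t (pr p)"
  shows "(\<integral>p. c (pr p) \<partial>\<nu>) = 0"
proof -
  interpret prob_space \<nu> using \<nu> by (simp add: invariant_measures_def)
  have inv: "\<Phi> t \<in> measurable \<nu> \<nu>" "distr \<nu> \<nu> (\<Phi> t) = \<nu>" for t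
    using \<nu> by (auto simp: invariant_measures_def)
  have "sets \<nu> = sets (restrict_space borel M)" using \<nu> by (simp add: invariant_measures_def)
  then have space: "space \<nu> = M" by (auto dest: sets_eq_imp_space_eq simp: space_restrict_space)
  have meas: "(\<lambda>p. w (pr p)) \<in> borel_measurable \<nu>" if "continuous_on UNIV w" for w :: "'w \<Rightarrow> real"
    using measurable_comp[OF pr(1) borel_measurable_continuous_onI[OF that]] by (simp add: o_def)
  have cont_shift: "continuous_on UNIV (\<lambda>\<omega>. h (\<sigma> t \<omega>))" for t
    by (rule continuous_on_compose2[OF h]) (auto intro!: continuous_intros)
  obtain B where B: "\<And>\<omega>. \<bar>h \<omega>\<bar> \<le> B" using bounded_continuous_base[OF h] by blast
  obtain K where K: "\<And>\<omega>. \<bar>c \<omega>\<bar> \<le> K" using bounded_continuous_base[OF c] by blast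
  have int: "integrable \<nu> (\<lambda>p. h (pr p))" "integrable \<nu> (\<lambda>p. h (\<sigma> t (pr p)))" for t
    using meas[OF h] meas[OF cont_shift] B by (auto intro!: integrable_const_bound[where B = B])
  have same: "(\<integral>p. h (\<sigma> t (pr p)) \<partial>\<nu>) = (\<integral>p. h (pr p) \<partial>\<nu>)" for t
  proof -
    have "(\<integral>p. h (pr p) \<partial>\<nu>) = (\<integral>p. h (pr p) \<partial>distr \<nu> \<nu> (\<Phi> t))" by (simp add: inv)
    also have "\<dots> = (\<integral>p. h (pr (\<Phi> t p)) \<partial>\<nu>)" by (rule integral_distr[OF inv(1) meas[OF h]])
    also have "\<dots> = (\<integral>p. h (\<sigma> t (pr p)) \<partial>\<nu>)"
      by (rule Bochner_Integration.integral_cong) (simp_all add: space pr(2))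
    finally show ?thesis ..
  qed
  define q where "q n \<omega> = real (Suc n) * (h (\<sigma> (1 / real (Suc n)) \<omega>) - h \<omega>)" for n \<omega>
  have q_int: "(\<integral>p. q n (pr p) \<partial>\<nu>) = 0" for n
    unfolding q_def using int same by simp
  have q_bound: "\<bar>q n \<omega>\<bar> \<le> K" for n \<omega>
  proof -
    have "\<exists>z>0. z < 1 / real (Suc n) \<and>
      h (\<sigma> (1 / real (Suc n)) \<omega>) - h (\<sigma> 0 \<omega>) = (1 / real (Suc n) - 0) * c (\<sigma> z \<omega>)"
      by (rule MVT2) (auto intro: primitive_deriv[OF c prim])
    then obtain z where "h (\<sigma> (1 / real (Suc n)) \<omega>) - h \<omega> = (1 / real (Suc n)) * c (\<sigma> z \<omega>)" by auto
    then have "q n \<omega> = c (\<sigma> z \<omega>)" by (simp add: q_def)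
    then show ?thesis using K by simp
  qed
  have q_lim: "(\<lambda>n. q n \<omega>) \<longlonglongrightarrow> c \<omega>" for \<omega>
  proof -
    have "((\<lambda>t. (h (\<sigma> t \<omega>) - h (\<sigma> 0 \<omega>)) / (t - 0)) \<longlongrightarrow> c (\<sigma> 0 \<omega>)) (at 0)"
      using primitive_deriv[OF c prim, of \<omega> 0] by (simp add: has_field_derivative_iff)
    moreover have "filterlim (\<lambda>n. 1 / real (Suc n)) (at 0) sequentially"
      unfolding filterlim_at using LIMSEQ_Suc[OF lim_1_over_n] by simp
    ultimately have "(\<lambda>n. (h (\<sigma> (1 / real (Suc n)) \<omega>) - h (\<sigma> 0 \<omega>)) / (1 / real (Suc n) - 0)) \<longlonglongrightarrow> c (\<sigma> 0 \<omega>)"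
      by (rule filterlim_compose)
    then show ?thesis by (simp add: q_def mult.commute)
  qed
  have "(\<lambda>n. \<integral>p. q n (pr p) \<partial>\<nu>) \<longlonglongrightarrow> (\<integral>p. c (pr p) \<partial>\<nu>)"
  proof (rule integral_dominated_convergence[where w = "\<lambda>_. K"])
    show "(\<lambda>p. c (pr p)) \<in> borel_measurable \<nu>" by (rule meas[OF c])
    show "(\<lambda>p. q n (pr p)) \<in> borel_measurable \<nu>" for n
      unfolding q_def using meas[OF h] meas[OF cont_shift] by (intro borel_measurable_times borel_measurable_diff) auto
    show "integrable \<nu> (\<lambda>_. K)" by simp
    show "AE p in \<nu>. (\<lambda>n. q n (pr p)) \<longlonglongrightarrow> c (pr p)" using q_lim by simp
    show "AE p in \<nu>. norm (q n (pr p)) \<le> K" for n using q_bound by simp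
  qed
  then show ?thesis by (simp add: q_int LIMSEQ_const_iff)
qed

end

section \<open>Growth bounds, monotone orbits and the dissipative nonlinearity\<close>

context compact_flow
begin

text \<open>Every \<open>\<epsilon> > 0\<close> lies outside the spectrum, so there is a dichotomy at \<open>\<epsilon>\<close>. It cannot be of the growing
  type: that type is inherited by all smaller parameters, so the spectrum, contained in
  \<open>(-\<infinity>, 0]\<close>, would be empty and its supremum \<open>-\<infinity>\<close>. The decaying type is the stated bound.\<close>

lemma spectrum_growth:
  assumes a: "continuous_on UNIV a" and sup: "Sup (ereal ` sacker_sell_spectrum \<sigma> a) = 0"
    and "\<epsilon> > 0"
  obtains C where "\<And>\<omega> t. t \<ge> 0 \<Longrightarrow> integral_along a t \<omega> \<le> C + \<epsilon> * t"
proof -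
  have shift: "(LBINT l=ereal 0..ereal t. a (\<sigma> l \<omega>) - r) = integral_along a t \<omega> - r * t" for r t \<omega>
  proof -
    have "(LBINT l=ereal 0..ereal t. a (\<sigma> l \<omega>) - r) = integral_along (\<lambda>\<omega>. a \<omega> - r) t \<omega>"
      by (simp add: integral_along_def)
    also have "\<dots> = (integral_along a t \<omega> - r * t) - (integral_along a 0 \<omega> - r * 0)"
      by (rule integral_along_eqI) (auto intro!: continuous_intros a derivative_eq_intros integral_along_deriv)
    finally show ?thesis by simp
  qed
  define grows where "grows r \<longleftrightarrow> (\<exists>\<kappa>\<ge>1. \<exists>\<gamma>>0. \<forall>\<omega>. \<forall>t\<le>0.
    exp (integral_along a t \<omega> - r * t) \<le> \<kappa> * exp (\<gamma> * t))" for r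
  define decays where "decays r \<longleftrightarrow> (\<exists>\<kappa>\<ge>1. \<exists>\<gamma>>0. \<forall>\<omega>. \<forall>t\<ge>0.
    exp (integral_along a t \<omega> - r * t) \<le> \<kappa> * exp (- \<gamma> * t))" for r
  have spec: "r \<in> sacker_sell_spectrum \<sigma> a \<longleftrightarrow> \<not> grows r \<and> \<not> decays r" for r
    unfolding sacker_sell_spectrum_def exponential_dichotomy_def shift grows_def decays_def by blast
  have nonpos: "r \<le> 0" if "r \<in> sacker_sell_spectrum \<sigma> a" for r
    using SUP_upper[OF that, of ereal] sup by simp
  have "decays \<epsilon>"
  proof (rule ccontr)
    assume "\<not> decays \<epsilon>"
    then have "grows \<epsilon>" using spec nonpos[of \<epsilon>] \<open>\<epsilon> > 0\<close> by auto
    then obtain \<kappa> \<gamma> where k: "\<kappa> \<ge> 1" "\<gamma> > 0"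
      "\<And>\<omega> t. t \<le> 0 \<Longrightarrow> exp (integral_along a t \<omega> - \<epsilon> * t) \<le> \<kappa> * exp (\<gamma> * t)"
      unfolding grows_def by blast
    \<comment> \<open>For \<open>t \<le> 0\<close>, lowering the parameter only lowers the exponent.\<close>
    have "grows r" if "r \<le> 0" for r
    proof -
      have "exp (integral_along a t \<omega> - r * t) \<le> \<kappa> * exp (\<gamma> * t)" if "t \<le> 0" for \<omega> t
      proof -
        have "\<epsilon> * t \<le> r * t"
          using \<open>r \<le> 0\<close> \<open>\<epsilon> > 0\<close> \<open>t \<le> 0\<close> by (intro mult_right_mono_neg) auto
        then have "exp (integral_along a t \<omega> - r * t) \<le> exp (integral_along a t \<omega> - \<epsilon> * t)" by simp
        also have "\<dots> \<le> \<kappa> * exp (\<gamma> * t)" by (rule k(3)[OF that])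
        finally show ?thesis .
      qed
      then show ?thesis unfolding grows_def using k(1,2) by blast
    qed
    then have "sacker_sell_spectrum \<sigma> a = {}" using spec nonpos by blast
    then show False using sup by (simp add: bot_ereal_def)
  qed
  then obtain \<kappa> \<gamma> where k: "\<kappa> \<ge> 1" "\<gamma> > 0"
    "\<And>\<omega> t. t \<ge> 0 \<Longrightarrow> exp (integral_along a t \<omega> - \<epsilon> * t) \<le> \<kappa> * exp (- \<gamma> * t)"
    unfolding decays_def by blast
  show thesis
  proof (rule that)
    fix \<omega> and t :: real assume t: "t \<ge> 0"
    have "exp (integral_along a t \<omega> - \<epsilon> * t) \<le> \<kappa> * exp (- \<gamma> * t)" by (rule k(3)[OF t])
    also have "\<dots> \<le> \<kappa> * 1" using k(1,2) t by (intro mult_left_mono) auto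
    finally have "ln (exp (integral_along a t \<omega> - \<epsilon> * t)) \<le> ln \<kappa>"
      using k(1) by (subst ln_le_cancel_iff) auto
    then show "integral_along a t \<omega> \<le> ln \<kappa> + \<epsilon> * t" by simp
  qed
qed

end

context minimal_compact_flow
begin

text \<open>Here \<open>L\<close> is the limit of \<open>\<psi>\<close> along the orbit as \<open>t \<rightarrow> -\<infinity>\<close>. For \<open>\<epsilon> > 0\<close> and \<open>t\<close> near
  \<open>-\<infinity>\<close> the speed of \<open>\<psi>\<close> is at most \<open>G (L - \<epsilon>) \<le> 0\<close>, by monotonicity of \<open>G\<close>; as \<open>\<psi>\<close> is bounded above, the
  integral of \<open>G (L - \<epsilon>)\<close> along the backward orbit is finite, so \<open>G (L - \<epsilon>)\<close> vanishes
  identically. The level \<open>m\<close> guarantees the sign of \<open>G\<close> just below \<open>L\<close>.\<close>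

lemma monotone_orbit_limit:
  assumes G: "continuous_on UNIV (\<lambda>(\<omega>, x). G \<omega> x)"
    and anti: "\<And>\<omega> x y. x \<le> y \<Longrightarrow> G \<omega> y \<le> G \<omega> x"
    and nonpos: "\<And>\<omega> x. m \<le> x \<Longrightarrow> G \<omega> x \<le> 0"
    and \<psi>: "\<And>t. ((\<lambda>t. \<psi> (\<sigma> t \<omega>)) has_real_derivative G (\<sigma> t \<omega>) (\<psi> (\<sigma> t \<omega>))) (at t)"
    and lower: "\<And>t. m < \<psi> (\<sigma> t \<omega>)" and upper: "\<And>t. \<psi> (\<sigma> t \<omega>) \<le> B"
  shows "\<exists>L. \<psi> \<omega> \<le> L \<and> (\<forall>\<theta>. G \<theta> L = 0)"
proof -
  define z where "z t = \<psi> (\<sigma> t \<omega>)" for t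
  have z: "(z has_real_derivative G (\<sigma> t \<omega>) (z t)) (at t)" for t using \<psi> by (simp add: z_def[abs_def])
  have z_anti: "z t \<le> z s" if "s \<le> t" for s t
  proof (rule DERIV_nonpos_imp_nonincreasing[OF that])
    fix x
    have "G (\<sigma> x \<omega>) (z x) \<le> 0" using lower[of x] by (intro nonpos) (simp add: z_def)
    with z show "\<exists>y. (z has_real_derivative y) (at x) \<and> y \<le> 0" by blast
  qed
  define L where "L = (SUP t. z t)"
  have bdd: "bdd_above (range z)" using upper by (auto simp: z_def intro!: bdd_aboveI)
  have z_le: "z t \<le> L" for t unfolding L_def by (rule cSUP_upper[OF _ bdd]) simp
  have "m < L" using lower[of 0] z_le[of 0] by (simp add: z_def)
  have zero: "G \<theta> (L - e) = 0" if e: "0 < e" "e \<le> L - m" for \<theta> e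
  proof -
    obtain T where T: "L - e < z T"
      using less_cSUP_iff[OF _ bdd, of "L - e"] e(1) unfolding L_def by auto
    have cont: "continuous_on UNIV (\<lambda>\<omega>. - G \<omega> (L - e))"
      using continuous_on_compose2[OF G, of UNIV "\<lambda>\<omega>. (\<omega>, L - e)"]
      by (simp add: continuous_on_Pair continuous_on_minus)
    have "- G \<theta> (L - e) = 0"
    proof (rule nonneg_eq_zero_of_bounded_integral[OF cont])
      show "- G \<omega> (L - e) \<ge> 0" for \<omega> using nonpos[of "L - e" \<omega>] e by simp
      fix t :: real assume t: "t \<le> 0"
      let ?I = "\<lambda>t. integral_along (\<lambda>\<omega>. - G \<omega> (L - e)) t (\<sigma> T \<omega>)"
      \<comment> \<open>\<open>z' \<le> G (L - e)\<close> before time \<open>T\<close>, so the sum is nonincreasing there.\<close>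
      have "?I 0 + z (0 + T) \<le> ?I t + z (t + T)"
      proof (rule DERIV_nonpos_imp_nonincreasing[OF t], intro exI conjI)
        fix x :: real assume "x \<le> 0"
        have "((\<lambda>t. z (t + T)) has_real_derivative G (\<sigma> (x + T) \<omega>) (z (x + T))) (at x)"
          using z[of "x + T"] by (simp add: DERIV_shift)
        then show "((\<lambda>t. ?I t + z (t + T)) has_real_derivative
            - G (\<sigma> x (\<sigma> T \<omega>)) (L - e) + G (\<sigma> (x + T) \<omega>) (z (x + T))) (at x)"
          by (intro DERIV_add integral_along_deriv[OF cont])
        show "- G (\<sigma> x (\<sigma> T \<omega>)) (L - e) + G (\<sigma> (x + T) \<omega>) (z (x + T)) \<le> 0"
          using anti[of "L - e" "z (x + T)"] z_anti[of "x + T" T] T \<open>x \<le> 0\<close> by (simp add: flow_add)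
      qed
      then show "- ?I t \<le> L - z T" using z_le[of "t + T"] by simp
    qed
    then show ?thesis by simp
  qed
  show ?thesis
  proof (intro exI conjI allI)
    show "\<psi> \<omega> \<le> L" using z_le[of 0] by (simp add: z_def)
    fix \<theta>
    have "(\<lambda>n. G \<theta> (L - (L - m) / real (Suc n))) \<longlonglongrightarrow> G \<theta> (L - 0)"
    proof (rule isCont_tendsto_compose[of _ "G \<theta>"])
      have "continuous_on UNIV (G \<theta>)"
        using continuous_on_compose2[OF G, of UNIV "\<lambda>x. (\<theta>, x)"] by (simp add: continuous_on_Pair)
      then show "isCont (G \<theta>) (L - 0)" by (simp add: continuous_on_eq_continuous_at)
      show "(\<lambda>n. L - (L - m) / real (Suc n)) \<longlonglongrightarrow> L - 0"
        by (intro tendsto_intros LIMSEQ_Suc[OF lim_const_over_n])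
    qed
    moreover have "G \<theta> (L - (L - m) / real (Suc n)) = 0" for n
      using \<open>m < L\<close> by (intro zero) (auto simp: divide_simps)
    ultimately show "G \<theta> L = 0" by (simp add: LIMSEQ_const_iff)
  qed
qed

end

locale dissipative_family = minimal_compact_flow \<sigma> for \<sigma> :: "real \<Rightarrow> 'w::metric_space \<Rightarrow> 'w" +
  fixes a b :: "'w \<Rightarrow> real" and g :: "'w \<Rightarrow> real \<Rightarrow> real" and r1 r2 :: real
  assumes a_cont: "continuous_on UNIV a" and b_cont: "continuous_on UNIV b"
    and admissible: "admissible_nonlinearity g r1 r2"
begin

abbreviation "f \<equiv> rhs a b g"

lemma g_deriv: "(g \<omega> has_real_derivative deriv (g \<omega>) x) (at x)"
  unfolding DERIV_deriv_iff_real_differentiable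
  using admissible unfolding admissible_nonlinearity_def by blast

lemma g_cont: "continuous_on UNIV (\<lambda>(\<omega>, x). g \<omega> x)"
  and g'_cont: "continuous_on UNIV (\<lambda>(\<omega>, x). deriv (g \<omega>) x)"
  and r1_le_r2: "r1 \<le> r2"
  using admissible unfolding admissible_nonlinearity_def by blast+

lemma g_eq_zero_iff: "g \<omega> x = 0 \<longleftrightarrow> r1 \<le> x \<and> x \<le> r2"
  and g_nonneg: "x \<le> r2 \<Longrightarrow> g \<omega> x \<ge> 0" and g_nonpos: "r1 \<le> x \<Longrightarrow> g \<omega> x \<le> 0"
proof -
  have "(r1 \<le> x \<and> x \<le> r2 \<longrightarrow> g \<omega> x = 0) \<and> (x < r1 \<longrightarrow> g \<omega> x > 0) \<and> (x > r2 \<longrightarrow> g \<omega> x < 0)"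
    using admissible unfolding admissible_nonlinearity_def by blast
  then show "g \<omega> x = 0 \<longleftrightarrow> r1 \<le> x \<and> x \<le> r2" "x \<le> r2 \<Longrightarrow> g \<omega> x \<ge> 0" "r1 \<le> x \<Longrightarrow> g \<omega> x \<le> 0"
    using r1_le_r2 by linarith+
qed

lemma deriv_g_eq_zero:
  assumes "r1 \<le> x" and "x \<le> r2"
  shows "deriv (g \<omega>) x = 0"
proof (cases "r1 = r2")
  case True
  then have "x = r1" using assms by simp
  then show ?thesis using admissible True unfolding admissible_nonlinearity_def by blast
next
  case False
  then have less: "r1 < r2" using r1_le_r2 by simp
  have "(g \<omega> has_vector_derivative deriv (g \<omega>) x) (at x within cbox r1 r2)"
    by (rule has_vector_derivative_at_within)
      (rule g_deriv[unfolded has_real_derivative_iff_has_vector_derivative])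
  moreover have "(g \<omega> has_vector_derivative 0) (at x within cbox r1 r2)"
    by (rule has_vector_derivative_transform[of _ _ _ "\<lambda>_. 0"]) (use assms g_eq_zero_iff in auto)
  ultimately show ?thesis
    using vector_derivative_unique_within_closed_interval[OF less, of x] assms by auto
qed

lemma deriv_g_neg: "x \<notin> {r1..r2} \<Longrightarrow> deriv (g \<omega>) x < 0"
  using admissible unfolding admissible_nonlinearity_def by blast

lemma g_antimono:
  assumes "x \<le> y" shows "g \<omega> y \<le> g \<omega> x"
proof (rule DERIV_nonpos_imp_nonincreasing[OF assms])
  fix t
  have "deriv (g \<omega>) t \<le> 0"
    using deriv_g_neg[of t \<omega>] deriv_g_eq_zero[of t \<omega>] by (cases "t \<in> {r1..r2}") auto
  with g_deriv show "\<exists>d. (g \<omega> has_real_derivative d) (at t) \<and> d \<le> 0" by blast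
qed

text \<open>Outside \<open>[r1, r2]\<close> the function \<open>g\<close> is strictly decreasing and changes sign only across that
  interval, so two different points with the same value are both zeros.\<close>

lemma g_eq_imp_between:
  assumes "x < y" and eq: "g \<omega> x = g \<omega> y"
  shows "r1 \<le> x" and "y \<le> r2"
proof -
  have dec: "g \<omega> y < g \<omega> x" if "\<And>t. x \<le> t \<Longrightarrow> t \<le> y \<Longrightarrow> t \<notin> {r1..r2}"
    by (rule DERIV_neg_imp_decreasing[OF \<open>x < y\<close>], rule exI, rule conjI, rule g_deriv)
      (intro deriv_g_neg that)
  show "r1 \<le> x"
  proof (rule ccontr)
    assume x: "\<not> r1 \<le> x"
    then have "g \<omega> x \<noteq> 0" "g \<omega> x \<ge> 0"
      using r1_le_r2 by (simp_all add: g_eq_zero_iff g_nonneg)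
    then have "\<not> r1 \<le> y" using eq g_nonpos[of y \<omega>] by linarith
    then show False using dec eq by simp
  qed
  show "y \<le> r2"
  proof (rule ccontr)
    assume y: "\<not> y \<le> r2"
    then have "g \<omega> y \<noteq> 0" "g \<omega> y \<le> 0"
      using r1_le_r2 by (simp_all add: g_eq_zero_iff g_nonpos)
    then have "\<not> x \<le> r2" using eq g_nonneg[of x \<omega>] by linarith
    then show False using dec eq by simp
  qed
qed

sublocale smooth_family \<sigma> "rhs a b g" "\<lambda>\<omega> x. a \<omega> + deriv (g \<omega>) x"
proof
  have proj: "continuous_on UNIV (\<lambda>p::'w \<times> real. a (fst p))" "continuous_on UNIV (\<lambda>p::'w \<times> real. b (fst p))"
    by (auto intro!: continuous_on_compose2[OF a_cont] continuous_on_compose2[OF b_cont] continuous_intros)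
  show "(f \<omega> has_real_derivative a \<omega> + deriv (g \<omega>) x) (at x)" for \<omega> x
    unfolding rhs_def[abs_def] by (auto intro!: derivative_eq_intros g_deriv)
  show "continuous_on UNIV (\<lambda>(\<omega>, x). f \<omega> x)"
    using g_cont proj unfolding rhs_def by (auto simp: case_prod_unfold intro!: continuous_intros)
  show "continuous_on UNIV (\<lambda>(\<omega>, x). a \<omega> + deriv (g \<omega>) x)"
    using g'_cont proj by (auto simp: case_prod_unfold intro!: continuous_intros)
qed

end

section \<open>The attractor and its bounding equilibria\<close>

locale dissipative_attractor = dissipative_family +
  fixes A :: "('a \<times> real) set" and \<alpha> \<beta> :: "'a \<Rightarrow> real"
  assumes attractor: "global_attractor (skew_dom \<sigma> (rhs a b g)) (skew_flow \<sigma> (rhs a b g)) A"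
    and \<alpha>_le_\<beta>: "\<alpha> \<omega> \<le> \<beta> \<omega>"
    and A_eq: "A = (\<Union>\<omega>. {\<omega>} \<times> {\<alpha> \<omega>..\<beta> \<omega>})"
begin

lemma in_A_iff: "(\<omega>, x) \<in> A \<longleftrightarrow> \<alpha> \<omega> \<le> x \<and> x \<le> \<beta> \<omega>"
  by (auto simp: A_eq)

lemma \<alpha>_in_A: "(\<omega>, \<alpha> \<omega>) \<in> A" and \<beta>_in_A: "(\<omega>, \<beta> \<omega>) \<in> A"
  using \<alpha>_le_\<beta> by (auto simp: in_A_iff)

lemma compact_A: "compact A"
  using attractor by (simp add: global_attractor_def)

lemma sol_dom_A: "(\<omega>, x) \<in> A \<Longrightarrow> sol_dom \<sigma> f \<omega> x = UNIV"
  using attractor by (auto simp: global_attractor_def flow_invariant_def skew_dom_def)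

lemma entire_A: "(\<omega>, x) \<in> A \<Longrightarrow> entire_solution \<omega> (\<lambda>t. sol \<sigma> f t \<omega> x)"
  and sol_zero_A: "(\<omega>, x) \<in> A \<Longrightarrow> sol \<sigma> f 0 \<omega> x = x"
  by (rule entire_solution_sol; erule sol_dom_A)+

lemma skew_flow_A: "skew_flow \<sigma> f t ` A = A"
  using attractor by (auto simp: global_attractor_def flow_invariant_def)

lemma sol_in_A: "(\<omega>, x) \<in> A \<Longrightarrow> (\<sigma> t \<omega>, sol \<sigma> f t \<omega> x) \<in> A"
  using skew_flow_A[of t] by (auto simp: skew_flow_def)

lemma bounded_A:
  obtains R where "\<And>\<omega> x. (\<omega>, x) \<in> A \<Longrightarrow> \<bar>x\<bar> \<le> R"
proof -
  have "bounded (snd ` A)"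
    by (intro compact_imp_bounded compact_continuous_image compact_A continuous_intros)
  then obtain R where "\<forall>p\<in>A. \<bar>snd p\<bar> \<le> R" by (auto simp: bounded_iff)
  then show thesis by (intro that[of R]) auto
qed

lemma sol_mono_A:
  assumes "(\<omega>, x) \<in> A" and "(\<omega>, y) \<in> A" and "x \<le> y"
  shows "sol \<sigma> f t \<omega> x \<le> sol \<sigma> f t \<omega> y"
proof (cases "x = y")
  case False
  then show ?thesis
    using entire_solution_less[OF entire_A[OF assms(1)] entire_A[OF assms(2)], of 0 t] assms
    by (simp add: sol_zero_A)
qed simp

lemma preimage_in_A:
  assumes "(\<sigma> t \<omega>, y) \<in> A"
  obtains x where "(\<omega>, x) \<in> A" and "y = sol \<sigma> f t \<omega> x"
proof -
  have "(\<sigma> t \<omega>, y) \<in> skew_flow \<sigma> f t ` A" using assms skew_flow_A by simp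
  then obtain \<theta> x where x: "(\<theta>, x) \<in> A" "\<sigma> t \<omega> = \<sigma> t \<theta>" "y = sol \<sigma> f t \<theta> x"
    by (auto simp: skew_flow_def)
  have "\<theta> = \<sigma> (- t) (\<sigma> t \<theta>)" by simp
  also have "\<dots> = \<omega>" unfolding x(2)[symmetric] by simp
  finally show thesis using x(1,3) by (intro that[of x]) auto
qed

text \<open>A monotone map of one interval onto another preserves the endpoints.\<close>

lemma sol_\<alpha>: "sol \<sigma> f t \<omega> (\<alpha> \<omega>) = \<alpha> (\<sigma> t \<omega>)"
proof (rule antisym)
  show "\<alpha> (\<sigma> t \<omega>) \<le> sol \<sigma> f t \<omega> (\<alpha> \<omega>)" using sol_in_A[OF \<alpha>_in_A] by (simp add: in_A_iff)
  obtain x where x: "(\<omega>, x) \<in> A" "\<alpha> (\<sigma> t \<omega>) = sol \<sigma> f t \<omega> x" by (rule preimage_in_A[OF \<alpha>_in_A])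
  then show "sol \<sigma> f t \<omega> (\<alpha> \<omega>) \<le> \<alpha> (\<sigma> t \<omega>)"
    using sol_mono_A[OF \<alpha>_in_A x(1), of t] by (simp add: in_A_iff)
qed

lemma sol_\<beta>: "sol \<sigma> f t \<omega> (\<beta> \<omega>) = \<beta> (\<sigma> t \<omega>)"
proof (rule antisym)
  show "sol \<sigma> f t \<omega> (\<beta> \<omega>) \<le> \<beta> (\<sigma> t \<omega>)" using sol_in_A[OF \<beta>_in_A] by (simp add: in_A_iff)
  obtain x where x: "(\<omega>, x) \<in> A" "\<beta> (\<sigma> t \<omega>) = sol \<sigma> f t \<omega> x" by (rule preimage_in_A[OF \<beta>_in_A])
  then show "\<beta> (\<sigma> t \<omega>) \<le> sol \<sigma> f t \<omega> (\<beta> \<omega>)"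
    using sol_mono_A[OF x(1) \<beta>_in_A, of t] by (simp add: in_A_iff)
qed

lemma entire_\<alpha>: "entire_solution \<omega> (\<lambda>t. \<alpha> (\<sigma> t \<omega>))"
  and entire_\<beta>: "entire_solution \<omega> (\<lambda>t. \<beta> (\<sigma> t \<omega>))"
  using entire_A[OF \<alpha>_in_A, of \<omega>] entire_A[OF \<beta>_in_A, of \<omega>] by (simp_all add: sol_\<alpha> sol_\<beta>)

text \<open>An invariant set is its own image at all times, so its constant distance to the attractor has limit
  zero.\<close>

lemma compact_invariant_subset_A:
  assumes "compact M" and inv: "flow_invariant (skew_dom \<sigma> f) (skew_flow \<sigma> f) M"
  shows "M \<subseteq> A"
proof
  fix p assume p: "p \<in> M"
  have "((\<lambda>t. hausdorff_semidist (skew_flow \<sigma> f t ` M) A) \<longlongrightarrow> 0) at_top"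
    using attractor compact_imp_bounded[OF assms(1)] unfolding global_attractor_def by blast
  then have "((\<lambda>t::real. hausdorff_semidist M A) \<longlongrightarrow> 0) at_top"
    using inv by (simp add: flow_invariant_def)
  then have "hausdorff_semidist M A = 0" by (simp add: tendsto_const_iff)
  then have "(INF q\<in>A. ennreal (dist p q)) \<le> 0"
    unfolding hausdorff_semidist_def using SUP_upper[OF p, of "\<lambda>p. INF q\<in>A. ennreal (dist p q)"] by simp
  then have zero: "(INF q\<in>A. ennreal (dist p q)) = 0" by simp
  have "p \<in> closure A"
    unfolding closure_approachable
  proof (intro allI impI)
    fix e :: real assume "e > 0"
    then have "(INF q\<in>A. ennreal (dist p q)) < ennreal e" using zero by simp
    then obtain q where "q \<in> A" "ennreal (dist p q) < ennreal e" unfolding INF_less_iff by blast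
    then show "\<exists>q\<in>A. dist q p < e" using \<open>e > 0\<close> by (auto simp: ennreal_less_iff dist_commute)
  qed
  then show "p \<in> A" using compact_imp_closed[OF compact_A] by simp
qed

lemma graph_flow_invariant:
  assumes "\<And>\<omega>. entire_solution \<omega> (\<lambda>t. \<psi> (\<sigma> t \<omega>))"
  shows "flow_invariant (skew_dom \<sigma> f) (skew_flow \<sigma> f) (graph \<psi>)"
proof -
  have dom: "sol_dom \<sigma> f \<omega> (\<psi> \<omega>) = UNIV" and sol: "sol \<sigma> f t \<omega> (\<psi> \<omega>) = \<psi> (\<sigma> t \<omega>)" for \<omega> t
    using entire_solution_imp_sol[OF assms] by simp_all
  have "skew_flow \<sigma> f t ` graph \<psi> = graph \<psi>" for t
  proof -
    have "range (\<sigma> t) = UNIV" by (rule surjI) (rule flow_inverse(2))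
    then have "graph \<psi> = (\<lambda>\<omega>. (\<omega>, \<psi> \<omega>)) ` range (\<sigma> t)" by (simp add: graph_def)
    also have "\<dots> = skew_flow \<sigma> f t ` graph \<psi>"
      by (simp add: graph_def skew_flow_def image_image sol)
    finally show ?thesis ..
  qed
  then show ?thesis by (auto simp: flow_invariant_def graph_def skew_dom_def dom)
qed

lemma continuous_equilibrium_in_A:
  assumes "continuous_on UNIV \<psi>" and "\<And>\<omega>. entire_solution \<omega> (\<lambda>t. \<psi> (\<sigma> t \<omega>))"
  shows "\<alpha> \<omega> \<le> \<psi> \<omega>" and "\<psi> \<omega> \<le> \<beta> \<omega>"
  using compact_invariant_subset_A[OF compact_graph graph_flow_invariant, OF assms]
  by (auto simp: graph_def in_A_iff image_subset_iff)

text \<open>The width of the attractor is bounded below near \<open>\<omega>0\<close>. Any other point reaches that neighbourhood in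
  a bounded time, during which the width changes at most by a fixed factor.\<close>

lemma uniform_gap:
  assumes cont: "isCont \<alpha> \<omega>0" "isCont \<beta> \<omega>0" and less: "\<alpha> \<omega>0 < \<beta> \<omega>0"
  obtains d where "d > 0" and "\<And>\<omega>. d \<le> \<beta> \<omega> - \<alpha> \<omega>"
proof -
  define c where "c = (\<beta> \<omega>0 - \<alpha> \<omega>0) / 2"
  have c: "c > 0" "c < \<beta> \<omega>0 - \<alpha> \<omega>0" using less by (auto simp: c_def)
  have "((\<lambda>\<omega>. \<beta> \<omega> - \<alpha> \<omega>) \<longlongrightarrow> \<beta> \<omega>0 - \<alpha> \<omega>0) (at \<omega>0)"
    using cont unfolding isCont_def by (intro tendsto_diff)
  from order_tendstoD(1)[OF this c(2)] have "\<forall>\<^sub>F \<omega> in nhds \<omega>0. c < \<beta> \<omega> - \<alpha> \<omega>"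
    using c(2) by (simp add: eventually_nhds_conv_at)
  then obtain U where U: "open U" "\<omega>0 \<in> U" "\<And>\<omega>. \<omega> \<in> U \<Longrightarrow> c < \<beta> \<omega> - \<alpha> \<omega>"
    unfolding eventually_nhds by blast
  obtain T where T: "T \<ge> 0" "\<And>\<omega>. \<exists>s. \<bar>s\<bar> \<le> T \<and> \<sigma> s \<omega> \<in> U"
    using uniform_return[OF U(1,2)] by blast
  obtain R where R: "\<And>\<omega> x. (\<omega>, x) \<in> A \<Longrightarrow> \<bar>x\<bar> \<le> R" using bounded_A by blast
  have R\<alpha>: "\<bar>\<alpha> \<omega>\<bar> \<le> R" and R\<beta>: "\<bar>\<beta> \<omega>\<bar> \<le> R" for \<omega>
    by (rule R[OF \<alpha>_in_A], rule R[OF \<beta>_in_A])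
  obtain L where L: "L \<ge> 0" "\<And>\<omega> x y. \<bar>x\<bar> \<le> R \<Longrightarrow> \<bar>y\<bar> \<le> R \<Longrightarrow> \<bar>f \<omega> x - f \<omega> y\<bar> \<le> L * \<bar>x - y\<bar>"
    using lipschitz_on_bounded by blast
  define E where "E = exp ((2 * L + 1) * T / 2)"
  have "E > 0" by (simp add: E_def)
  show thesis
  proof (rule that)
    show "c / E > 0" using c \<open>E > 0\<close> by simp
    fix \<omega>
    obtain s where s: "\<bar>s\<bar> \<le> T" "\<sigma> s \<omega> \<in> U" using T by blast
    have "(\<beta> (\<sigma> s \<omega>) - \<alpha> (\<sigma> s \<omega>))\<^sup>2 + 0\<^sup>2 \<le>
        ((\<beta> (\<sigma> 0 \<omega>) - \<alpha> (\<sigma> 0 \<omega>))\<^sup>2 + 0\<^sup>2) * exp ((2 * L + 1) * \<bar>s - 0\<bar>)"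
    proof (rule compare_solutions[where R = R and u = "\<lambda>t. \<beta> (\<sigma> t \<omega>)" and v = "\<lambda>t. \<alpha> (\<sigma> t \<omega>)"
        and \<omega> = \<omega> and \<omega>' = \<omega> and s = 0 and t = s and L = L and e = 0])
      fix x
      show "((\<lambda>t. \<beta> (\<sigma> t \<omega>)) has_real_derivative f (\<sigma> x \<omega>) (\<beta> (\<sigma> x \<omega>))) (at x)"
        by (rule entire_solution_deriv[OF entire_\<beta>])
      show "((\<lambda>t. \<alpha> (\<sigma> t \<omega>)) has_real_derivative f (\<sigma> x \<omega>) (\<alpha> (\<sigma> x \<omega>))) (at x)"
        by (rule entire_solution_deriv[OF entire_\<alpha>])
      show "\<bar>\<beta> (\<sigma> x \<omega>)\<bar> \<le> R" "\<bar>\<alpha> (\<sigma> x \<omega>)\<bar> \<le> R" by (rule R\<beta> R\<alpha>)+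
      show "L \<ge> 0" by (rule L(1))
      show "\<bar>f \<theta> x - f \<theta> y\<bar> \<le> L * \<bar>x - y\<bar>" if "\<bar>x\<bar> \<le> R" "\<bar>y\<bar> \<le> R" for \<theta> x y
        using that by (rule L(2))
    qed simp
    then have "(\<beta> (\<sigma> s \<omega>) - \<alpha> (\<sigma> s \<omega>))\<^sup>2 \<le> (\<beta> \<omega> - \<alpha> \<omega>)\<^sup>2 * exp ((2 * L + 1) * \<bar>s - 0\<bar>)"
      by (simp only: flow_zero power_zero_numeral add_0_right)
    also have "exp ((2 * L + 1) * \<bar>s - 0\<bar>) \<le> E\<^sup>2"
    proof -
      have "(2 * L + 1) * \<bar>s - 0\<bar> \<le> 2 * ((2 * L + 1) * T / 2)"
        using mult_left_mono[OF s(1), of "2 * L + 1"] L(1) by simp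
      then show ?thesis unfolding E_def exp_double[symmetric] by (rule exp_mono)
    qed
    also have "(\<beta> \<omega> - \<alpha> \<omega>)\<^sup>2 * E\<^sup>2 = ((\<beta> \<omega> - \<alpha> \<omega>) * E)\<^sup>2"
      by (rule power_mult_distrib[symmetric])
    finally have "(\<beta> (\<sigma> s \<omega>) - \<alpha> (\<sigma> s \<omega>))\<^sup>2 \<le> ((\<beta> \<omega> - \<alpha> \<omega>) * E)\<^sup>2"
      by (simp add: mult_left_mono)
    then have "\<beta> (\<sigma> s \<omega>) - \<alpha> (\<sigma> s \<omega>) \<le> (\<beta> \<omega> - \<alpha> \<omega>) * E"
      by (rule power2_le_imp_le) (use \<alpha>_le_\<beta>[of \<omega>] \<open>E > 0\<close> in \<open>intro mult_nonneg_nonneg; linarith\<close>)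
    then have "c \<le> (\<beta> \<omega> - \<alpha> \<omega>) * E" using U(3)[OF s(2)] by linarith
    then show "c / E \<le> \<beta> \<omega> - \<alpha> \<omega>" using \<open>E > 0\<close> by (simp only: pos_divide_le_eq)
  qed
qed

end

section \<open>Two linear orbits, and the affine family that they generate\<close>

context dissipative_attractor
begin

text \<open>The quantity in the bound is the increment over \<open>[0, t]\<close> of \<open>J t = \<integral>\<^sub>0\<^sup>t a - ln y\<close>, where \<open>y = \<beta> - \<alpha>\<close>.
  If \<open>J\<close> grew by more than \<open>1 / N\<close> on each window of length \<open>2 N\<close>, it would grow linearly, which the
  spectrum forbids. The point \<open>\<omega>\<close> is the midpoint of a window.\<close>

lemma flat_windows:
  assumes sup: "Sup (ereal ` sacker_sell_spectrum \<sigma> a) = 0"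
    and gap: "d > 0" "\<And>\<omega>. d \<le> \<beta> \<omega> - \<alpha> \<omega>" and "N > 0"
  obtains \<omega> where "\<And>t. \<bar>t\<bar> \<le> N \<Longrightarrow>
    \<bar>integral_along a t \<omega> - ln (\<beta> (\<sigma> t \<omega>) - \<alpha> (\<sigma> t \<omega>)) + ln (\<beta> \<omega> - \<alpha> \<omega>)\<bar> \<le> 1 / N"
proof -
  fix \<omega> :: 'a
  define y where "y \<theta> = \<beta> \<theta> - \<alpha> \<theta>" for \<theta>
  define J where "J t = integral_along a t \<omega> - ln (y (\<sigma> t \<omega>))" for t
  have y_pos: "y \<theta> > 0" for \<theta> using gap(1) gap(2)[of \<theta>] by (simp add: y_def)
  have J_mono: "J s \<le> J t" if "s \<le> t" for s t
  proof (rule DERIV_nonneg_imp_nondecreasing[OF that], intro exI conjI)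
    fix x
    have "((\<lambda>t. y (\<sigma> t \<omega>)) has_real_derivative f (\<sigma> x \<omega>) (\<beta> (\<sigma> x \<omega>)) - f (\<sigma> x \<omega>) (\<alpha> (\<sigma> x \<omega>))) (at x)"
      unfolding y_def using entire_\<alpha> entire_\<beta> by (intro DERIV_diff entire_solution_deriv)
    then show "(J has_real_derivative a (\<sigma> x \<omega>) - (f (\<sigma> x \<omega>) (\<beta> (\<sigma> x \<omega>)) - f (\<sigma> x \<omega>) (\<alpha> (\<sigma> x \<omega>))) / y (\<sigma> x \<omega>)) (at x)"
      unfolding J_def by (auto intro!: derivative_eq_intros integral_along_deriv[OF a_cont] simp: y_pos)
    have "f (\<sigma> x \<omega>) (\<beta> (\<sigma> x \<omega>)) - f (\<sigma> x \<omega>) (\<alpha> (\<sigma> x \<omega>)) \<le> a (\<sigma> x \<omega>) * y (\<sigma> x \<omega>)"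
      using g_antimono[OF \<alpha>_le_\<beta>[of "\<sigma> x \<omega>"], of "\<sigma> x \<omega>"] by (simp add: rhs_def y_def algebra_simps)
    then show "0 \<le> a (\<sigma> x \<omega>) - (f (\<sigma> x \<omega>) (\<beta> (\<sigma> x \<omega>)) - f (\<sigma> x \<omega>) (\<alpha> (\<sigma> x \<omega>))) / y (\<sigma> x \<omega>)"
      using y_pos by (simp add: divide_le_eq)
  qed
  obtain C where C: "\<And>\<omega> t. t \<ge> 0 \<Longrightarrow> integral_along a t \<omega> \<le> C + (1 / (4 * N\<^sup>2)) * t"
    using spectrum_growth[OF a_cont sup, of "1 / (4 * N\<^sup>2)"] \<open>N > 0\<close> by auto
  \<comment> \<open>After \<open>k\<close> windows the assumed growth \<open>k / N\<close> exceeds \<open>2 N k / (4 N\<^sup>2) = k / (2 N)\<close>.\<close>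
  have "\<exists>s. J (s + 2 * N) - J s \<le> 1 / N"
  proof (rule ccontr)
    assume "\<not> ?thesis"
    then have step: "J (s + 2 * N) > J s + 1 / N" for s by (auto simp: not_le algebra_simps)
    have "J 0 + real k / N \<le> J (2 * N * real k)" for k
    proof (induction k)
      case (Suc k)
      have "J 0 + real (Suc k) / N = J 0 + real k / N + 1 / N" by (simp add: add_divide_distrib)
      also have "\<dots> \<le> J (2 * N * real k + 2 * N)" using Suc step[of "2 * N * real k"] by simp
      finally show ?case by (simp add: algebra_simps)
    qed simp
    moreover have "J (2 * N * real k) \<le> C + real k / (2 * N) - ln d" for k
    proof -
      have "ln d \<le> ln (y (\<sigma> t \<omega>))" for t using gap y_pos by (simp add: y_def)
      then have "J (2 * N * real k) \<le> C + (1 / (4 * N\<^sup>2)) * (2 * N * real k) - ln d"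
        unfolding J_def using \<open>N > 0\<close> by (intro diff_mono C) auto
      also have "(1 / (4 * N\<^sup>2)) * (2 * N * real k) = real k / (2 * N)"
        using \<open>N > 0\<close> by (simp add: power2_eq_square)
      finally show ?thesis .
    qed
    ultimately have "J 0 + real k / N \<le> C + real k / (2 * N) - ln d" for k using order_trans by blast
    moreover have "real k / N = 2 * (real k / (2 * N))" for k by simp
    ultimately have *: "real k / (2 * N) \<le> C - ln d - J 0" for k by (smt (verit))
    obtain k :: nat where "(C - ln d - J 0) * (2 * N) < real k" using reals_Archimedean2 by blast
    then have "C - ln d - J 0 < real k / (2 * N)" using \<open>N > 0\<close> by (simp add: field_simps)
    then show False using *[of k] by simp
  qed
  then obtain s where s: "J (s + 2 * N) - J s \<le> 1 / N" by blast
  show thesis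
  proof (rule that)
    fix t assume t: "\<bar>t\<bar> \<le> N"
    let ?\<theta> = "\<sigma> (s + N) \<omega>"
    have "integral_along a t ?\<theta> - ln (\<beta> (\<sigma> t ?\<theta>) - \<alpha> (\<sigma> t ?\<theta>)) + ln (\<beta> ?\<theta> - \<alpha> ?\<theta>)
        = J (t + (s + N)) - J (s + N)"
      using integral_along_add[OF a_cont, of t "s + N" \<omega>] by (simp add: J_def y_def flow_add)
    moreover have "J s \<le> J (t + (s + N))" "J (t + (s + N)) \<le> J (s + 2 * N)"
      "J s \<le> J (s + N)" "J (s + N) \<le> J (s + 2 * N)"
      using t by (intro J_mono; auto)+
    ultimately show "\<bar>integral_along a t ?\<theta> - ln (\<beta> (\<sigma> t ?\<theta>) - \<alpha> (\<sigma> t ?\<theta>)) + ln (\<beta> ?\<theta> - \<alpha> ?\<theta>)\<bar> \<le> 1 / N"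
      using s by linarith
  qed
qed

text \<open>Limit of the flat windows. The limit is taken in \<open>A \<times> A\<close>, over the base points together with the
  values of \<open>\<alpha>\<close> and \<open>\<beta>\<close> there, since \<open>\<alpha>\<close> and \<open>\<beta>\<close> are not yet known to be continuous: \<open>u\<close> and \<open>v\<close>
  are solutions in the attractor, but possibly not its bounds.\<close>

lemma linear_pair:
  assumes sup: "Sup (ereal ` sacker_sell_spectrum \<sigma> a) = 0"
    and gap: "d > 0" "\<And>\<omega>. d \<le> \<beta> \<omega> - \<alpha> \<omega>"
  obtains \<omega> u v R where "entire_solution \<omega> u" "entire_solution \<omega> v"
    "\<And>t. d \<le> v t - u t" "\<And>t. \<bar>u t\<bar> \<le> R" "\<And>t. \<bar>v t\<bar> \<le> R"
    "\<And>t. integral_along a t \<omega> = ln (v t - u t) - ln (v 0 - u 0)"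
    "\<And>t. r1 \<le> u t" "\<And>t. v t \<le> r2"
proof -
  have "\<exists>\<omega>. \<forall>t. \<bar>t\<bar> \<le> real (Suc n) \<longrightarrow>
    \<bar>integral_along a t \<omega> - ln (\<beta> (\<sigma> t \<omega>) - \<alpha> (\<sigma> t \<omega>)) + ln (\<beta> \<omega> - \<alpha> \<omega>)\<bar> \<le> 1 / real (Suc n)" for n
    using flat_windows[OF sup gap, of "real (Suc n)"] by auto
  then obtain W where W: "\<And>n t. \<bar>t\<bar> \<le> real (Suc n) \<Longrightarrow>
    \<bar>integral_along a t (W n) - ln (\<beta> (\<sigma> t (W n)) - \<alpha> (\<sigma> t (W n))) + ln (\<beta> (W n) - \<alpha> (W n))\<bar> \<le> 1 / real (Suc n)"
    by metis
  obtain R where R: "\<And>\<omega> x. (\<omega>, x) \<in> A \<Longrightarrow> \<bar>x\<bar> \<le> R" using bounded_A by blast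
  have "compact (A \<times> A)" by (intro compact_Times compact_A)
  moreover have "\<forall>n. ((W n, \<alpha> (W n)), (W n, \<beta> (W n))) \<in> A \<times> A" by (simp add: \<alpha>_in_A \<beta>_in_A)
  ultimately obtain l r where lr: "l \<in> A \<times> A" "strict_mono (r :: nat \<Rightarrow> nat)"
    "((\<lambda>n. ((W n, \<alpha> (W n)), (W n, \<beta> (W n)))) \<circ> r) \<longlonglongrightarrow> l"
    by (rule compact_imp_seq_compact[THEN seq_compactE])
  obtain \<omega> x \<omega>' y where l: "l = ((\<omega>, x), (\<omega>', y))" by (metis surj_pair)
  define \<theta> where "\<theta> n = W (r n)" for n
  have lims: "\<theta> \<longlonglongrightarrow> \<omega>" "(\<lambda>n. \<alpha> (\<theta> n)) \<longlonglongrightarrow> x" "\<theta> \<longlonglongrightarrow> \<omega>'" "(\<lambda>n. \<beta> (\<theta> n)) \<longlonglongrightarrow> y"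
    using tendsto_fst[OF tendsto_fst[OF lr(3)]] tendsto_snd[OF tendsto_fst[OF lr(3)]]
      tendsto_fst[OF tendsto_snd[OF lr(3)]] tendsto_snd[OF tendsto_snd[OF lr(3)]]
    by (simp_all add: l \<theta>_def[abs_def] o_def)
  have "\<omega>' = \<omega>" using LIMSEQ_unique[OF lims(3,1)] .
  then have A: "(\<omega>, x) \<in> A" "(\<omega>, y) \<in> A" using lr(1) by (simp_all add: l)
  define u where "u t = sol \<sigma> f t \<omega> x" for t
  define v where "v t = sol \<sigma> f t \<omega> y" for t
  have u: "entire_solution \<omega> u" "u 0 = x" and v: "entire_solution \<omega> v" "v 0 = y"
    unfolding u_def[abs_def] v_def[abs_def] using entire_A sol_zero_A A by simp_all
  have uR: "\<bar>u t\<bar> \<le> R" and vR: "\<bar>v t\<bar> \<le> R" for t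
    unfolding u_def v_def using R sol_in_A A by blast+
  have ut: "(\<lambda>n. \<alpha> (\<sigma> t (\<theta> n))) \<longlonglongrightarrow> u t" for t
    by (rule continuous_dependence[OF entire_\<alpha> R[OF \<alpha>_in_A] u(1) uR lims(1)]) (simp add: lims u)
  have vt: "(\<lambda>n. \<beta> (\<sigma> t (\<theta> n))) \<longlonglongrightarrow> v t" for t
    by (rule continuous_dependence[OF entire_\<beta> R[OF \<beta>_in_A] v(1) vR lims(1)]) (simp add: lims v)
  have yt: "(\<lambda>n. \<beta> (\<sigma> t (\<theta> n)) - \<alpha> (\<sigma> t (\<theta> n))) \<longlonglongrightarrow> v t - u t" for t
    by (intro tendsto_diff ut vt)
  have gap': "d \<le> v t - u t" for t
    by (rule LIMSEQ_le_const[OF yt]) (use gap(2) in blast)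
  have ln_lim: "(\<lambda>n. ln (\<beta> (\<sigma> t (\<theta> n)) - \<alpha> (\<sigma> t (\<theta> n)))) \<longlonglongrightarrow> ln (v t - u t)" for t
    using gap'[of t] gap(1) by (intro tendsto_ln yt) auto
  have integral: "integral_along a t \<omega> = ln (v t - u t) - ln (v 0 - u 0)" for t
  proof -
    have "(\<lambda>n. integral_along a t (\<theta> n)) \<longlonglongrightarrow> integral_along a t \<omega>"
      using continuous_on_integral_along[OF a_cont, of t]
      by (intro isCont_tendsto_compose[OF _ lims(1)]) (simp add: continuous_on_eq_continuous_at)
    then have "(\<lambda>n. integral_along a t (\<theta> n) - ln (\<beta> (\<sigma> t (\<theta> n)) - \<alpha> (\<sigma> t (\<theta> n)))
        + ln (\<beta> (\<sigma> 0 (\<theta> n)) - \<alpha> (\<sigma> 0 (\<theta> n))))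
      \<longlonglongrightarrow> integral_along a t \<omega> - ln (v t - u t) + ln (v 0 - u 0)"
      by (intro tendsto_intros ln_lim)
    moreover have "(\<lambda>n. integral_along a t (\<theta> n) - ln (\<beta> (\<sigma> t (\<theta> n)) - \<alpha> (\<sigma> t (\<theta> n)))
        + ln (\<beta> (\<sigma> 0 (\<theta> n)) - \<alpha> (\<sigma> 0 (\<theta> n)))) \<longlonglongrightarrow> 0"
    proof (rule Lim_null_comparison)
      obtain m :: nat where m: "\<bar>t\<bar> \<le> real m" using real_arch_simple by blast
      show "\<forall>\<^sub>F n in sequentially. norm (integral_along a t (\<theta> n) - ln (\<beta> (\<sigma> t (\<theta> n)) - \<alpha> (\<sigma> t (\<theta> n)))
        + ln (\<beta> (\<sigma> 0 (\<theta> n)) - \<alpha> (\<sigma> 0 (\<theta> n)))) \<le> 1 / real (Suc n)"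
        using eventually_ge_at_top[of m]
      proof eventually_elim
        case (elim n)
        have n: "n \<le> r n" by (rule seq_suble[OF lr(2)])
        have "\<bar>t\<bar> \<le> real (Suc (r n))" using m elim n by linarith
        from W[OF this] have "norm (integral_along a t (\<theta> n) - ln (\<beta> (\<sigma> t (\<theta> n)) - \<alpha> (\<sigma> t (\<theta> n)))
          + ln (\<beta> (\<sigma> 0 (\<theta> n)) - \<alpha> (\<sigma> 0 (\<theta> n)))) \<le> 1 / real (Suc (r n))"
          by (simp add: \<theta>_def)
        also have "\<dots> \<le> 1 / real (Suc n)" using n by (intro divide_left_mono) auto
        finally show ?case .
      qed
      show "(\<lambda>n. 1 / real (Suc n)) \<longlonglongrightarrow> 0" by (rule LIMSEQ_Suc[OF lim_1_over_n])
    qed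
    ultimately have "integral_along a t \<omega> - ln (v t - u t) + ln (v 0 - u 0) = 0"
      by (rule LIMSEQ_unique)
    then show ?thesis by simp
  qed
  \<comment> \<open>Both sides of the integral identity are differentiated: the derivative of \<open>ln (v - u)\<close> is \<open>a\<close> plus
    the difference quotient of \<open>g\<close>.\<close>
  have eq: "g (\<sigma> t \<omega>) (u t) = g (\<sigma> t \<omega>) (v t)" for t
  proof -
    have pos: "v t - u t > 0" using gap'[of t] gap(1) by linarith
    have "((\<lambda>t. ln (v t - u t) - ln (v 0 - u 0)) has_real_derivative
        (f (\<sigma> t \<omega>) (v t) - f (\<sigma> t \<omega>) (u t)) / (v t - u t)) (at t)"
      using pos by (auto intro!: derivative_eq_intros entire_solution_deriv[OF u(1)] entire_solution_deriv[OF v(1)])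
    then have "((\<lambda>t. integral_along a t \<omega>) has_real_derivative
        (f (\<sigma> t \<omega>) (v t) - f (\<sigma> t \<omega>) (u t)) / (v t - u t)) (at t)"
      by (simp add: integral)
    then have "a (\<sigma> t \<omega>) = (f (\<sigma> t \<omega>) (v t) - f (\<sigma> t \<omega>) (u t)) / (v t - u t)"
      using integral_along_deriv[OF a_cont] DERIV_unique by blast
    then show ?thesis using pos by (simp add: rhs_def field_simps)
  qed
  have less: "u t < v t" for t using gap'[of t] gap(1) by linarith
  show thesis
    by (rule that[OF u(1) v(1) gap' uR vR integral])
      (use g_eq_imp_between[OF less eq] in auto)
qed

text \<open>The two solutions are first expressed as \<open>e\<^sup>h (k + c)\<close> along their own orbit, with constants \<open>c1 < c2\<close>;
  the inequalities that they satisfy there extend to \<open>\<Omega>\<close> by density and continuity.\<close>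

lemma affine_family:
  assumes sup: "Sup (ereal ` sacker_sell_spectrum \<sigma> a) = 0"
    and gap: "d > 0" "\<And>\<omega>. d \<le> \<beta> \<omega> - \<alpha> \<omega>"
  obtains h k c1 c2 where "continuous_on UNIV h" "continuous_on UNIV k"
    "\<And>\<omega> t. h (\<sigma> t \<omega>) - h \<omega> = integral_along a t \<omega>"
    "\<And>\<omega> t. k (\<sigma> t \<omega>) - k \<omega> = integral_along (\<lambda>\<omega>. exp (- h \<omega>) * b \<omega>) t \<omega>"
    "c1 < c2" "\<And>\<omega>. r1 \<le> exp (h \<omega>) * (k \<omega> + c1)" "\<And>\<omega>. exp (h \<omega>) * (k \<omega> + c2) \<le> r2"
proof -
  obtain \<omega> u v R where uv: "entire_solution \<omega> u" "entire_solution \<omega> v"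
    "\<And>t. d \<le> v t - u t" and bdd: "\<And>t. \<bar>u t\<bar> \<le> R" "\<And>t. \<bar>v t\<bar> \<le> R" and
    integral: "\<And>t. integral_along a t \<omega> = ln (v t - u t) - ln (v 0 - u 0)" and
    range: "\<And>t. r1 \<le> u t" "\<And>t. v t \<le> r2"
    using linear_pair[OF sup gap] by blast
  have less: "u t < v t" for t using uv(3)[of t] gap(1) by linarith
  have "\<bar>ln (v t - u t)\<bar> \<le> \<bar>ln d\<bar> + \<bar>ln (2 * R)\<bar>" for t
  proof -
    have "v t - u t \<le> 2 * R" using bdd[of t] by linarith
    then have "ln d \<le> ln (v t - u t)" "ln (v t - u t) \<le> ln (2 * R)"
      using less[of t] uv(3)[of t] gap(1) by (auto intro!: ln_mono)
    then show ?thesis by linarith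
  qed
  then have "\<bar>ln (v t - u t) - ln (v 0 - u 0)\<bar> \<le> 2 * (\<bar>ln d\<bar> + \<bar>ln (2 * R)\<bar>)" for t
    by (smt (verit))
  from bounded_integral_imp_primitive[OF a_cont, of \<omega>, unfolded integral, OF this]
  obtain h where h: "continuous_on UNIV h" "\<And>\<omega> t. h (\<sigma> t \<omega>) - h \<omega> = integral_along a t \<omega>" by blast
  note h_deriv = primitive_deriv[OF a_cont h(2)]
  let ?c = "\<lambda>\<omega>. exp (- h \<omega>) * b \<omega>"
  have c: "continuous_on UNIV ?c" by (intro continuous_intros h b_cont)
  have "continuous_on UNIV (\<lambda>\<omega>. exp (- h \<omega>))" by (intro continuous_intros h)
  from bounded_continuous_base[OF this]
  obtain B where B: "\<And>\<omega>. \<bar>exp (- h \<omega>)\<bar> \<le> B" by blast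
  have z_deriv: "((\<lambda>t. exp (- h (\<sigma> t \<omega>)) * w t) has_real_derivative ?c (\<sigma> t \<omega>)) (at t)"
    if "entire_solution \<omega> w" "\<And>t. g (\<sigma> t \<omega>) (w t) = 0" for w t
    using that(2)[of t]
    by (auto intro!: derivative_eq_intros h_deriv entire_solution_deriv[OF that(1)] simp: rhs_def algebra_simps)
  have gu: "g (\<sigma> t \<omega>) (u t) = 0" and gv: "g (\<sigma> t \<omega>) (v t) = 0" for t
    using less[of t] range[of t] by (simp_all add: g_eq_zero_iff)
  have "\<bar>exp (- h (\<sigma> t \<omega>)) * u t\<bar> \<le> B * R" for t
    unfolding abs_mult by (intro mult_mono B bdd(1) order_trans[OF abs_ge_zero B] abs_ge_zero)
  from bounded_antiderivative_imp_primitive[OF c this z_deriv[OF uv(1) gu]]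
  obtain k where k: "continuous_on UNIV k" "\<And>\<omega> t. k (\<sigma> t \<omega>) - k \<omega> = integral_along ?c t \<omega>" by blast
  have form: "w t = exp (h (\<sigma> t \<omega>)) * (k (\<sigma> t \<omega>) + (exp (- h \<omega>) * w 0 - k \<omega>))"
    if "entire_solution \<omega> w" "\<And>t. g (\<sigma> t \<omega>) (w t) = 0" for w t
  proof -
    have "integral_along ?c t \<omega> = exp (- h (\<sigma> t \<omega>)) * w t - exp (- h (\<sigma> 0 \<omega>)) * w 0"
      by (rule integral_along_eqI[OF c z_deriv[OF that]])
    then have "exp (- h (\<sigma> t \<omega>)) * w t = k (\<sigma> t \<omega>) + (exp (- h \<omega>) * w 0 - k \<omega>)"
      using k(2)[of t \<omega>] by simp
    then have "exp (h (\<sigma> t \<omega>)) * (exp (- h (\<sigma> t \<omega>)) * w t)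
      = exp (h (\<sigma> t \<omega>)) * (k (\<sigma> t \<omega>) + (exp (- h \<omega>) * w 0 - k \<omega>))" by simp
    then show ?thesis by (simp add: mult.assoc[symmetric] flip: exp_add)
  qed
  show thesis
  proof (rule that[OF h(1) k(1) h(2) k(2)])
    show "exp (- h \<omega>) * u 0 - k \<omega> < exp (- h \<omega>) * v 0 - k \<omega>" using less[of 0] by simp
    have "{\<theta>. r1 \<le> exp (h \<theta>) * (k \<theta> + (exp (- h \<omega>) * u 0 - k \<omega>))} = UNIV"
    proof (rule closed_orbit_eq_UNIV[where \<omega> = \<omega>])
      show "closed {\<theta>. r1 \<le> exp (h \<theta>) * (k \<theta> + (exp (- h \<omega>) * u 0 - k \<omega>))}"
        by (intro closed_Collect_le continuous_intros h k)
      show "\<sigma> t \<omega> \<in> {\<theta>. r1 \<le> exp (h \<theta>) * (k \<theta> + (exp (- h \<omega>) * u 0 - k \<omega>))}" for t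
        unfolding mem_Collect_eq form[OF uv(1) gu, of t, symmetric] by (rule range(1))
    qed
    then show "r1 \<le> exp (h \<theta>) * (k \<theta> + (exp (- h \<omega>) * u 0 - k \<omega>))" for \<theta> by auto
    have "{\<theta>. exp (h \<theta>) * (k \<theta> + (exp (- h \<omega>) * v 0 - k \<omega>)) \<le> r2} = UNIV"
    proof (rule closed_orbit_eq_UNIV[where \<omega> = \<omega>])
      show "closed {\<theta>. exp (h \<theta>) * (k \<theta> + (exp (- h \<omega>) * v 0 - k \<omega>)) \<le> r2}"
        by (intro closed_Collect_le continuous_intros h k)
      show "\<sigma> t \<omega> \<in> {\<theta>. exp (h \<theta>) * (k \<theta> + (exp (- h \<omega>) * v 0 - k \<omega>)) \<le> r2}" for t
        unfolding mem_Collect_eq form[OF uv(2) gv, of t, symmetric] by (rule range(2))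
    qed
    then show "exp (h \<theta>) * (k \<theta> + (exp (- h \<omega>) * v 0 - k \<omega>)) \<le> r2" for \<theta> by auto
  qed
qed

end

section \<open>The bounding equilibria are affine\<close>

context dissipative_attractor
begin

text \<open>With \<open>\<psi> = e\<^sup>-\<^sup>h \<beta> - k\<close> and \<open>\<phi> = k - e\<^sup>-\<^sup>h \<alpha>\<close> both bounds are governed by the same monotone equation.
  The limits \<open>L\<close> give equilibria inside the attractor, which bound \<open>\<psi>\<close> and \<open>\<phi>\<close> from below everywhere and
  from above at the point of departure, so \<open>\<psi>\<close> and \<open>\<phi>\<close> are constant.\<close>

lemma attractor_affine:
  assumes sup: "Sup (ereal ` sacker_sell_spectrum \<sigma> a) = 0"
    and gap: "d > 0" "\<And>\<omega>. d \<le> \<beta> \<omega> - \<alpha> \<omega>"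
  obtains h k c1 c2 where "continuous_on UNIV h" "continuous_on UNIV k"
    "\<And>\<omega> t. h (\<sigma> t \<omega>) - h \<omega> = integral_along a t \<omega>"
    "\<And>\<omega> t. k (\<sigma> t \<omega>) - k \<omega> = integral_along (\<lambda>\<omega>. exp (- h \<omega>) * b \<omega>) t \<omega>"
    "c1 < c2" "\<And>\<omega>. \<alpha> \<omega> = exp (h \<omega>) * (k \<omega> + c1)" "\<And>\<omega>. \<beta> \<omega> = exp (h \<omega>) * (k \<omega> + c2)"
    "\<And>\<omega>. r1 \<le> \<alpha> \<omega>" "\<And>\<omega>. \<beta> \<omega> \<le> r2"
proof -
  obtain h k m1 m2 where h: "continuous_on UNIV h" and k: "continuous_on UNIV k" and
    hp: "\<And>\<omega> t. h (\<sigma> t \<omega>) - h \<omega> = integral_along a t \<omega>" and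
    kp: "\<And>\<omega> t. k (\<sigma> t \<omega>) - k \<omega> = integral_along (\<lambda>\<omega>. exp (- h \<omega>) * b \<omega>) t \<omega>" and
    m: "m1 < m2" "\<And>\<omega>. r1 \<le> exp (h \<omega>) * (k \<omega> + m1)" "\<And>\<omega>. exp (h \<omega>) * (k \<omega> + m2) \<le> r2"
    using affine_family[OF sup gap] by blast
  have cb: "continuous_on UNIV (\<lambda>\<omega>. exp (- h \<omega>) * b \<omega>)" by (intro continuous_intros h b_cont)
  note h_deriv = primitive_deriv[OF a_cont hp] and k_deriv = primitive_deriv[OF cb kp]
  define e where "e c \<omega> = exp (h \<omega>) * (k \<omega> + c)" for c \<omega>
  have e_mono: "e c \<omega> \<le> e c' \<omega> \<longleftrightarrow> c \<le> c'" for c c' \<omega> by (simp add: e_def)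
  have e_inv: "e (exp (- h \<omega>) * x - k \<omega>) \<omega> = x" for \<omega> x
    by (simp add: e_def mult.assoc[symmetric] flip: exp_add)
  have e_cont: "continuous_on UNIV (e c)" for c unfolding e_def by (intro continuous_intros h k)
  have e_in_A: "\<alpha> \<omega> \<le> e c \<omega>" "e c \<omega> \<le> \<beta> \<omega>"
    if "\<And>\<theta>. r1 \<le> e c \<theta>" "\<And>\<theta>. e c \<theta> \<le> r2" for c \<omega>
  proof -
    have "entire_solution \<theta> (\<lambda>t. e c (\<sigma> t \<theta>))" for \<theta>
      unfolding entire_solution_def
    proof
      fix t
      have "g (\<sigma> t \<theta>) (e c (\<sigma> t \<theta>)) = 0" using that by (simp add: g_eq_zero_iff)
      then have "f (\<sigma> t \<theta>) (e c (\<sigma> t \<theta>)) = a (\<sigma> t \<theta>) * e c (\<sigma> t \<theta>) + b (\<sigma> t \<theta>)" by (simp add: rhs_def)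
      moreover have "exp (h (\<sigma> t \<theta>)) * (exp (- h (\<sigma> t \<theta>)) * b (\<sigma> t \<theta>)) = b (\<sigma> t \<theta>)"
        by (simp add: mult.assoc[symmetric] flip: exp_add)
      ultimately show "((\<lambda>t. e c (\<sigma> t \<theta>)) has_real_derivative f (\<sigma> t \<theta>) (e c (\<sigma> t \<theta>))) (at t)"
        unfolding e_def by (auto intro!: derivative_eq_intros h_deriv k_deriv simp: algebra_simps)
    qed
    from continuous_equilibrium_in_A[OF e_cont this] show "\<alpha> \<omega> \<le> e c \<omega>" "e c \<omega> \<le> \<beta> \<omega>" by simp_all
  qed
  have m1: "r1 \<le> e m1 \<omega>" "e m1 \<omega> \<le> r2" and m2: "r1 \<le> e m2 \<omega>" "e m2 \<omega> \<le> r2" for \<omega>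
    using m(2,3)[of \<omega>] e_mono[of m1 \<omega> m2] m(1) by (simp_all add: e_def[symmetric])
  define \<psi> where "\<psi> \<omega> = exp (- h \<omega>) * \<beta> \<omega> - k \<omega>" for \<omega>
  define \<phi> where "\<phi> \<omega> = k \<omega> - exp (- h \<omega>) * \<alpha> \<omega>" for \<omega>
  have \<beta>_eq: "\<beta> \<omega> = e (\<psi> \<omega>) \<omega>" for \<omega> unfolding \<psi>_def e_inv ..
  have \<alpha>_eq: "\<alpha> \<omega> = e (- \<phi> \<omega>) \<omega>" for \<omega> using e_inv[of \<omega> "\<alpha> \<omega>"] by (simp add: \<phi>_def)
  obtain R where R: "\<And>\<omega> x. (\<omega>, x) \<in> A \<Longrightarrow> \<bar>x\<bar> \<le> R" using bounded_A by blast
  obtain B1 where B1: "\<And>\<omega>. \<bar>exp (- h \<omega>)\<bar> \<le> B1"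
    using bounded_continuous_base[OF continuous_on_exp[OF continuous_on_minus[OF h]]] by blast
  obtain B2 where B2: "\<And>\<omega>. \<bar>k \<omega>\<bar> \<le> B2" using bounded_continuous_base[OF k] by blast
  have bound: "\<bar>exp (- h \<omega>) * x\<bar> \<le> B1 * R" if "(\<omega>, x) \<in> A" for \<omega> x
    unfolding abs_mult by (intro mult_mono B1 R[OF that] order_trans[OF abs_ge_zero B1] abs_ge_zero)
  have jointly: "continuous_on UNIV (\<lambda>(\<omega>, x). exp (- h \<omega>) * g \<omega> (exp (h \<omega>) * (k \<omega> + s * x)))" for s
  proof -
    have p: "continuous_on UNIV (\<lambda>p::'a \<times> real. h (fst p))" "continuous_on UNIV (\<lambda>p::'a \<times> real. k (fst p))"
      by (auto intro!: continuous_on_compose2[OF h] continuous_on_compose2[OF k] continuous_intros)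
    have "continuous_on UNIV (\<lambda>p::'a \<times> real. g (fst p) (exp (h (fst p)) * (k (fst p) + s * snd p)))"
      using continuous_on_compose2[OF g_cont continuous_on_Pair[OF continuous_on_fst[OF continuous_on_id]
          continuous_on_mult[OF continuous_on_exp[OF p(1)] continuous_on_add[OF p(2)
            continuous_on_mult[OF continuous_on_const continuous_on_snd[OF continuous_on_id]]]]]]
      by simp
    then show ?thesis
      unfolding case_prod_unfold by (intro continuous_on_mult continuous_on_exp continuous_on_minus p)
  qed
  have \<psi>_le: "\<psi> \<omega> \<le> \<psi> \<theta>" and \<beta>_le: "\<beta> \<omega> \<le> r2" for \<omega> \<theta>
  proof -
    have "\<exists>L. \<psi> \<omega> \<le> L \<and> (\<forall>\<theta>. exp (- h \<theta>) * g \<theta> (e L \<theta>) = 0)"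
    proof (rule monotone_orbit_limit[where G = "\<lambda>\<omega> x. exp (- h \<omega>) * g \<omega> (e x \<omega>)" and \<psi> = \<psi>
          and \<omega> = \<omega> and m = m1 and B = "B1 * R + B2"])
      show "continuous_on UNIV (\<lambda>(\<omega>, x). exp (- h \<omega>) * g \<omega> (e x \<omega>))"
        using jointly[of 1] by (simp add: e_def)
      show "exp (- h \<theta>) * g \<theta> (e y \<theta>) \<le> exp (- h \<theta>) * g \<theta> (e x \<theta>)" if "x \<le> y" for \<theta> x y
        using that by (intro mult_left_mono g_antimono) (simp_all add: e_mono)
      show "exp (- h \<theta>) * g \<theta> (e x \<theta>) \<le> 0" if "m1 \<le> x" for \<theta> x
        using that e_mono[of m1 \<theta> x] m1(1)[of \<theta>] g_nonpos[of "e x \<theta>" \<theta>] by (auto simp: mult_le_0_iff)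
      fix t
      show "((\<lambda>t. \<psi> (\<sigma> t \<omega>)) has_real_derivative
          exp (- h (\<sigma> t \<omega>)) * g (\<sigma> t \<omega>) (e (\<psi> (\<sigma> t \<omega>)) (\<sigma> t \<omega>))) (at t)"
        unfolding \<beta>_eq[symmetric] unfolding \<psi>_def
        by (auto intro!: derivative_eq_intros h_deriv k_deriv entire_solution_deriv[OF entire_\<beta>]
            simp: rhs_def algebra_simps)
      have "e m2 (\<sigma> t \<omega>) \<le> e (\<psi> (\<sigma> t \<omega>)) (\<sigma> t \<omega>)" unfolding \<beta>_eq[symmetric] by (rule e_in_A[OF m2])
      then show "m1 < \<psi> (\<sigma> t \<omega>)" using m(1) by (simp add: e_mono)
      show "\<psi> (\<sigma> t \<omega>) \<le> B1 * R + B2"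
        using bound[OF \<beta>_in_A, of "\<sigma> t \<omega>"] B2[of "\<sigma> t \<omega>"] unfolding \<psi>_def by linarith
    qed
    then obtain L where L: "\<psi> \<omega> \<le> L" "\<And>\<theta>. exp (- h \<theta>) * g \<theta> (e L \<theta>) = 0" by blast
    then have range: "r1 \<le> e L \<theta>" "e L \<theta> \<le> r2" for \<theta> by (simp_all add: g_eq_zero_iff)
    then have "e L \<theta> \<le> e (\<psi> \<theta>) \<theta>" unfolding \<beta>_eq[symmetric] by (rule e_in_A)
    then show "\<psi> \<omega> \<le> \<psi> \<theta>" using L(1) by (simp add: e_mono)
    have "\<beta> \<omega> \<le> e L \<omega>" unfolding \<beta>_eq e_mono by (rule L(1))
    then show "\<beta> \<omega> \<le> r2" using range(2)[of \<omega>] by (rule order_trans)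
  qed
  have \<phi>_le: "\<phi> \<omega> \<le> \<phi> \<theta>" and \<alpha>_ge: "r1 \<le> \<alpha> \<omega>" for \<omega> \<theta>
  proof -
    have "\<exists>L. \<phi> \<omega> \<le> L \<and> (\<forall>\<theta>. - (exp (- h \<theta>) * g \<theta> (e (- L) \<theta>)) = 0)"
    proof (rule monotone_orbit_limit[where G = "\<lambda>\<omega> x. - (exp (- h \<omega>) * g \<omega> (e (- x) \<omega>))" and \<psi> = \<phi>
          and \<omega> = \<omega> and m = "- m2" and B = "B1 * R + B2"])
      show "continuous_on UNIV (\<lambda>(\<omega>, x). - (exp (- h \<omega>) * g \<omega> (e (- x) \<omega>)))"
        using continuous_on_minus[OF jointly[of "-1"]] by (simp add: e_def case_prod_unfold)
      show "- (exp (- h \<theta>) * g \<theta> (e (- y) \<theta>)) \<le> - (exp (- h \<theta>) * g \<theta> (e (- x) \<theta>))" if "x \<le> y" for \<theta> x y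
        using that by (intro le_imp_neg_le mult_left_mono g_antimono) (simp_all add: e_mono)
      show "- (exp (- h \<theta>) * g \<theta> (e (- x) \<theta>)) \<le> 0" if "- m2 \<le> x" for \<theta> x
        using that e_mono[of "- x" \<theta> m2] m2(2)[of \<theta>] g_nonneg[of "e (- x) \<theta>" \<theta>] by auto
      fix t
      show "((\<lambda>t. \<phi> (\<sigma> t \<omega>)) has_real_derivative
          - (exp (- h (\<sigma> t \<omega>)) * g (\<sigma> t \<omega>) (e (- \<phi> (\<sigma> t \<omega>)) (\<sigma> t \<omega>)))) (at t)"
        unfolding \<alpha>_eq[symmetric] unfolding \<phi>_def
        by (auto intro!: derivative_eq_intros h_deriv k_deriv entire_solution_deriv[OF entire_\<alpha>]
            simp: rhs_def algebra_simps)
      have "e (- \<phi> (\<sigma> t \<omega>)) (\<sigma> t \<omega>) \<le> e m1 (\<sigma> t \<omega>)" unfolding \<alpha>_eq[symmetric] by (rule e_in_A[OF m1])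
      then show "- m2 < \<phi> (\<sigma> t \<omega>)" using m(1) by (simp add: e_mono)
      show "\<phi> (\<sigma> t \<omega>) \<le> B1 * R + B2"
        using bound[OF \<alpha>_in_A, of "\<sigma> t \<omega>"] B2[of "\<sigma> t \<omega>"] unfolding \<phi>_def by linarith
    qed
    then obtain L where L: "\<phi> \<omega> \<le> L" "\<And>\<theta>. - (exp (- h \<theta>) * g \<theta> (e (- L) \<theta>)) = 0" by blast
    then have range: "r1 \<le> e (- L) \<theta>" "e (- L) \<theta> \<le> r2" for \<theta> by (simp_all add: g_eq_zero_iff)
    then have "e (- \<phi> \<theta>) \<theta> \<le> e (- L) \<theta>" unfolding \<alpha>_eq[symmetric] by (rule e_in_A)
    then show "\<phi> \<omega> \<le> \<phi> \<theta>" using L(1) by (simp add: e_mono)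
    have "e (- L) \<omega> \<le> \<alpha> \<omega>" unfolding \<alpha>_eq e_mono using L(1) by simp
    with range(1)[of \<omega>] show "r1 \<le> \<alpha> \<omega>" by (rule order_trans)
  qed
  fix \<omega> :: 'a
  have const: "\<psi> \<theta> = \<psi> \<omega>" "\<phi> \<theta> = \<phi> \<omega>" for \<theta>
    using \<psi>_le \<phi>_le by (auto intro: antisym)
  show thesis
  proof (rule that[OF h k hp kp])
    show \<alpha>: "\<alpha> \<theta> = exp (h \<theta>) * (k \<theta> + - \<phi> \<omega>)" and \<beta>: "\<beta> \<theta> = exp (h \<theta>) * (k \<theta> + \<psi> \<omega>)" for \<theta>
      using \<alpha>_eq[of \<theta>] \<beta>_eq[of \<theta>] unfolding const[of \<theta>] e_def .
    show "- \<phi> \<omega> < \<psi> \<omega>"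
      using gap(1) gap(2)[of \<omega>] e_mono[of "\<psi> \<omega>" \<omega> "- \<phi> \<omega>"] by (simp add: \<alpha>_eq \<beta>_eq)
  qed (rule \<alpha>_ge \<beta>_le)+
qed

end

section \<open>Minimal sets and their Lyapunov exponents\<close>

context dissipative_attractor
begin

lemma skew_flow_graph:
  assumes "\<And>\<omega>. entire_solution \<omega> (\<lambda>t. \<psi> (\<sigma> t \<omega>))"
  shows "skew_flow \<sigma> f t (\<omega>, \<psi> \<omega>) = (\<sigma> t \<omega>, \<psi> (\<sigma> t \<omega>))"
  using entire_solution_imp_sol(2)[OF assms, of t \<omega>] by (simp add: skew_flow_def)

lemma minimal_set_eq_graph:
  assumes M: "flow_minimal (skew_dom \<sigma> f) (skew_flow \<sigma> f) M"
    and \<psi>: "continuous_on UNIV \<psi>" "\<And>\<omega>. entire_solution \<omega> (\<lambda>t. \<psi> (\<sigma> t \<omega>))"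
    and "(\<omega>, \<psi> \<omega>) \<in> M"
  shows "M = graph \<psi>"
proof -
  have "skew_flow \<sigma> f t (\<omega>, \<psi> \<omega>) \<in> M" for t
  proof -
    have "skew_flow \<sigma> f t ` M = M" using M by (simp add: flow_minimal_def flow_invariant_def)
    then show ?thesis using assms(4) by blast
  qed
  then have "range (\<lambda>t. (\<sigma> t \<omega>, \<psi> (\<sigma> t \<omega>))) \<subseteq> M"
    by (auto simp: skew_flow_graph[OF \<psi>(2)])
  moreover have "closed M" using M by (auto simp: flow_minimal_def intro: compact_imp_closed)
  ultimately have "orbit_closure \<sigma> \<psi> \<omega> \<subseteq> M"
    unfolding orbit_closure_def by (rule closure_minimal)
  then have "graph \<psi> \<subseteq> M" by (simp only: orbit_closure_eq_graph[OF \<psi>(1)])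
  moreover have "graph \<psi> \<noteq> {}" by (auto simp: graph_def)
  ultimately show ?thesis
    using M compact_graph[OF \<psi>(1)] graph_flow_invariant[OF \<psi>(2)]
    unfolding flow_minimal_def by metis
qed

text \<open>The graph map conjugates \<open>\<sigma>\<close> to the skew-product flow, so the image of an invariant measure on the base
  is invariant.\<close>

lemma ex_invariant_measure_graph:
  assumes \<psi>: "continuous_on UNIV \<psi>" "\<And>\<omega>. entire_solution \<omega> (\<lambda>t. \<psi> (\<sigma> t \<omega>))"
  shows "invariant_measures (skew_flow \<sigma> f) (graph \<psi>) \<noteq> {}"
proof -
  obtain m :: "'a measure" where m: "sets m = sets borel" "prob_space m" "\<And>t. distr m borel (\<sigma> t) = m"
    using ex_invariant_probability by blast
  interpret m: prob_space m by (rule m(2))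
  let ?G = "\<lambda>\<omega>. (\<omega>, \<psi> \<omega>)" and ?N = "restrict_space borel (graph \<psi>)"
  have G: "?G \<in> measurable m ?N"
  proof (rule measurable_restrict_space2)
    have "?G \<in> borel_measurable borel"
      using \<psi>(1) by (intro borel_measurable_continuous_onI continuous_intros)
    then show "?G \<in> borel_measurable m" by (simp add: measurable_cong_sets[OF m(1) refl])
  qed (simp add: graph_def)
  have \<sigma>: "\<sigma> t \<in> measurable m m" for t
  proof -
    have "continuous_on UNIV (\<lambda>\<omega>. \<sigma> t \<omega>)" by (intro continuous_intros)
    then have "\<sigma> t \<in> borel_measurable borel" by (intro borel_measurable_continuous_onI)
    then show ?thesis by (simp add: measurable_cong_sets[OF m(1) m(1)])
  qed
  have \<Phi>: "skew_flow \<sigma> f t \<in> measurable ?N ?N" for t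
  proof (rule measurable_restrict_space2)
    show "skew_flow \<sigma> f t \<in> space ?N \<rightarrow> graph \<psi>"
      by (auto simp: space_restrict_space graph_def skew_flow_graph[OF \<psi>(2)])
    have "continuous_on UNIV (\<lambda>p::'a \<times> real. \<sigma> t (fst p))" by (intro continuous_intros)
    then have "continuous_on UNIV (\<lambda>p::'a \<times> real. (\<sigma> t (fst p), \<psi> (\<sigma> t (fst p))))"
      by (intro continuous_on_Pair continuous_on_compose2[OF \<psi>(1)]) auto
    then have "(\<lambda>p::'a \<times> real. (\<sigma> t (fst p), \<psi> (\<sigma> t (fst p)))) \<in> borel_measurable ?N"
      by (intro measurable_restrict_space1 borel_measurable_continuous_onI)
    then show "skew_flow \<sigma> f t \<in> borel_measurable ?N"
      by (rule measurable_cong[THEN iffD1, rotated])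
        (auto simp: space_restrict_space graph_def skew_flow_graph[OF \<psi>(2)])
  qed
  let ?\<nu> = "distr m ?N ?G"
  have "distr ?\<nu> ?\<nu> (skew_flow \<sigma> f t) = ?\<nu>" for t
  proof -
    have "distr ?\<nu> ?\<nu> (skew_flow \<sigma> f t) = distr ?\<nu> ?N (skew_flow \<sigma> f t)"
      by (rule distr_cong) simp_all
    also have "\<dots> = distr m ?N (skew_flow \<sigma> f t \<circ> ?G)" by (rule distr_distr[OF \<Phi> G])
    also have "skew_flow \<sigma> f t \<circ> ?G = ?G \<circ> \<sigma> t"
      by (simp add: fun_eq_iff skew_flow_graph[OF \<psi>(2)])
    also have "distr m ?N (?G \<circ> \<sigma> t) = distr (distr m m (\<sigma> t)) ?N ?G"
      by (rule distr_distr[OF G \<sigma>, symmetric])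
    also have "distr m m (\<sigma> t) = distr m borel (\<sigma> t)" by (rule distr_cong) (simp_all add: m(1))
    finally show ?thesis by (simp only: m(3))
  qed
  then have "?\<nu> \<in> invariant_measures (skew_flow \<sigma> f) (graph \<psi>)"
    using \<Phi> m.prob_space_distr[OF G] by (simp add: invariant_measures_def)
  then show ?thesis by blast
qed

lemma upper_lyapunov_exponent_graph:
  assumes \<psi>: "continuous_on UNIV \<psi>" "\<And>\<omega>. entire_solution \<omega> (\<lambda>t. \<psi> (\<sigma> t \<omega>))"
    and range: "\<And>\<omega>. r1 \<le> \<psi> \<omega>" "\<And>\<omega>. \<psi> \<omega> \<le> r2"
    and h: "continuous_on UNIV h" "\<And>\<omega> t. h (\<sigma> t \<omega>) - h \<omega> = integral_along a t \<omega>"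
  shows "upper_lyapunov_exponent (skew_flow \<sigma> f) (\<lambda>(\<omega>, x). a \<omega> + deriv (g \<omega>) x) (graph \<psi>) = 0"
proof -
  have zero: "(\<integral>p. (case p of (\<omega>, x) \<Rightarrow> a \<omega> + deriv (g \<omega>) x) \<partial>\<nu>) = 0"
    if \<nu>: "\<nu> \<in> invariant_measures (skew_flow \<sigma> f) (graph \<psi>)" for \<nu>
  proof -
    have sets: "sets \<nu> = sets (restrict_space borel (graph \<psi>))" using \<nu> by (simp add: invariant_measures_def)
    then have "space \<nu> = graph \<psi>" by (auto dest: sets_eq_imp_space_eq simp: space_restrict_space)
    then have "(\<integral>p. (case p of (\<omega>, x) \<Rightarrow> a \<omega> + deriv (g \<omega>) x) \<partial>\<nu>) = (\<integral>p. a (fst p) \<partial>\<nu>)"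
      by (intro Bochner_Integration.integral_cong refl)
        (auto simp: graph_def deriv_g_eq_zero[OF range])
    also have "\<dots> = 0"
    proof (rule integral_eq_zero_of_primitive[OF a_cont h \<nu>])
      have "(fst :: 'a \<times> real \<Rightarrow> 'a) \<in> borel_measurable (restrict_space borel (graph \<psi>))"
        by (intro measurable_restrict_space1 borel_measurable_continuous_onI continuous_intros)
      then show "fst \<in> borel_measurable \<nu>" by (simp add: measurable_cong_sets[OF sets refl])
      show "fst (skew_flow \<sigma> f t p) = \<sigma> t (fst p)" for t p by (simp add: skew_flow_def case_prod_unfold)
    qed
    finally show ?thesis .
  qed
  then show ?thesis
    unfolding upper_lyapunov_exponent_def using ex_invariant_measure_graph[OF \<psi>]
    by (simp cong: SUP_cong add: zero_ereal_def)
qed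

end

theorem theorem3p10:
  fixes \<sigma> :: "real \<Rightarrow> 'w::metric_space \<Rightarrow> 'w"
    and a b :: "'w \<Rightarrow> real"
    and g :: "'w \<Rightarrow> real \<Rightarrow> real"
    and r1 r2 :: real
    and A :: "('w \<times> real) set"
    and \<alpha> \<beta> :: "'w \<Rightarrow> real"
    and \<omega>0 \<omega>1 :: 'w
  assumes "compact (UNIV :: 'w set)"
    and "continuous_flow \<sigma>"
    and "flow_minimal (\<lambda>_. UNIV) \<sigma> UNIV"
    and "continuous_on UNIV a" and "continuous_on UNIV b"
    and "admissible_nonlinearity g r1 r2"
    and "global_attractor (skew_dom \<sigma> (rhs a b g)) (skew_flow \<sigma> (rhs a b g)) A"
    and "\<forall>\<omega>. \<alpha> \<omega> \<le> \<beta> \<omega>"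
    and "A = (\<Union>\<omega>. {\<omega>} \<times> {\<alpha> \<omega>..\<beta> \<omega>})"
    and "Sup (ereal ` sacker_sell_spectrum \<sigma> a) = 0"
    and "\<omega>0 \<in> common_continuity_points \<alpha> \<beta>" and "\<alpha> \<omega>0 < \<beta> \<omega>0"
    and "\<omega>1 \<in> common_continuity_points \<alpha> \<beta>"
  shows "fiber_less (orbit_closure \<sigma> \<alpha> \<omega>1) (orbit_closure \<sigma> \<beta> \<omega>1)
    \<and> r1 < r2
    \<and> (\<exists>h. continuous_primitive \<sigma> a h)
    \<and> (common_continuity_points \<alpha> \<beta> = UNIV \<and>
       equilibrium \<sigma> (rhs a b g) \<alpha> \<and> equilibrium \<sigma> (rhs a b g) \<beta> \<and>
       orbit_closure \<sigma> \<alpha> \<omega>1 = graph \<alpha> \<and> orbit_closure \<sigma> \<beta> \<omega>1 = graph \<beta>)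
    \<and> (\<forall>M. flow_minimal (skew_dom \<sigma> (rhs a b g)) (skew_flow \<sigma> (rhs a b g)) M \<longrightarrow>
         (\<exists>c\<in>{0..1}. continuous_on UNIV (\<lambda>\<omega>. c * \<alpha> \<omega> + (1 - c) * \<beta> \<omega>) \<and>
                     M = graph (\<lambda>\<omega>. c * \<alpha> \<omega> + (1 - c) * \<beta> \<omega>)) \<and>
         upper_lyapunov_exponent (skew_flow \<sigma> (rhs a b g))
           (\<lambda>(\<omega>, x). a \<omega> + deriv (g \<omega>) x) M = 0)
    \<and> (A = (\<Union>c\<in>{0..1}. graph (\<lambda>\<omega>. c * \<alpha> \<omega> + (1 - c) * \<beta> \<omega>)) \<and>
       A \<subseteq> UNIV \<times> {r1..r2} \<and>
       linear_on \<sigma> (rhs a b g) a b A \<and>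
       uniformly_stable \<sigma> (rhs a b g) A {0..} \<and>
       uniformly_stable \<sigma> (rhs a b g) A {..0})"
proof -
  interpret dissipative_attractor \<sigma> a b g r1 r2 A \<alpha> \<beta>
    by unfold_locales (use assms in auto)
  have cont: "isCont \<alpha> \<omega>0" "isCont \<beta> \<omega>0"
    using assms(11) by (auto simp: common_continuity_points_def)
  obtain d where d: "d > 0" "\<And>\<omega>. d \<le> \<beta> \<omega> - \<alpha> \<omega>"
    using uniform_gap[OF cont assms(12)] by blast
  obtain h k c1 c2 where h: "continuous_on UNIV h" and k: "continuous_on UNIV k" and
    hp: "\<And>\<omega> t. h (\<sigma> t \<omega>) - h \<omega> = integral_along a t \<omega>" and
    kp: "\<And>\<omega> t. k (\<sigma> t \<omega>) - k \<omega> = integral_along (\<lambda>\<omega>. exp (- h \<omega>) * b \<omega>) t \<omega>" and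
    c: "c1 < c2" and \<alpha>: "\<And>\<omega>. \<alpha> \<omega> = exp (h \<omega>) * (k \<omega> + c1)" and
    \<beta>: "\<And>\<omega>. \<beta> \<omega> = exp (h \<omega>) * (k \<omega> + c2)" and
    range: "\<And>\<omega>. r1 \<le> \<alpha> \<omega>" "\<And>\<omega>. \<beta> \<omega> \<le> r2"
    using attractor_affine[OF assms(10) d] by blast
  have less: "\<alpha> \<omega> < \<beta> \<omega>" for \<omega> using d(1) d(2)[of \<omega>] by linarith
  have \<alpha>_cont: "continuous_on UNIV \<alpha>" and \<beta>_cont: "continuous_on UNIV \<beta>"
    unfolding \<alpha>[abs_def] \<beta>[abs_def] by (intro continuous_intros h k)+
  define e where "e c \<omega> = c * \<alpha> \<omega> + (1 - c) * \<beta> \<omega>" for c \<omega>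
  have e_exp: "e c \<omega> = \<beta> \<omega> - c * (c2 - c1) * exp (h \<omega>)" for c \<omega>
    by (simp add: e_def \<alpha> \<beta> algebra_simps)
  have e_cont: "continuous_on UNIV (e c)" for c
    unfolding e_def by (intro continuous_intros \<alpha>_cont \<beta>_cont)
  have e_between: "\<alpha> \<omega> \<le> e c \<omega>" "e c \<omega> \<le> \<beta> \<omega>" if "c \<in> {0..1}" for c \<omega>
  proof -
    have "e c \<omega> = \<alpha> \<omega> + (1 - c) * (\<beta> \<omega> - \<alpha> \<omega>)" "e c \<omega> = \<beta> \<omega> - c * (\<beta> \<omega> - \<alpha> \<omega>)"
      by (simp_all add: e_def algebra_simps)
    moreover have "0 \<le> (1 - c) * (\<beta> \<omega> - \<alpha> \<omega>)" "0 \<le> c * (\<beta> \<omega> - \<alpha> \<omega>)"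
      using that less[of \<omega>] by (auto intro!: mult_nonneg_nonneg)
    ultimately show "\<alpha> \<omega> \<le> e c \<omega>" "e c \<omega> \<le> \<beta> \<omega>" by linarith+
  qed
  have e_range: "r1 \<le> e c \<omega>" "e c \<omega> \<le> r2" if "c \<in> {0..1}" for c \<omega>
    using e_between[OF that, of \<omega>] range[of \<omega>] by linarith+
  have g_zero: "g \<omega> x = 0" if "(\<omega>, x) \<in> A" for \<omega> x
    using that range[of \<omega>] by (simp add: in_A_iff g_eq_zero_iff)
  have f_A: "f \<omega> x = a \<omega> * x + b \<omega>" if "(\<omega>, x) \<in> A" for \<omega> x
    using g_zero[OF that] by (simp add: rhs_def)
  have e_entire: "entire_solution \<omega> (\<lambda>t. e c (\<sigma> t \<omega>))" if "c \<in> {0..1}" for c \<omega>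
    unfolding entire_solution_def
  proof
    fix t
    let ?\<omega> = "\<sigma> t \<omega>"
    have "((\<lambda>t. e c (\<sigma> t \<omega>)) has_real_derivative c * f ?\<omega> (\<alpha> ?\<omega>) + (1 - c) * f ?\<omega> (\<beta> ?\<omega>)) (at t)"
      unfolding e_def
      by (auto intro!: derivative_eq_intros entire_solution_deriv[OF entire_\<alpha>] entire_solution_deriv[OF entire_\<beta>])
    also have "c * f ?\<omega> (\<alpha> ?\<omega>) + (1 - c) * f ?\<omega> (\<beta> ?\<omega>) = a ?\<omega> * e c ?\<omega> + b ?\<omega>"
      by (simp add: f_A[OF \<alpha>_in_A] f_A[OF \<beta>_in_A] e_def algebra_simps)
    also have "\<dots> = f ?\<omega> (e c ?\<omega>)"
      by (rule f_A[symmetric]) (simp add: in_A_iff e_between[OF that])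
    finally show "((\<lambda>t. e c (\<sigma> t \<omega>)) has_real_derivative f ?\<omega> (e c ?\<omega>)) (at t)" .
  qed
  have e_onto: "\<exists>c\<in>{0..1}. x = e c \<omega>" if "(\<omega>, x) \<in> A" for \<omega> x
  proof
    show "(\<beta> \<omega> - x) / (\<beta> \<omega> - \<alpha> \<omega>) \<in> {0..1}"
      using that less[of \<omega>] by (simp add: in_A_iff)
    have "e c \<omega> = \<beta> \<omega> - c * (\<beta> \<omega> - \<alpha> \<omega>)" for c by (simp add: e_def algebra_simps)
    then show "x = e ((\<beta> \<omega> - x) / (\<beta> \<omega> - \<alpha> \<omega>)) \<omega>" using less[of \<omega>] by simp
  qed
  have sol_e: "sol \<sigma> f t \<omega> (e c \<omega>) = e c (\<sigma> t \<omega>)" if "c \<in> {0..1}" for c t \<omega>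
    using entire_solution_imp_sol(2)[OF e_entire[OF that]] by simp
  have A_graphs: "A = (\<Union>c\<in>{0..1}. graph (e c))"
    using e_onto e_between by (force simp: graph_def in_A_iff)
  have closures: "orbit_closure \<sigma> \<alpha> \<omega>1 = graph \<alpha>" "orbit_closure \<sigma> \<beta> \<omega>1 = graph \<beta>"
    by (rule orbit_closure_eq_graph[OF \<alpha>_cont] orbit_closure_eq_graph[OF \<beta>_cont])+
  have "fiber_less (orbit_closure \<sigma> \<alpha> \<omega>1) (orbit_closure \<sigma> \<beta> \<omega>1)"
    unfolding closures fiber_less_def using less by (auto simp: graph_def)
  moreover have "r1 < r2" using less[of \<omega>0] range[of \<omega>0] by linarith
  moreover have "continuous_primitive \<sigma> a h"
    unfolding continuous_primitive_def using h hp by (simp add: integral_along_def)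
  moreover have "common_continuity_points \<alpha> \<beta> = UNIV"
    using \<alpha>_cont \<beta>_cont by (auto simp: common_continuity_points_def continuous_on_eq_continuous_at)
  moreover have "equilibrium \<sigma> f \<alpha>" "equilibrium \<sigma> f \<beta>"
    unfolding equilibrium_def by (simp_all add: sol_dom_A \<alpha>_in_A \<beta>_in_A sol_\<alpha> sol_\<beta>)
  moreover have "(\<exists>c\<in>{0..1}. continuous_on UNIV (e c) \<and> M = graph (e c)) \<and>
      upper_lyapunov_exponent (skew_flow \<sigma> f) (\<lambda>(\<omega>, x). a \<omega> + deriv (g \<omega>) x) M = 0"
    if M: "flow_minimal (skew_dom \<sigma> f) (skew_flow \<sigma> f) M" for M
  proof -
    have "M \<subseteq> A" using M by (intro compact_invariant_subset_A) (auto simp: flow_minimal_def)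
    moreover have "M \<noteq> {}" using M by (simp add: flow_minimal_def)
    ultimately obtain \<omega> x where x: "(\<omega>, x) \<in> M" "(\<omega>, x) \<in> A" by auto
    then obtain c where c: "c \<in> {0..1}" "x = e c \<omega>" using e_onto by blast
    have "M = graph (e c)"
      by (rule minimal_set_eq_graph[OF M e_cont e_entire[OF c(1)]]) (use x(1) c(2) in simp)
    then show ?thesis
      using c(1) e_cont upper_lyapunov_exponent_graph[OF e_cont e_entire[OF c(1)] e_range[OF c(1)] h hp]
      by blast
  qed
  moreover have "A \<subseteq> UNIV \<times> {r1..r2}"
  proof
    fix p assume "p \<in> A"
    then show "p \<in> UNIV \<times> {r1..r2}"
      using range[of "fst p"] in_A_iff[of "fst p" "snd p"] by (simp add: mem_Times_iff)
  qed
  moreover have "linear_on \<sigma> f a b A"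
    unfolding linear_on_def
  proof (intro ballI, clarsimp, intro conjI allI)
    fix \<omega> x t assume x: "(\<omega>, x) \<in> A"
    show "sol_dom \<sigma> f \<omega> x = UNIV" by (rule sol_dom_A[OF x])
    show "((\<lambda>s. sol \<sigma> f s \<omega> x) has_real_derivative a (\<sigma> t \<omega>) * sol \<sigma> f t \<omega> x + b (\<sigma> t \<omega>)) (at t)"
      using entire_solution_deriv[OF entire_A[OF x], of t] by (simp add: f_A[OF sol_in_A[OF x]])
  qed
  moreover have "uniformly_stable \<sigma> f A T" for T
    unfolding uniformly_stable_def
  proof (intro allI impI)
    fix \<kappa> :: real assume "\<kappa> > 0"
    obtain B where B: "\<And>\<omega>. \<bar>h \<omega>\<bar> \<le> B" using bounded_continuous_base[OF h] by blast
    show "\<exists>\<delta>>0. \<forall>\<omega> x1 x2. (\<omega>, x1) \<in> A \<and> (\<omega>, x2) \<in> A \<and> \<bar>x1 - x2\<bar> < \<delta> \<longrightarrow>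
      (\<forall>t\<in>T. \<bar>sol \<sigma> f t \<omega> x1 - sol \<sigma> f t \<omega> x2\<bar> \<le> \<kappa>)"
    \<comment> \<open>Differences within \<open>A\<close> are multiples of \<open>e\<^sup>h\<close>, which varies by a factor of at most \<open>e\<^sup>2\<^sup>B\<close>.\<close>
    proof (intro exI[of _ "\<kappa> / exp (2 * B)"] conjI allI impI ballI)
      show "\<kappa> / exp (2 * B) > 0" using \<open>\<kappa> > 0\<close> by simp
      fix \<omega> x1 x2 t assume x: "(\<omega>, x1) \<in> A \<and> (\<omega>, x2) \<in> A \<and> \<bar>x1 - x2\<bar> < \<kappa> / exp (2 * B)"
      obtain p where p: "p \<in> {0..1}" "x1 = e p \<omega>" using e_onto x by blast
      obtain q where q: "q \<in> {0..1}" "x2 = e q \<omega>" using e_onto x by blast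
      have diff: "e p \<theta> - e q \<theta> = (q - p) * (c2 - c1) * exp (h \<theta>)" for \<theta>
        by (simp add: e_exp algebra_simps)
      have "\<bar>sol \<sigma> f t \<omega> x1 - sol \<sigma> f t \<omega> x2\<bar> = \<bar>(q - p) * (c2 - c1)\<bar> * exp (h (\<sigma> t \<omega>))"
        unfolding p(2) q(2) sol_e[OF p(1)] sol_e[OF q(1)] diff abs_mult by simp
      also have "\<dots> \<le> \<bar>(q - p) * (c2 - c1)\<bar> * exp (h \<omega> + 2 * B)"
        using B[of "\<sigma> t \<omega>"] B[of \<omega>] by (intro mult_left_mono) auto
      also have "\<dots> = \<bar>x1 - x2\<bar> * exp (2 * B)"
        unfolding p(2) q(2) diff exp_add abs_mult by simp
      also have "\<dots> \<le> \<kappa>" using x by (simp add: pos_less_divide_eq less_imp_le)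
      finally show "\<bar>sol \<sigma> f t \<omega> x1 - sol \<sigma> f t \<omega> x2\<bar> \<le> \<kappa>" .
    qed
  qed
  ultimately show ?thesis
    using closures A_graphs unfolding e_def by blast
qed

end
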